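(* Let $X$ be a complex Banach space, $I=[0,1]$, and let $A(t):D(A(t))\subset X\to X$ ($t\in I$) be densely defined closed linear operators such that for every $\varepsilon\in(0,\infty)$ there is an evolution system $U_\varepsilon$ for $\frac1\varepsilon A$ on $D(A(t))$ and there is a constant $M\in[1,\infty)$ with $\|U_\varepsilon(t,s)\|\le M$ for all $0\le s\le t\le1$ and all $\varepsilon\in(0,\infty)$. Suppose that $\lambda(t)$ for every $t\in I$ is an eigenvalue of $A(t)$ and that there are numbers $\delta_0\in(0,\infty)$ and $\vartheta(t)\in\mathbb R$ such that $\lambda(t)+\delta e^{i\vartheta(t)}\in\rho(A(t))$ for all $\delta\in(0,\delta_0]$ and $t\in I$, such that $t\mapsto\lambda(t)$ and $t\mapsto e^{i\vartheta(t)}$ are continuously differentiable, and such that $t\mapsto\big(\lambda(t)+\delta e^{i\vartheta(t)}-A(t)\big)^{-1}$ is SOT-continuously differentiable (for every $\delta\in(0,\delta_0]$). Suppose that $P(t)$ for every $t\in I$ is a bounded projection in $X$ commuting with $A(t)$ (i.e. $P(t)A(t)\subset A(t)P(t)$) such that $P(t)$ is weakly associated with $A(t)$ and $\lambda(t)$ for almost every $t\in I$ and such that, for some $m_0\in\mathbb N$, $$P(t)X\subset\ker(A(t)-\lambda(t))^{m_0}\quad\text{for every }t\in I.$$ Suppose there are $M_0,M_0'\in(0,\infty)$ such that $$\big\|\big(\lambda(t)+\delta e^{i\vartheta(t)}-A(t)\big)^{-1}(1-P(t))\big\|\le\frac{M_0}{\delta},\qquad\Big\|\frac{d}{dt}\Big(\big(\lambda(t)+\delta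 e^{i\vartheta(t)}-A(t)\big)^{-1}(1-P(t))\Big)\Big\|\le\frac{M_0'}{\delta^{m_0+1}}$$ for all $\delta\in(0,\delta_0]$ and $t\in I$; let $\operatorname{rk}P(0)<\infty$ and let $t\mapsto P(t)$ be SOT-continuously differentiable. Then $$\sup_{t\in I}\big\|\big(U_\varepsilon(t)-V_{0\,\varepsilon}(t)\big)P(0)\big\|\longrightarrow0\qquad(\varepsilon\searrow0),$$ where $V_{0\,\varepsilon}$ for every $\varepsilon\in(0,\infty)$ denotes the evolution system for $\frac1\varepsilon AP+[P',P]$ on $X$. If, in addition, $X$ is reflexive and $t\mapsto P(t)$ is norm continuously differentiable, then $$\sup_{t\in I}\|U_\varepsilon(t)-V_\varepsilon(t)\|\longrightarrow0\qquad(\varepsilon\searrow0),$$ whenever the evolution system $V_\varepsilon$ for $\frac1\varepsilon A+[P',P]$ exists on $D(A(t))$ for every $\varepsilon\in(0,\infty)$.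
   Context: SOT = strong operator topology (derivatives of operator-valued maps are taken in SOT); $[B,C]=BC-CB$; $AP$ denotes the family $t\mapsto A(t)P(t)$ (bounded operators here). Evolution system for a family $A$ of linear operators $A(t)$ ($t\in I$) on the spaces $D(A(t))$: bounded operators $U(t,s)$, $0\le s\le t\le1$, such that (i) for every $s\in[0,1)$ and $y\in D(A(s))$, $[s,1]\ni t\mapsto U(t,s)y$ is a continuously differentiable solution of $x'=A(t)x$, $x(s)=y$; (ii) $U(t,s)U(s,r)=U(t,r)$ for $r\le s\le t$ and $(s,t)\mapsto U(t,s)x$ is continuous for all $x\in X$. It is unique if it exists; $U(t):=U(t,0)$. Weakly associated: for a densely defined closed $A$ with $\rho(A)\neq\emptyset$ and $\lambda\in\sigma(A)$, a bounded projection $P$ is weakly associated with $A$ and $\lambda$ if $PA\subset AP$, $PD(A)=PX$, $A|_{PD(A)}-\lambda$ is nilpotent, and $A|_{(1-P)D(A)}-\lambda$ is injective with dense range in $(1-P)X$. *)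

theory Defs
  imports "HOL-Analysis.Analysis"
begin

class complex_banach = banach +
  fixes scaleC :: "complex \<Rightarrow> 'a \<Rightarrow> 'a"  (infixr "*\<^sub>C" 75)
  assumes scaleC_add_right: "a *\<^sub>C (x + y) = a *\<^sub>C x + a *\<^sub>C y"
    and scaleC_add_left: "(a + b) *\<^sub>C x = a *\<^sub>C x + b *\<^sub>C x"
    and scaleC_scaleC: "a *\<^sub>C (b *\<^sub>C x) = (a * b) *\<^sub>C x"
    and scaleC_one: "1 *\<^sub>C x = x"
    and scaleR_scaleC: "r *\<^sub>R x = complex_of_real r *\<^sub>C x"
    and norm_scaleC: "norm (a *\<^sub>C x) = cmod a * norm x"

global_interpretation complex_vector: vector_space "scaleC :: complex \<Rightarrow> 'a::complex_banach \<Rightarrow> 'a"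
  by unfold_locales
    (simp_all add: scaleC_add_right scaleC_add_left scaleC_scaleC scaleC_one)

text \<open>Bounded operators are elements of the library type \<^typ>\<open>'a \<Rightarrow>\<^sub>L 'a\<close>, which only records
  real linearity; complex linearity is imposed by the following predicate. The operator norm is
  the same in both settings.\<close>

definition complex_linear_op :: "('a::complex_banach \<Rightarrow>\<^sub>L 'a) \<Rightarrow> bool" where
  "complex_linear_op T \<longleftrightarrow> (\<forall>c x. T (c *\<^sub>C x) = c *\<^sub>C T x)"

definition commutator :: "('a::complex_banach \<Rightarrow>\<^sub>L 'a) \<Rightarrow> ('a \<Rightarrow>\<^sub>L 'a) \<Rightarrow> ('a \<Rightarrow>\<^sub>L 'a)" where
  "commutator B C = (B o\<^sub>L C) - (C o\<^sub>L B)"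

definition finite_rank :: "('a::complex_banach \<Rightarrow>\<^sub>L 'a) \<Rightarrow> bool" where
  "finite_rank T \<longleftrightarrow> (\<exists>B. finite B \<and> range T \<subseteq> complex_vector.span B)"

definition bounded_projection :: "('a::complex_banach \<Rightarrow>\<^sub>L 'a) \<Rightarrow> bool" where
  "bounded_projection P \<longleftrightarrow> complex_linear_op P \<and> P o\<^sub>L P = P"


text \<open>An unbounded operator is a pair of a domain \<open>D\<close> and a function \<open>A\<close> whose values outside \<open>D\<close>
  are irrelevant.\<close>

definition linear_operator :: "'a::complex_banach set \<Rightarrow> ('a \<Rightarrow> 'a) \<Rightarrow> bool" where
  "linear_operator D A \<longleftrightarrow> complex_vector.subspace D \<and>
     (\<forall>x\<in>D. \<forall>y\<in>D. A (x + y) = A x + A y) \<and> (\<forall>c. \<forall>x\<in>D. A (c *\<^sub>C x) = c *\<^sub>C A x)"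

definition densely_defined_closed :: "'a::complex_banach set \<Rightarrow> ('a \<Rightarrow> 'a) \<Rightarrow> bool" where
  "densely_defined_closed D A \<longleftrightarrow>
     linear_operator D A \<and> closure D = UNIV \<and> closed ((\<lambda>x. (x, A x)) ` D)"

definition is_resolvent :: "'a::complex_banach set \<Rightarrow> ('a \<Rightarrow> 'a) \<Rightarrow> complex \<Rightarrow> ('a \<Rightarrow>\<^sub>L 'a) \<Rightarrow> bool" where
  "is_resolvent D A z R \<longleftrightarrow>
     (\<forall>y. R y \<in> D \<and> z *\<^sub>C R y - A (R y) = y) \<and> (\<forall>x\<in>D. R (z *\<^sub>C x - A x) = x)"

definition resolvent_set :: "'a::complex_banach set \<Rightarrow> ('a \<Rightarrow> 'a) \<Rightarrow> complex set" where
  "resolvent_set D A = {z. \<exists>R. is_resolvent D A z R}"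

definition resolvent :: "'a::complex_banach set \<Rightarrow> ('a \<Rightarrow> 'a) \<Rightarrow> complex \<Rightarrow> ('a \<Rightarrow>\<^sub>L 'a)" where
  "resolvent D A z = (THE R. is_resolvent D A z R)"

definition spectrum :: "'a::complex_banach set \<Rightarrow> ('a \<Rightarrow> 'a) \<Rightarrow> complex set" where
  "spectrum D A = - resolvent_set D A"

definition eigenvalue :: "'a::complex_banach set \<Rightarrow> ('a \<Rightarrow> 'a) \<Rightarrow> complex \<Rightarrow> bool" where
  "eigenvalue D A l \<longleftrightarrow> (\<exists>x\<in>D. x \<noteq> 0 \<and> A x = l *\<^sub>C x)"

definition shifted :: "('a::complex_banach \<Rightarrow> 'a) \<Rightarrow> complex \<Rightarrow> 'a \<Rightarrow> 'a" where
  "shifted A l x = A x - l *\<^sub>C x"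

text \<open>The membership conditions describe the natural domain of the power \<open>(A - l)\<^sup>m\<close>.\<close>

definition kernel_power :: "'a::complex_banach set \<Rightarrow> ('a \<Rightarrow> 'a) \<Rightarrow> complex \<Rightarrow> nat \<Rightarrow> 'a set" where
  "kernel_power D A l m =
     {x. (\<forall>k<m. (shifted A l ^^ k) x \<in> D) \<and> (shifted A l ^^ m) x = 0}"

text \<open>The inclusion \<open>P A \<subseteq> A P\<close> of unbounded operators.\<close>

definition commutes_with :: "('a::complex_banach \<Rightarrow>\<^sub>L 'a) \<Rightarrow> 'a set \<Rightarrow> ('a \<Rightarrow> 'a) \<Rightarrow> bool" where
  "commutes_with P D A \<longleftrightarrow> (\<forall>x\<in>D. P x \<in> D \<and> P (A x) = A (P x))"

definition weakly_associated ::
    "'a::complex_banach set \<Rightarrow> ('a \<Rightarrow> 'a) \<Rightarrow> complex \<Rightarrow> ('a \<Rightarrow>\<^sub>L 'a) \<Rightarrow> bool" where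
  "weakly_associated D A l P \<longleftrightarrow>
     densely_defined_closed D A \<and> resolvent_set D A \<noteq> {} \<and> l \<in> spectrum D A \<and>
     bounded_projection P \<and> commutes_with P D A \<and> P ` D = range P \<and>
     (\<exists>n. \<forall>x\<in>P ` D. (shifted A l ^^ n) x = 0) \<and>
     inj_on (shifted A l) ((id_blinfun - P) ` D) \<and>
     closure (shifted A l ` (id_blinfun - P) ` D) = range (id_blinfun - P)"


text \<open>Derivatives are taken within \<open>S\<close>, hence are one-sided at endpoints of an interval.\<close>

definition C1_on :: "real set \<Rightarrow> (real \<Rightarrow> 'b::real_normed_vector) \<Rightarrow> bool" where
  "C1_on S f \<longleftrightarrow> (\<exists>f'. (\<forall>t\<in>S. (f has_vector_derivative f' t) (at t within S)) \<and>
     continuous_on S f')"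

definition has_sot_derivative ::
    "(real \<Rightarrow> 'a::complex_banach \<Rightarrow>\<^sub>L 'a) \<Rightarrow> ('a \<Rightarrow>\<^sub>L 'a) \<Rightarrow> real \<Rightarrow> real set \<Rightarrow> bool" where
  "has_sot_derivative F G t S \<longleftrightarrow>
     (\<forall>x. ((\<lambda>s. F s x) has_vector_derivative G x) (at t within S))"

definition sot_C1_on :: "real set \<Rightarrow> (real \<Rightarrow> 'a::complex_banach \<Rightarrow>\<^sub>L 'a) \<Rightarrow> bool" where
  "sot_C1_on S F \<longleftrightarrow> (\<exists>F'. (\<forall>t\<in>S. has_sot_derivative F (F' t) t S) \<and>
     (\<forall>x. continuous_on S (\<lambda>t. F' t x)))"

definition sot_deriv ::
    "real set \<Rightarrow> (real \<Rightarrow> 'a::complex_banach \<Rightarrow>\<^sub>L 'a) \<Rightarrow> real \<Rightarrow> 'a \<Rightarrow>\<^sub>L 'a" where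
  "sot_deriv S F t = (THE G. has_sot_derivative F G t S)"


text \<open>Evolution system on the parameter interval \<open>[0, 1]\<close> for the family of operators \<open>A t\<close> with
  domains \<open>D t\<close>; only the values \<open>U t s\<close> with \<open>0 \<le> s \<le> t \<le> 1\<close> matter.\<close>

definition evolution_system ::
    "(real \<Rightarrow> 'a::complex_banach set) \<Rightarrow> (real \<Rightarrow> 'a \<Rightarrow> 'a) \<Rightarrow> (real \<Rightarrow> real \<Rightarrow> 'a \<Rightarrow>\<^sub>L 'a) \<Rightarrow> bool" where
  "evolution_system D A U \<longleftrightarrow>
     (\<forall>s t. 0 \<le> s \<and> s \<le> t \<and> t \<le> 1 \<longrightarrow> complex_linear_op (U t s)) \<and>
     (\<forall>s\<in>{0..<1}. \<forall>y\<in>D s. U s s y = y \<and>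
        (\<forall>t\<in>{s..1}. U t s y \<in> D t \<and>
           ((\<lambda>r. U r s y) has_vector_derivative A t (U t s y)) (at t within {s..1})) \<and>
        continuous_on {s..1} (\<lambda>t. A t (U t s y))) \<and>
     (\<forall>r s t. 0 \<le> r \<and> r \<le> s \<and> s \<le> t \<and> t \<le> 1 \<longrightarrow> U t s o\<^sub>L U s r = U t r) \<and>
     (\<forall>x. continuous_on {(s, t). 0 \<le> s \<and> s \<le> t \<and> t \<le> 1} (\<lambda>(s, t). U t s x))"


definition complex_dual :: "('a::complex_banach \<Rightarrow>\<^sub>L complex) set" where
  "complex_dual = {f :: 'a \<Rightarrow>\<^sub>L complex. \<forall>c x. f (c *\<^sub>C x) = c * f x}"

text \<open>Every bounded complex-linear functional on the complex dual is evaluation at a point.\<close>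

definition reflexive_space :: "'a::complex_banach itself \<Rightarrow> bool" where
  "reflexive_space _ \<longleftrightarrow> (\<forall>\<Phi> :: ('a \<Rightarrow>\<^sub>L complex) \<Rightarrow> complex.
     (\<forall>f\<in>complex_dual. \<forall>g\<in>complex_dual. \<Phi> (f + g) = \<Phi> f + \<Phi> g) \<and>
     (\<forall>c. \<forall>f\<in>complex_dual. \<Phi> (blinfun_mult_right c o\<^sub>L f) = c * \<Phi> f) \<and>
     (\<exists>K. \<forall>f\<in>complex_dual. norm (\<Phi> f) \<le> K * norm f)
     \<longrightarrow> (\<exists>x. \<forall>f\<in>complex_dual. \<Phi> f = f x))"

end

theory Submission
  imports Defs
begin

text \<open>For a solution \<open>v\<close> of \<open>v' = (1/\<epsilon>) A v + [P',P] v\<close>, such as \<open>V\<^sub>0 P(0) x\<close> or \<open>V x\<close>, the difference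
  \<open>v(t) - U(t,0) v(0)\<close> is the integral of \<open>U(t,s) [P',P](s) v(s)\<close>. Since \<open>[P',P]\<close> exchanges
  the ranges of \<open>P\<close> and \<open>1 - P\<close>, it is enough to treat \<open>E = (1 - P) P' P\<close> and \<open>E = P P' (1 - P)\<close>,
  where \<open>P'\<close> may be replaced by a difference quotient, so that \<open>E\<close> becomes strongly differentiable.
  In the first case \<open>B = R\<^sub>\<delta> E\<close> satisfies \<open>A B - B A = \<delta> e\<^sup>i\<^sup>\<theta> B - E - B N\<close> on the range of \<open>P\<close>, with the
  nilpotent \<open>N = (A - \<lambda>) P\<close>. For fixed \<open>\<delta>\<close>, an integration by parts shows that the commutator
  contributes \<open>O(\<epsilon>)\<close>; the term \<open>B N\<close> is handled by induction on the nilpotency index; and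
  \<open>\<delta> B\<close> is small in the mean as \<open>\<delta>\<close> tends to zero, because weak associatedness makes
  \<open>\<delta> R\<^sub>\<delta> (1 - P)\<close> converge strongly to zero almost everywhere, and \<open>P\<close> has finite rank. The second case
  is dual, with \<open>B = E R\<^sub>\<delta>\<close>; there the norm convergence of \<open>E \<delta> R\<^sub>\<delta> (1 - P)\<close> comes from
  reflexivity.\<close>

subsection \<open>The uniform boundedness principle\<close>

text \<open>The domains \<open>D t\<close> vary with \<open>t\<close>, so
  \<open>U \<epsilon> t s y\<close> need not be differentiable in \<open>s\<close>. The comparison
  with \<open>U\<close> therefore rests on right derivatives and on a fundamental theorem for them.
  Since \<open>P'\<close> is only strongly continuous, all calculus is done for strongly continuous
  families, with norm bounds supplied by uniform boundedness. The order of choices matters: the step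
  of the difference quotient and then \<delta> are fixed by the desired accuracy, and \<epsilon>
  comes last, so the constants of the integration by parts may depend on \<delta>. All other errors
  stand under an integral, so convergence at almost every time suffices. The two cases need
  different kinds of convergence. Solutions in the range of \<open>P\<close> are combinations of
  finitely many curves, obtained by transporting vectors that span the range of \<open>P 0\<close>
  with the propagator of \<open>[P', P]\<close>; strong convergence along these curves is enough.
  Solutions in the kernel admit no such finite description, and there operator norms have to
  converge. This is where norm differentiability of \<open>P\<close> and reflexivity enter.\<close>

lemma uniform_boundedness:
  fixes T :: "'i \<Rightarrow> 'a::banach \<Rightarrow>\<^sub>L 'b::real_normed_vector"
  assumes pw: "\<And>x. bounded ((\<lambda>i. T i x) ` S)"
  obtains K where "K > 0" "\<And>i. i \<in> S \<Longrightarrow> norm (T i) \<le> K"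
proof -
  define F where "F n = {x. \<forall>i\<in>S. norm (T i x) \<le> real n}" for n
  have F_eq: "F n = (\<Inter>i\<in>S. {x. norm (T i x) \<le> real n})" for n
    by (auto simp: F_def)
  have clo: "closed (F n)" for n
    unfolding F_eq by (intro closed_INT ballI closed_Collect_le continuous_intros)
  have "x \<in> \<Union> (range F)" for x
  proof -
    obtain a where "\<And>i. i \<in> S \<Longrightarrow> norm (T i x) \<le> a"
      using pw[of x] by (auto simp: bounded_iff)
    moreover obtain n where "a \<le> real n" using real_arch_simple by blast
    ultimately have "x \<in> F n" unfolding F_def by force
    then show ?thesis by blast
  qed
  then have un: "\<Union> (range F) = UNIV" by auto
  have "\<exists>n. interior (F n) \<noteq> {}"
  proof (rule ccontr)
    assume "\<not> ?thesis"
    moreover have "Met_TC.mcomplete TYPE('a)"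
      by (simp add: mcomplete_iff_complete complete_UNIV)
    ultimately have "Met_TC.mtopology interior_of \<Union> (range F) = {}"
      by (intro Met_TC.metric_Baire_category_alt) (auto simp: clo)
    then show False unfolding un by simp
  qed
  then obtain n x r where r: "r > 0" and sub: "cball x r \<subseteq> F n"
    by (metis ex_in_conv interior_subset mem_interior_cball)
  have "norm (T i) \<le> 2 * real n / r" if "i \<in> S" for i
  proof (rule norm_blinfun_bound)
    show "0 \<le> 2 * real n / r" using r by simp
    fix y
    show "norm (T i y) \<le> 2 * real n / r * norm y"
    proof (cases "y = 0")
      case False
      define z where "z = (r / norm y) *\<^sub>R y"
      have "x \<in> cball x r" "x + z \<in> cball x r"
        using r False by (auto simp: z_def dist_norm)
      then have "norm (T i x) \<le> n" "norm (T i (x + z)) \<le> n"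
        using sub that unfolding F_def by blast+
      then have "norm (T i (x + z) - T i x) \<le> 2 * real n"
        by (smt (verit) norm_triangle_ineq4)
      then have "r / norm y * norm (T i y) \<le> 2 * real n"
        using r by (simp add: z_def blinfun.bilinear_simps)
      then show ?thesis using r False by (simp add: field_simps)
    qed simp
  qed
  \<comment> \<open>The added 1 keeps the constant positive when \<open>n = 0\<close>.\<close>
  then have "norm (T i) \<le> 2 * real n / r + 1" if "i \<in> S" for i
    using that by (smt (verit))
  moreover have "2 * real n / r + 1 > 0" using r by (simp add: add_nonneg_pos)
  ultimately show thesis using that by blast
qed

subsection \<open>A Hahn--Banach theorem\<close>

definition sublinear :: "('a::real_vector \<Rightarrow> real) \<Rightarrow> bool" where
  "sublinear q \<longleftrightarrow> (\<forall>x y. q (x + y) \<le> q x + q y) \<and> (\<forall>c\<ge>0. \<forall>x. q (c *\<^sub>R x) = c * q x)"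

lemma sublinear_zero: "sublinear q \<Longrightarrow> q 0 = 0"
  unfolding sublinear_def by (metis mult_zero_left order_refl scaleR_zero_left)

lemma sublinear_minus: "sublinear q \<Longrightarrow> - q (- x) \<le> q x"
  using sublinear_zero[of q] unfolding sublinear_def
  by (metis add.right_inverse add_0 add_le_cancel_right minus_add_cancel add.commute)

text \<open>Applied to \<open>1 / c\<close> and \<open>c *\<^sub>R x\<close>, the inequality turns
  into its own converse. For functionals defined as infima only the upper estimate is then left to
  check.\<close>

lemma sublinear_homogeneousI:
  fixes q :: "'a::real_vector \<Rightarrow> real"
  assumes zero: "q 0 = 0"
    and le: "\<And>c x. c > 0 \<Longrightarrow> q (c *\<^sub>R x) \<le> c * q x"
    and c: "c \<ge> 0"
  shows "q (c *\<^sub>R x) = c * q x"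
proof (cases "c = 0")
  case False
  then have c: "c > 0" using c by simp
  have "q ((1/c) *\<^sub>R (c *\<^sub>R x)) \<le> (1/c) * q (c *\<^sub>R x)"
    using c by (intro le) simp
  moreover have "(1/c) *\<^sub>R (c *\<^sub>R x) = x" using c by simp
  ultimately have "c * q x \<le> q (c *\<^sub>R x)" using c by (simp add: pos_le_divide_eq mult.commute)
  with le[OF c, of x] show ?thesis by simp
qed (simp add: zero)

text \<open>The functional \<open>r\<close> is the largest sublinear one below \<open>q\<close> with
  \<open>r (- y) \<le> - q y\<close>; it is linear on the line through \<open>y\<close>. A minimal
  \<open>q\<close> must equal all its reductions, and a reduction also serves to force a nonzero
  value at a prescribed point.\<close>

lemma sublinear_reduce:
  fixes q :: "'a::real_vector \<Rightarrow> real" and x y :: 'a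
  assumes q: "sublinear q"
  defines "r \<equiv> \<lambda>x. INF t\<in>{0..}. q (x + t *\<^sub>R y) - t * q y"
  shows "sublinear r" "r x \<le> q x" "r x \<le> q (x + y) - q y"
proof -
  have q1: "q (x + y) \<le> q x + q y" and q2: "c \<ge> 0 \<Longrightarrow> q (c *\<^sub>R x) = c * q x" for x y c
    using q by (auto simp: sublinear_def)
  \<comment> \<open>Subadditivity for \<open>x + t *\<^sub>R y\<close> and \<open>- x\<close> gives
    a lower bound free of \<open>t\<close>, so the infimum is finite.\<close>
  have lower: "- q (- x) \<le> q (x + t *\<^sub>R y) - t * q y" if "t \<ge> 0" for t x
    using q1[of "x + t *\<^sub>R y" "- x"] q2[of t y] that by simp
  have bdd: "bdd_below ((\<lambda>t. q (x + t *\<^sub>R y) - t * q y) ` {0..})" for x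
    using lower by (intro bdd_belowI2[where m = "- q (- x)"]) auto
  have upper: "r x \<le> q (x + t *\<^sub>R y) - t * q y" if "t \<ge> 0" for t x
    unfolding r_def using bdd that by (intro cINF_lower) auto
  have greatest: "a \<le> r x" if "\<And>t. t \<ge> 0 \<Longrightarrow> a \<le> q (x + t *\<^sub>R y) - t * q y" for a x
    unfolding r_def using that by (intro cINF_greatest) auto
  have "r 0 = 0"
    using upper[of 0 0] greatest[of 0 0] lower[of _ 0] sublinear_zero[OF q]
    by (intro antisym) auto
  moreover have "r (c *\<^sub>R x) \<le> c * r x" if "c > 0" for c x
  proof -
    have "r (c *\<^sub>R x) / c \<le> r x"
    proof (rule greatest)
      fix t :: real assume t: "t \<ge> 0"
      have "r (c *\<^sub>R x) \<le> q (c *\<^sub>R (x + t *\<^sub>R y)) - (c * t) * q y"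
        using upper[of "c * t" "c *\<^sub>R x"] that t by (simp add: scaleR_add_right)
      also have "\<dots> = c * (q (x + t *\<^sub>R y) - t * q y)"
        using that by (subst q2) (auto simp: algebra_simps)
      finally show "r (c *\<^sub>R x) / c \<le> q (x + t *\<^sub>R y) - t * q y"
        using that by (simp add: field_simps)
    qed
    then show ?thesis using that by (simp add: field_simps)
  qed
  moreover have "r (x + x') \<le> r x + r x'" for x x'
  proof -
    have "r (x + x') - r x \<le> r x'"
    proof (rule greatest)
      fix t' :: real assume t': "t' \<ge> 0"
      have "r (x + x') - (q (x' + t' *\<^sub>R y) - t' * q y) \<le> r x"
      proof (rule greatest)
        fix t :: real assume t: "t \<ge> 0"
        have "r (x + x') \<le> q (x + x' + (t + t') *\<^sub>R y) - (t + t') * q y"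
          using t t' by (intro upper) simp
        also have "x + x' + (t + t') *\<^sub>R y = (x + t *\<^sub>R y) + (x' + t' *\<^sub>R y)"
          by (simp add: algebra_simps)
        finally show "r (x + x') - (q (x' + t' *\<^sub>R y) - t' * q y) \<le> q (x + t *\<^sub>R y) - t * q y"
          using q1[of "x + t *\<^sub>R y" "x' + t' *\<^sub>R y"] by (simp add: algebra_simps)
      qed
      then show "r (x + x') - r x \<le> q (x' + t' *\<^sub>R y) - t' * q y" by simp
    qed
    then show ?thesis by simp
  qed
  ultimately show "sublinear r"
    unfolding sublinear_def by (blast intro: sublinear_homogeneousI)
  show "r x \<le> q x" using upper[of 0 x] by simp
  show "r x \<le> q (x + y) - q y" using upper[of 1 x] by simp
qed

text \<open>A minimal sublinear functional is linear, since otherwise it could be reduced along some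
  direction; this replaces the usual extension of partially defined functionals.\<close>

lemma sublinear_linear_minorant:
  fixes p :: "'a::real_vector \<Rightarrow> real"
  assumes p: "sublinear p"
  obtains f where "linear f" "\<And>x. f x \<le> p x"
proof -
  define Q where "Q = {q. sublinear q \<and> (\<forall>x. q x \<le> p x)}"
  \<comment> \<open>The order is the reverse of the pointwise one, so that a maximal element is a
    minimal functional.\<close>
  define le where "le = (\<lambda>q r. \<forall>x. (r x :: real) \<le> q (x :: 'a))"
  have "\<exists>m\<in>Q. \<forall>a\<in>Q. le m a \<longrightarrow> a = m"
  proof (rule predicate_Zorn)
    show "partial_order_on Q (relation_of le Q)"
      by (rule partial_order_on_relation_ofI)
        (auto simp: le_def fun_eq_iff intro: order_trans antisym)
    fix C assume C: "C \<in> Chains (relation_of le Q)"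
    show "\<exists>u\<in>Q. \<forall>a\<in>C. le a u"
    proof (cases "C = {}")
      case True
      then show ?thesis using p by (auto simp: Q_def)
    next
      case ne: False
      have CQ: "C \<subseteq> Q" and chain: "\<And>a b. a \<in> C \<Longrightarrow> b \<in> C \<Longrightarrow> le a b \<or> le b a"
        using C by (auto simp: Chains_def relation_of_def)
      define u where "u x = (INF q\<in>C. q x)" for x
      have lower: "- p (- x) \<le> q x" if "q \<in> C" for q x
      proof -
        have "q (- x) \<le> p (- x)" "- q (- x) \<le> q x"
          using CQ that sublinear_minus[of q] by (auto simp: Q_def)
        then show ?thesis by simp
      qed
      have bdd: "bdd_below ((\<lambda>q. q x) ` C)" for x
        using lower by (intro bdd_belowI2[where m = "- p (- x)"]) auto
      have upper: "u x \<le> q x" if "q \<in> C" for q x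
        unfolding u_def using bdd that by (intro cINF_lower) auto
      have greatest: "a \<le> u x" if "\<And>q. q \<in> C \<Longrightarrow> a \<le> q x" for a x
        unfolding u_def using that ne by (intro cINF_greatest) auto
      have sub: "q (x + y) \<le> q x + q y" "c \<ge> 0 \<Longrightarrow> q (c *\<^sub>R x) = c * q x" if "q \<in> C" for q x y c
        using that CQ by (auto simp: Q_def sublinear_def)
      have zero: "q 0 = 0" if "q \<in> C" for q
        using that CQ by (auto simp: Q_def sublinear_zero)
      have "u 0 = 0"
        using ne greatest[of 0 0] upper[of _ 0] zero by (metis antisym equals0I order_refl)
      moreover have "u (c *\<^sub>R x) \<le> c * u x" if "c > 0" for c x
      proof -
        have "u (c *\<^sub>R x) / c \<le> u x"
          using that upper[of _ "c *\<^sub>R x"] sub(2)[of _ c x]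
          by (intro greatest) (fastforce simp: field_simps)
        then show ?thesis using that by (simp add: field_simps)
      qed
      moreover have "u (x + y) \<le> u x + u y" for x y
      proof -
        have "u (x + y) - u x \<le> u y"
        proof (rule greatest)
          fix q assume q: "q \<in> C"
          have "u (x + y) - q y \<le> u x"
          proof (rule greatest)
            fix q' assume q': "q' \<in> C"
            \<comment> \<open>Of two members of the chain, the smaller one is subadditive and lies
              below both.\<close>
            have "u (x + y) \<le> q' x + q y"
              using chain[OF q q'] upper[OF q, of "x + y"] upper[OF q', of "x + y"]
                sub(1)[OF q, of x y] sub(1)[OF q', of x y]
              unfolding le_def by (smt (verit))
            then show "u (x + y) - q y \<le> q' x" by simp
          qed
          then show "u (x + y) - u x \<le> q y" by simp
        qed
        then show ?thesis by simp
      qed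
      ultimately have "sublinear u"
        unfolding sublinear_def by (blast intro: sublinear_homogeneousI)
      moreover have "u x \<le> p x" for x
        using ne upper[of _ x] CQ unfolding Q_def by (force intro: order_trans)
      ultimately show ?thesis
        using upper by (auto simp: Q_def le_def)
    qed
  qed
  then obtain q where q: "sublinear q" "\<And>x. q x \<le> p x"
    and min0: "\<And>r. r \<in> Q \<Longrightarrow> (\<And>x. r x \<le> q x) \<Longrightarrow> r = q"
    unfolding Q_def le_def by blast
  have min: "r = q" if "sublinear r" "\<And>x. r x \<le> q x" for r
    using min0[of r] that q(2) order_trans unfolding Q_def by blast
  have add: "q (x + y) = q x + q y" for x y
  proof -
    have "q x \<le> q (x + y) - q y"
      using sublinear_reduce(3)[OF q(1), of x y]
        min[OF sublinear_reduce(1)[OF q(1), where y = y] sublinear_reduce(2)[OF q(1), where y = y]]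
      by (simp only: fun_eq_iff)
    then show ?thesis using q(1) by (auto simp: sublinear_def intro: antisym)
  qed
  have minus: "q (- x) = - q x" for x
    using add[of x "- x"] sublinear_zero[OF q(1)] by simp
  have "q (c *\<^sub>R x) = c *\<^sub>R q x" for c x
  proof (cases "c \<ge> 0")
    case False
    then have "q ((- c) *\<^sub>R x) = (- c) * q x"
      using q(1) unfolding sublinear_def by (metis linear neg_0_le_iff_le)
    then show ?thesis using minus[of "c *\<^sub>R x"] by simp
  qed (use q(1) in \<open>auto simp: sublinear_def\<close>)
  with add q(2) show thesis by (intro that[of q] linearI)
qed

text \<open>This is the quotient seminorm modulo \<open>S\<close>. A linear functional below it
  vanishes on \<open>S\<close> and has norm at most 1.\<close>

lemma sublinear_infdist:
  fixes S :: "'a::real_normed_vector set"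
  assumes "subspace S"
  shows "sublinear (\<lambda>x. infdist x S)"
proof -
  have ne: "S \<noteq> {}" using subspace_0[OF assms] by blast
  have greatest: "a \<le> infdist x S" if "\<And>s. s \<in> S \<Longrightarrow> a \<le> norm (x - s)" for a x
    using that ne by (auto simp: infdist_notempty dist_norm intro!: cINF_greatest)
  have "infdist 0 S = 0" using subspace_0[OF assms] by simp
  moreover have "infdist (c *\<^sub>R x) S \<le> c * infdist x S" if c: "c > 0" for c x
  proof -
    have "infdist (c *\<^sub>R x) S / c \<le> infdist x S"
    proof (rule greatest)
      fix s assume "s \<in> S"
      then have "infdist (c *\<^sub>R x) S \<le> norm (c *\<^sub>R x - c *\<^sub>R s)"
        using assms by (metis dist_norm infdist_le subspace_scale)
      also have "\<dots> = c * norm (x - s)" using c by (simp flip: scaleR_diff_right)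
      finally show "infdist (c *\<^sub>R x) S / c \<le> norm (x - s)" using c by (simp add: field_simps)
    qed
    then show ?thesis using c by (simp add: field_simps)
  qed
  moreover have "infdist (x + y) S \<le> infdist x S + infdist y S" for x y
  proof -
    have "infdist (x + y) S - infdist x S \<le> infdist y S"
    proof (rule greatest)
      fix s assume s: "s \<in> S"
      have "infdist (x + y) S - norm (y - s) \<le> infdist x S"
      proof (rule greatest)
        fix s' assume "s' \<in> S"
        then have "infdist (x + y) S \<le> norm ((x + y) - (s' + s))"
          using s assms by (metis dist_norm infdist_le subspace_add)
        also have "\<dots> \<le> norm (x - s') + norm (y - s)"
          by (metis add_diff_add norm_triangle_ineq)
        finally show "infdist (x + y) S - norm (y - s) \<le> norm (x - s')" by simp
      qed
      then show "infdist (x + y) S - infdist x S \<le> norm (y - s)" by simp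
    qed
    then show ?thesis by simp
  qed
  ultimately show ?thesis
    unfolding sublinear_def by (blast intro: sublinear_homogeneousI[of "\<lambda>x. infdist x S"])
qed

text \<open>Domination by the distance to \<open>S\<close> gives continuity and vanishing on
  \<open>S\<close>, but would allow the zero functional. The distance is therefore first reduced
  along \<open>x\<close>, which forces \<open>f (- x) \<le> - infdist x S < 0\<close>.\<close>

lemma separate_from_closed_subspace:
  fixes S :: "'a::real_normed_vector set"
  assumes S: "subspace S" "closed S" and x: "x \<notin> S"
  obtains \<phi> :: "'a \<Rightarrow>\<^sub>L real" where "\<And>s. s \<in> S \<Longrightarrow> \<phi> s = 0" "\<phi> x \<noteq> 0"
proof -
  define p where "p = (\<lambda>x. infdist x S)"
  have p: "sublinear p" unfolding p_def by (rule sublinear_infdist[OF S(1)])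
  define r where "r = (\<lambda>z. INF t\<in>{0..}. p (z + t *\<^sub>R x) - t * p x)"
  have red: "sublinear r" "\<And>z. r z \<le> p z" "\<And>z. r z \<le> p (z + x) - p x"
    unfolding r_def by (rule sublinear_reduce[OF p])+
  obtain f where f: "linear f" "\<And>z. f z \<le> r z"
    using sublinear_linear_minorant[OF red(1)] by blast
  have fp: "f z \<le> p z" for z using f(2)[of z] red(2)[of z] by linarith
  have fneg: "f (- z) = - f z" for z using f(1) by (rule linear_neg)
  have p_le: "p z \<le> norm z" for z
    using infdist_le[OF subspace_0[OF S(1)], of z] by (simp add: p_def)
  have "norm (f z) \<le> 1 * norm z" for z
    using fp[of z] fp[of "- z"] p_le[of z] p_le[of "- z"] fneg[of z] by (simp add: abs_le_iff)
  then have bl: "bounded_linear f"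
    using f(1) by (intro bounded_linear_intro[where K = 1]) (auto simp: linear_add linear_scale)
  have "f s = 0" if "s \<in> S" for s
    using fp[of s] fp[of "- s"] fneg[of s] that subspace_neg[OF S(1) that] by (simp add: p_def)
  moreover have "f x \<noteq> 0"
  proof -
    have "f (- x) \<le> p (- x + x) - p x" using f(2)[of "- x"] red(3)[of "- x"] by linarith
    moreover have "p x > 0"
      unfolding p_def using S x subspace_0[OF S(1)] by (intro infdist_pos_not_in_closed) auto
    ultimately show ?thesis using fneg[of x] sublinear_zero[OF p] by simp
  qed
  ultimately show thesis
    using that[of "Blinfun f"] bl by (simp add: bounded_linear_Blinfun_apply)
qed

subsection \<open>Operators of finite rank\<close>

text \<open>The constant is the distance from \<open>b\<close> to the closed space \<open>S\<close>;
  scaling by \<open>c\<close> does the rest. The closedness of finite-dimensional spaces and the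
  continuity of coordinates both come from this bound.\<close>

lemma coefficient_bound:
  fixes S :: "'a::complex_banach set"
  assumes S: "complex_vector.subspace S" "closed S" and b: "b \<notin> S"
  obtains d where "d > 0" "\<And>c s. s \<in> S \<Longrightarrow> d * cmod c \<le> norm (c *\<^sub>C b + s)"
proof (rule that)
  show "infdist b S > 0"
    using S b complex_vector.subspace_0[OF S(1)] by (intro infdist_pos_not_in_closed) auto
  fix c s assume s: "s \<in> S"
  show "infdist b S * cmod c \<le> norm (c *\<^sub>C b + s)"
  proof (cases "c = 0")
    case False
    define s' where "s' = (- inverse c) *\<^sub>C s"
    have "s' \<in> S" unfolding s'_def using s S(1) by (rule complex_vector.subspace_scale[rotated])
    then have "infdist b S \<le> norm (b - s')" by (metis infdist_le dist_norm)
    then have "infdist b S * cmod c \<le> cmod c * norm (b - s')"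
      by (simp add: mult.commute mult_left_mono)
    also have "\<dots> = norm (c *\<^sub>C (b - s'))" by (simp add: norm_scaleC)
    also have "c *\<^sub>C (b - s') = c *\<^sub>C b + s"
      using False by (simp add: s'_def scaleC_add_right scaleC_scaleC scaleC_one)
    finally show ?thesis .
  qed simp
qed

lemma bounded_bilinear_scaleC: "bounded_bilinear (scaleC :: complex \<Rightarrow> 'a::complex_banach \<Rightarrow> 'a)"
proof (rule bounded_bilinear.intro)
  show "\<exists>K. \<forall>a b. norm (a *\<^sub>C (b::'a)) \<le> norm a * norm b * K"
    by (rule exI[of _ 1]) (simp add: norm_scaleC)
qed (simp_all add: scaleC_add_right scaleC_add_left scaleR_scaleC scaleC_scaleC
      scaleR_conv_of_real mult.commute)

lemmas tendsto_scaleC = bounded_bilinear.tendsto[OF bounded_bilinear_scaleC]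

lemma closed_complex_span_finite:
  assumes "finite B"
  shows "closed (complex_vector.span (B :: 'a::complex_banach set))"
  using assms
proof (induction B rule: finite_induct)
  case (insert b B)
  let ?S = "complex_vector.span B"
  show ?case
  proof (cases "b \<in> ?S")
    case True
    then show ?thesis using insert.IH by (simp add: complex_vector.span_redundant)
  next
    case False
    obtain d where d: "d > 0" "\<And>c s. s \<in> ?S \<Longrightarrow> d * cmod c \<le> norm (c *\<^sub>C b + s)"
      using coefficient_bound[OF complex_vector.subspace_span insert.IH False] by blast
    show ?thesis
      unfolding closed_sequential_limits
    proof (intro allI impI, elim conjE)
      fix x l assume "\<forall>n. x n \<in> complex_vector.span (insert b B)" and lim: "x \<longlonglongrightarrow> l"
      then obtain c where c: "\<And>n. x n - c n *\<^sub>C b \<in> ?S"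
        unfolding complex_vector.span_breakdown_eq by metis
      \<comment> \<open>The coefficients of \<open>b\<close> inherit the Cauchy property from
        \<open>x\<close>.\<close>
      have cd: "d * cmod (c m - c n) \<le> norm (x m - x n)" for m n
      proof -
        have "d * cmod (c m - c n) \<le>
            norm ((c m - c n) *\<^sub>C b + ((x m - c m *\<^sub>C b) - (x n - c n *\<^sub>C b)))"
          by (rule d(2)[OF complex_vector.span_diff[OF c c]])
        then show ?thesis by (simp add: complex_vector.scale_left_diff_distrib)
      qed
      have "Cauchy c"
      proof (rule metric_CauchyI)
        fix e :: real assume e: "e > 0"
        with lim d(1) obtain N where N: "\<And>m n. m \<ge> N \<Longrightarrow> n \<ge> N \<Longrightarrow> dist (x m) (x n) < d * e"
          using metric_CauchyD[OF LIMSEQ_imp_Cauchy, of x l "d * e"] by auto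
        have "dist (c m) (c n) < e" if "m \<ge> N" "n \<ge> N" for m n
          using cd[of m n] N[OF that] d(1) unfolding dist_norm
          by (metis le_less_trans mult_less_cancel_left_pos)
        then show "\<exists>N. \<forall>m\<ge>N. \<forall>n\<ge>N. dist (c m) (c n) < e" by blast
      qed
      then obtain k where "c \<longlonglongrightarrow> k" using Cauchy_convergent convergent_def by blast
      then have "(\<lambda>n. x n - c n *\<^sub>C b) \<longlonglongrightarrow> l - k *\<^sub>C b"
        by (intro tendsto_diff lim tendsto_scaleC tendsto_const)
      then have "l - k *\<^sub>C b \<in> ?S"
        by (rule closed_sequentially[OF insert.IH c])
      then show "l \<in> complex_vector.span (insert b B)"
        unfolding complex_vector.span_breakdown_eq by blast
    qed
  qed
qed simp

lemma complex_linear_opD: "complex_linear_op T \<Longrightarrow> T (c *\<^sub>C x) = c *\<^sub>C T x"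
  by (simp add: complex_linear_op_def)

text \<open>The functionals are the coordinates of \<open>T x\<close> in a basis \<open>B\<close> of
  a finite-dimensional space containing the range. Each is bounded because its basis vector has
  positive distance from the span of the others.\<close>

lemma finite_rank_decomposition:
  assumes T: "complex_linear_op T" "finite_rank T"
  obtains B f where "finite B" "\<And>b. b \<in> B \<Longrightarrow> f b \<in> complex_dual" "\<And>x. T x = (\<Sum>b\<in>B. f b x *\<^sub>C b)"
proof -
  obtain B0 where B0: "finite B0" "range T \<subseteq> complex_vector.span B0"
    using T(2) by (auto simp: finite_rank_def)
  obtain B where B: "B \<subseteq> B0" "complex_vector.independent B" "B0 \<subseteq> complex_vector.span B"
    by (rule complex_vector.maximal_independent_subset[of B0]) blast
  have fin: "finite B" using B(1) B0(1) finite_subset by blast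
  have T_span: "T x \<in> complex_vector.span B" for x
    using B0(2) complex_vector.span_minimal[OF B(3) complex_vector.subspace_span] by blast
  define rep where "rep = complex_vector.representation B"
  have sum_rep: "(\<Sum>b\<in>B. rep v b *\<^sub>C b) = v" if "v \<in> complex_vector.span B" for v
    unfolding rep_def using complex_vector.sum_representation_eq[OF B(2) that fin] by simp
  have "bounded_linear (\<lambda>x. rep (T x) b)" if b: "b \<in> B" for b
  proof -
    let ?S = "complex_vector.span (B - {b})"
    have "b \<notin> ?S" using B(2) b by (auto simp: complex_vector.dependent_def)
    then obtain d where d: "d > 0" "\<And>c s. s \<in> ?S \<Longrightarrow> d * cmod c \<le> norm (c *\<^sub>C b + s)"
      using coefficient_bound[OF complex_vector.subspace_span closed_complex_span_finite, of "B - {b}"] fin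
      by (metis finite_Diff)
    show ?thesis
    proof (rule bounded_linear_intro[where K = "norm T / d"])
      fix x
      have "T x = rep (T x) b *\<^sub>C b + (\<Sum>a\<in>B-{b}. rep (T x) a *\<^sub>C a)"
        using sum_rep[OF T_span[of x]] sum.remove[OF fin b] by metis
      moreover have "(\<Sum>a\<in>B-{b}. rep (T x) a *\<^sub>C a) \<in> ?S"
        by (intro complex_vector.span_sum complex_vector.span_scale complex_vector.span_base)
      ultimately have "d * cmod (rep (T x) b) \<le> norm (T x)"
        using d(2) by metis
      also have "\<dots> \<le> norm T * norm x" by (rule norm_blinfun)
      finally show "norm (rep (T x) b) \<le> norm x * (norm T / d)"
        using d(1) by (simp add: field_simps)
    qed (simp_all add: rep_def blinfun.bilinear_simps scaleR_scaleC complex_linear_opD[OF T(1)] scaleR_conv_of_real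
        complex_vector.representation_add[OF B(2) T_span T_span]
        complex_vector.representation_scale[OF B(2) T_span])
  qed
  note ap = bounded_linear_Blinfun_apply[OF this]
  show thesis
  proof (rule that[of B "\<lambda>b. Blinfun (\<lambda>x. rep (T x) b)"])
    show "Blinfun (\<lambda>x. rep (T x) b) \<in> complex_dual" if "b \<in> B" for b
      unfolding complex_dual_def mem_Collect_eq ap[OF that]
      by (simp add: rep_def complex_linear_opD[OF T(1)]
        complex_vector.representation_scale[OF B(2) T_span])
    show "T x = (\<Sum>b\<in>B. Blinfun (\<lambda>x. rep (T x) b) x *\<^sub>C b)" for x
      using sum_rep[OF T_span[of x]] by (simp add: ap)
  qed (rule fin)
qed

subsection \<open>Duality in reflexive spaces\<close>

text \<open>A complex-linear functional is determined by its real part: it has to be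
  \<open>\<phi> x - \<i> * \<phi> (\<i> *\<^sub>C x)\<close>.\<close>

lemma complexified_functional:
  fixes \<phi> :: "'a::complex_banach \<Rightarrow>\<^sub>L real"
  obtains g where "g \<in> complex_dual" "\<And>x. Re (g x) = \<phi> x"
proof -
  define h where "h x = Complex (\<phi> x) (- \<phi> (\<i> *\<^sub>C x))" for x
  have "bounded_linear h"
  proof (rule bounded_linear_intro[where K = "2 * norm \<phi>"])
    show "h (x + y) = h x + h y" for x y
      by (simp add: h_def complex_eq_iff blinfun.bilinear_simps scaleC_add_right)
    have "\<i> *\<^sub>C (r *\<^sub>R x) = r *\<^sub>R (\<i> *\<^sub>C x)" for r and x :: 'a
      by (simp add: scaleR_scaleC scaleC_scaleC mult.commute)
    then show "h (r *\<^sub>R x) = r *\<^sub>R h x" for r x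
      by (simp add: h_def complex_eq_iff blinfun.bilinear_simps)
    show "norm (h x) \<le> norm x * (2 * norm \<phi>)" for x
    proof -
      have "norm (h x) \<le> \<bar>\<phi> x\<bar> + \<bar>\<phi> (\<i> *\<^sub>C x)\<bar>"
        using cmod_le[of "h x"] by (simp add: h_def)
      also have "\<dots> \<le> norm \<phi> * norm x + norm \<phi> * norm (\<i> *\<^sub>C x)"
        using norm_blinfun[of \<phi>] by (metis add_mono real_norm_def)
      finally show ?thesis by (simp add: norm_scaleC algebra_simps)
    qed
  qed
  then have ap: "Blinfun h x = h x" for x by (simp add: bounded_linear_Blinfun_apply)
  have "h (c *\<^sub>C x) = c * h x" for c x
  proof -
    have "c *\<^sub>C x = Re c *\<^sub>R x + Im c *\<^sub>R (\<i> *\<^sub>C x)"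
      unfolding scaleR_scaleC scaleC_scaleC scaleC_add_left[symmetric]
      by (simp add: complex_eq_iff)
    moreover have "\<i> *\<^sub>C (c *\<^sub>C x) = Re c *\<^sub>R (\<i> *\<^sub>C x) - Im c *\<^sub>R x"
      unfolding scaleR_scaleC scaleC_scaleC complex_vector.scale_left_diff_distrib[symmetric]
      by (rule arg_cong[where f = "\<lambda>a. a *\<^sub>C x"]) (simp add: complex_eq_iff)
    ultimately show ?thesis
      by (simp add: h_def complex_eq_iff blinfun.bilinear_simps)
  qed
  then show thesis
    by (intro that[of "Blinfun h"]) (auto simp: complex_dual_def ap h_def)
qed

lemma complex_dual_separates_points:
  assumes "\<And>g. g \<in> complex_dual \<Longrightarrow> g x = 0"
  shows "(x :: 'a::complex_banach) = 0"
proof (rule ccontr)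
  assume "x \<noteq> 0"
  then obtain \<phi> :: "'a \<Rightarrow>\<^sub>L real" where "\<phi> x \<noteq> 0"
    using separate_from_closed_subspace[of "{0}" x] by (auto simp: subspace_single_0)
  moreover obtain g where "g \<in> complex_dual" "Re (g x) = \<phi> x"
    using complexified_functional[of \<phi>] by metis
  ultimately show False using assms by force
qed

lemma subspace_closure:
  assumes "subspace (S :: 'a::real_normed_vector set)"
  shows "subspace (closure S)"
proof (rule subspaceI)
  show "0 \<in> closure S" using assms closure_subset subspace_0 by blast
  show "x + y \<in> closure S" if xy: "x \<in> closure S" "y \<in> closure S" for x y
  proof -
    obtain f g where "\<forall>n. f n \<in> S" "f \<longlonglongrightarrow> x" "\<forall>n. g n \<in> S" "g \<longlonglongrightarrow> y"
      using xy unfolding closure_sequential by blast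
    then show ?thesis
      unfolding closure_sequential
      by (intro exI[of _ "\<lambda>n. f n + g n"]) (auto intro: subspace_add[OF assms] tendsto_add)
  qed
  show "c *\<^sub>R x \<in> closure S" if x: "x \<in> closure S" for c x
  proof -
    obtain f where "\<forall>n. f n \<in> S" "f \<longlonglongrightarrow> x"
      using x unfolding closure_sequential by blast
    then show ?thesis
      unfolding closure_sequential
      by (intro exI[of _ "\<lambda>n. c *\<^sub>R f n"]) (auto intro: subspace_scale[OF assms] tendsto_intros)
  qed
qed

text \<open>If \<open>f\<close> had positive distance from the functionals
  \<open>g o\<^sub>L L\<close>, a functional on the dual would separate them. By reflexivity it is
  evaluation at some \<open>x\<close>, with \<open>g (L x) = 0\<close> for all \<open>g\<close>;
  hence \<open>L x = 0\<close>, and injectivity gives \<open>x = 0\<close>, contradicting the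
  separation.\<close>

lemma reflexive_dual_range_dense:
  fixes L :: "'a::complex_banach \<Rightarrow>\<^sub>L 'a"
  assumes refl: "reflexive_space TYPE('a)"
    and L: "complex_linear_op L" and inj: "\<And>x. L x = 0 \<Longrightarrow> x = 0"
    and f: "f \<in> complex_dual" and e: "e > 0"
  obtains g where "g \<in> complex_dual" "norm (f - (g o\<^sub>L L)) < e"
proof -
  define S where "S = (\<lambda>g. g o\<^sub>L L) ` complex_dual"
  \<comment> \<open>Multiplication by the imaginary unit on functionals. The separation is carried
    out over the reals, and \<open>J\<close> serves to complexify the separating functional.\<close>
  define J where "J g = (blinfun_mult_right \<i> o\<^sub>L g)" for g :: "'a \<Rightarrow>\<^sub>L complex"
  have J_dual: "J g \<in> complex_dual" if "g \<in> complex_dual" for g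
    using that by (auto simp: complex_dual_def J_def)
  have subsp: "subspace S"
    unfolding S_def
  proof (rule subspaceI; (elim imageE)?)
    show "0 \<in> (\<lambda>g. g o\<^sub>L L) ` complex_dual"
      by (rule image_eqI[of _ _ 0]) (auto simp: complex_dual_def blinfun_eqI)
    show "x + y \<in> (\<lambda>g. g o\<^sub>L L) ` complex_dual"
      if "x = g o\<^sub>L L" "y = h o\<^sub>L L" "g \<in> complex_dual" "h \<in> complex_dual" for x y g h
      using that
      by (intro image_eqI[of _ _ "g + h"])
        (auto simp: complex_dual_def blinfun.bilinear_simps algebra_simps intro!: blinfun_eqI)
    show "c *\<^sub>R x \<in> (\<lambda>g. g o\<^sub>L L) ` complex_dual"
      if "x = g o\<^sub>L L" "g \<in> complex_dual" for c x g
      using that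
      by (intro image_eqI[of _ _ "c *\<^sub>R g"])
        (auto simp: complex_dual_def blinfun.bilinear_simps intro!: blinfun_eqI)
  qed
  have "f \<in> closure S"
  proof (rule ccontr)
    assume "f \<notin> closure S"
    then obtain \<phi> :: "('a \<Rightarrow>\<^sub>L complex) \<Rightarrow>\<^sub>L real" where
      \<phi>: "\<And>g. g \<in> closure S \<Longrightarrow> \<phi> g = 0" "\<phi> f \<noteq> 0"
      using separate_from_closed_subspace[of "closure S" f] subsp by (auto simp: subspace_closure)
    have \<phi>0: "\<phi> (g o\<^sub>L L) = 0" if "g \<in> complex_dual" for g
      using \<phi>(1)[of "g o\<^sub>L L"] closure_subset[of S] that unfolding S_def by auto
    define \<Phi> where "\<Phi> g = Complex (\<phi> g) (- \<phi> (J g))" for g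
    have J_add: "J (g + h) = J g + J h" for g h
      by (auto simp: J_def blinfun.bilinear_simps algebra_simps intro!: blinfun_eqI)
    have J_norm: "norm (J g) \<le> norm g" for g
      using norm_blinfun[of g] by (intro norm_blinfun_bound) (auto simp: J_def norm_mult)
    have add: "\<Phi> (g + h) = \<Phi> g + \<Phi> h" for g h
      by (simp add: \<Phi>_def J_add blinfun.bilinear_simps complex_eq_iff)
    have hom: "\<Phi> (blinfun_mult_right c o\<^sub>L g) = c * \<Phi> g" for c g
    proof -
      have 1: "blinfun_mult_right c o\<^sub>L g = Re c *\<^sub>R g + Im c *\<^sub>R J g"
        by (auto simp: J_def blinfun.bilinear_simps complex_eq_iff intro!: blinfun_eqI)
      have 2: "J (blinfun_mult_right c o\<^sub>L g) = Re c *\<^sub>R J g - Im c *\<^sub>R g"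
        by (auto simp: J_def blinfun.bilinear_simps complex_eq_iff intro!: blinfun_eqI)
      show ?thesis
        unfolding \<Phi>_def 2 unfolding 1 by (auto simp: complex_eq_iff blinfun.bilinear_simps)
    qed
    have bnd: "norm (\<Phi> g) \<le> (2 * norm \<phi>) * norm g" for g
    proof -
      have "norm (\<Phi> g) \<le> \<bar>\<phi> g\<bar> + \<bar>\<phi> (J g)\<bar>"
        using cmod_le[of "\<Phi> g"] by (simp add: \<Phi>_def)
      also have "\<dots> \<le> norm \<phi> * norm g + norm \<phi> * norm (J g)"
        using norm_blinfun[of \<phi>] by (metis add_mono real_norm_def)
      also have "\<dots> \<le> norm \<phi> * norm g + norm \<phi> * norm g"
        using J_norm by (intro add_left_mono mult_left_mono) auto
      finally show ?thesis by (simp add: mult_ac)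
    qed
    obtain x where x: "\<And>g. g \<in> complex_dual \<Longrightarrow> \<Phi> g = g x"
    proof -
      have "(\<forall>f\<in>complex_dual. \<forall>g\<in>complex_dual. \<Phi> (f + g) = \<Phi> f + \<Phi> g) \<and>
          (\<forall>c. \<forall>f\<in>complex_dual. \<Phi> (blinfun_mult_right c o\<^sub>L f) = c * \<Phi> f) \<and>
          (\<exists>K. \<forall>f\<in>complex_dual. norm (\<Phi> f) \<le> K * norm f)"
        using add hom bnd by blast
      then have "\<exists>x. \<forall>f\<in>complex_dual. \<Phi> f = f x"
        using refl unfolding reflexive_space_def by blast
      then show thesis using that by blast
    qed
    have "g (L x) = 0" if g: "g \<in> complex_dual" for g
    proof -
      have "J (g o\<^sub>L L) = J g o\<^sub>L L" by (auto simp: J_def intro!: blinfun_eqI)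
      then have "\<Phi> (g o\<^sub>L L) = 0"
        using \<phi>0[OF g] \<phi>0[OF J_dual[OF g]] by (simp add: \<Phi>_def complex_eq_iff)
      moreover have "(g o\<^sub>L L) \<in> complex_dual"
        using g L by (auto simp: complex_dual_def complex_linear_op_def)
      ultimately show ?thesis using x[of "g o\<^sub>L L"] by simp
    qed
    then have "x = 0" by (rule inj[OF complex_dual_separates_points])
    then show False using x[OF f] \<phi>(2) by (simp add: \<Phi>_def complex_eq_iff)
  qed
  then obtain s where "s \<in> S" "dist s f < e"
    using e closure_approachable by blast
  then show thesis using that unfolding S_def by (auto simp: dist_norm norm_minus_commute)
qed

text \<open>Functionals of the form \<open>g o\<^sub>L L\<close> composed with \<open>T n\<close>
  tend to zero. They are dense, and the \<open>T n\<close> are uniformly bounded, so this carries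
  over to every functional, and to \<open>E\<close> as a finite sum of functionals times
  vectors.\<close>

lemma reflexive_dual_convergence:
  fixes L :: "'a::complex_banach \<Rightarrow>\<^sub>L 'a"
  assumes refl: "reflexive_space TYPE('a)"
    and L: "complex_linear_op L" "\<And>x. L x = 0 \<Longrightarrow> x = 0"
    and T: "\<And>n. norm (T n) \<le> C" "(\<lambda>n. L o\<^sub>L T n) \<longlonglongrightarrow> 0"
    and E: "complex_linear_op E" "finite_rank E"
  shows "(\<lambda>n. E o\<^sub>L T n) \<longlonglongrightarrow> 0"
proof -
  have "(\<lambda>n. f o\<^sub>L T n) \<longlonglongrightarrow> 0" if f: "f \<in> complex_dual" for f
  proof (rule LIMSEQ_I)
    fix r :: real assume r: "r > 0"
    have C: "C \<ge> 0" using T(1)[of 0] norm_ge_zero order_trans by blast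
    obtain g where g: "g \<in> complex_dual" "norm (f - (g o\<^sub>L L)) < r / (2 * (C + 1))"
      using reflexive_dual_range_dense[OF refl L f, of "r / (2 * (C + 1))"] r C by auto
    obtain N where N: "\<And>n. n \<ge> N \<Longrightarrow> norm (L o\<^sub>L T n) < r / (2 * (norm g + 1))"
      using LIMSEQ_D[OF T(2), of "r / (2 * (norm g + 1))"] r
      by (metis diff_zero add_nonneg_pos divide_pos_pos norm_ge_zero mult_pos_pos zero_less_numeral zero_less_one)
    have "norm (f o\<^sub>L T n) < r" if "n \<ge> N" for n
    proof -
      have "f o\<^sub>L T n = ((f - (g o\<^sub>L L)) o\<^sub>L T n) + (g o\<^sub>L (L o\<^sub>L T n))"
        by (auto simp: blinfun.bilinear_simps intro!: blinfun_eqI)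
      then have "norm (f o\<^sub>L T n) \<le> norm ((f - (g o\<^sub>L L)) o\<^sub>L T n) + norm (g o\<^sub>L (L o\<^sub>L T n))"
        by (metis norm_triangle_ineq)
      also have "\<dots> \<le> norm (f - (g o\<^sub>L L)) * norm (T n) + norm g * norm (L o\<^sub>L T n)"
        by (intro add_mono norm_blinfun_compose)
      also have "\<dots> \<le> r / (2 * (C + 1)) * C + norm g * (r / (2 * (norm g + 1)))"
        using g N[OF that] T(1)[of n] C r by (intro add_mono mult_mono) auto
      also have "\<dots> < r / 2 + r / 2"
      proof (intro add_strict_mono)
        show "r / (2 * (C + 1)) * C < r / 2" using C r by (simp add: field_simps)
        have "norm g * r < (norm g + 1) * r" using r by simp
        then show "norm g * (r / (2 * (norm g + 1))) < r / 2"
          by (simp add: pos_divide_less_eq add_nonneg_pos) (simp add: field_simps)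
      qed
      finally show ?thesis by simp
    qed
    then show "\<exists>N. \<forall>n\<ge>N. norm ((f o\<^sub>L T n) - 0) < r" by auto
  qed note dual = this
  obtain B f where B: "finite B" "\<And>b. b \<in> B \<Longrightarrow> f b \<in> complex_dual" "\<And>x. E x = (\<Sum>b\<in>B. f b x *\<^sub>C b)"
    using finite_rank_decomposition[OF E] by blast
  have bound: "norm (E o\<^sub>L T n) \<le> (\<Sum>b\<in>B. norm (f b o\<^sub>L T n) * norm b)" for n
  proof (rule norm_blinfun_bound)
    fix x
    have "norm ((E o\<^sub>L T n) x) \<le> (\<Sum>b\<in>B. norm (f b (T n x)) * norm b)"
      unfolding blinfun_apply_blinfun_compose B(3)
      by (rule order_trans[OF norm_sum]) (simp add: norm_scaleC)
    also have "\<dots> \<le> (\<Sum>b\<in>B. (norm (f b o\<^sub>L T n) * norm x) * norm b)"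
      using norm_blinfun[of "f b o\<^sub>L T n" x for b] by (intro sum_mono mult_right_mono) auto
    finally show "norm ((E o\<^sub>L T n) x) \<le> (\<Sum>b\<in>B. norm (f b o\<^sub>L T n) * norm b) * norm x"
      by (simp add: sum_distrib_left mult_ac)
  qed (auto intro: sum_nonneg)
  have "(\<lambda>n. \<Sum>b\<in>B. norm (f b o\<^sub>L T n) * norm b) \<longlonglongrightarrow> 0"
  proof (rule tendsto_null_sum)
    fix b assume "b \<in> B"
    then have "(\<lambda>n. norm (f b o\<^sub>L T n)) \<longlonglongrightarrow> 0"
      using tendsto_norm[OF dual[OF B(2)]] by simp
    then show "(\<lambda>n. norm (f b o\<^sub>L T n) * norm b) \<longlonglongrightarrow> 0"
      by (rule tendsto_mult_left_zero)
  qed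
  then show ?thesis
    by (rule Lim_null_comparison[OF always_eventually[OF allI[OF bound]]])
qed

subsection \<open>One-sided derivatives and Gronwall's inequality\<close>

lemma has_vector_derivative_iff_quotient:
  "(f has_vector_derivative f') (at t within S) \<longleftrightarrow>
     ((\<lambda>s. (1 / (s - t)) *\<^sub>R (f s - f t)) \<longlongrightarrow> f') (at t within S)"
proof -
  have eq: "norm ((1 / norm (s - t)) *\<^sub>R (f s - (f t + (s - t) *\<^sub>R f'))) =
      norm ((1 / (s - t)) *\<^sub>R (f s - f t) - f')" if "s \<noteq> t" for s
  proof -
    have "(1 / (s - t)) *\<^sub>R (f s - f t) - f' = (1 / (s - t)) *\<^sub>R (f s - (f t + (s - t) *\<^sub>R f'))"
      using that by (simp add: scaleR_diff_right scaleR_add_right)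
    then show ?thesis by simp
  qed
  have ev: "\<forall>\<^sub>F s in at t within S. norm ((1 / norm (s - t)) *\<^sub>R (f s - (f t + (s - t) *\<^sub>R f'))) =
      norm ((1 / (s - t)) *\<^sub>R (f s - f t) - f')"
    by (rule eventually_mono[OF eventually_neq_at_within[of t t S]]) (rule eq)
  have "(f has_vector_derivative f') (at t within S) \<longleftrightarrow>
      ((\<lambda>s. norm ((1 / norm (s - t)) *\<^sub>R (f s - (f t + (s - t) *\<^sub>R f')))) \<longlongrightarrow> 0) (at t within S)"
    unfolding has_vector_derivative_def has_derivative_within tendsto_norm_zero_iff
    by (simp add: bounded_linear_scaleR_left)
  also have "\<dots> \<longleftrightarrow> ((\<lambda>s. norm ((1 / (s - t)) *\<^sub>R (f s - f t) - f')) \<longlongrightarrow> 0) (at t within S)"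
    by (rule tendsto_cong[OF ev])
  also have "\<dots> \<longleftrightarrow> ((\<lambda>s. (1 / (s - t)) *\<^sub>R (f s - f t)) \<longlongrightarrow> f') (at t within S)"
    by (simp add: tendsto_norm_zero_iff LIM_zero_iff)
  finally show ?thesis .
qed

text \<open>Only right derivatives will be at hand for \<open>U \<epsilon> t s (v s)\<close> as a
  function of \<open>s\<close>, because an evolution system is differentiable in its later time
  alone.\<close>

lemma right_derivative_zero_imp_constant:
  fixes f :: "real \<Rightarrow> 'a::real_normed_vector"
  assumes cont: "continuous_on {a..b} f" and ab: "a \<le> b"
    and der: "\<And>t. a \<le> t \<Longrightarrow> t < b \<Longrightarrow> (f has_vector_derivative 0) (at t within {t..b})"
  shows "f b = f a"
proof -
  have bound: "norm (f b - f a) \<le> e * (b - a)" if e: "e > 0" for e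
  proof -
    \<comment> \<open>Continuity puts the supremum of \<open>G\<close> into \<open>G\<close>, and
      the right derivative at an interior supremum would allow a further step. That \<open>G\<close>
      might have gaps does no harm.\<close>
    define G where "G = {t \<in> {a..b}. norm (f t - f a) \<le> e * (t - a)}"
    have "closed G"
      unfolding G_def by (intro continuous_on_closed_Collect_le continuous_intros cont)
    moreover have "a \<in> G" using ab by (auto simp: G_def)
    moreover have bdd: "bdd_above G" by (auto simp: G_def bdd_above_def)
    ultimately have s: "Sup G \<in> G" using closed_contains_Sup by blast
    define s where "s = Sup G"
    have sG: "s \<in> {a..b}" "norm (f s - f a) \<le> e * (s - a)" using s by (auto simp: G_def s_def)
    have "s = b"
    proof (rule ccontr)
      assume "s \<noteq> b"
      then have sb: "a \<le> s" "s < b" using sG by auto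
      obtain d where d: "d > 0"
        "\<And>y. y \<in> {s..b} \<Longrightarrow> norm (y - s) < d \<Longrightarrow> norm (f y - f s) \<le> e * norm (y - s)"
        using der[OF sb] e unfolding has_vector_derivative_def has_derivative_within_alt by auto
      define y where "y = min b (s + d / 2)"
      have y: "y \<in> {s..b}" "norm (y - s) < d" "s < y" using d(1) sb by (auto simp: y_def min_def)
      have "norm (f y - f a) \<le> norm (f y - f s) + norm (f s - f a)"
        using norm_triangle_ineq[of "f y - f s" "f s - f a"] by simp
      also have "\<dots> \<le> e * (y - s) + e * (s - a)" using d(2)[OF y(1,2)] sG y by auto
      finally have "y \<in> G" using y sb by (auto simp: G_def algebra_simps)
      then have "y \<le> s" unfolding s_def using bdd by (rule cSup_upper)
      then show False using y by simp
    qed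
    then show ?thesis using sG by simp
  qed
  have "norm (f b - f a) \<le> 0"
  proof (rule field_le_epsilon)
    fix e :: real assume e: "e > 0"
    have "norm (f b - f a) \<le> e / (b - a + 1) * (b - a)" using e ab by (intro bound) auto
    also have "\<dots> \<le> e" using e ab by (simp add: field_simps)
    finally show "norm (f b - f a) \<le> 0 + e" by simp
  qed
  then show ?thesis by simp
qed

lemma right_derivative_fundamental_theorem:
  fixes f :: "real \<Rightarrow> 'a::banach"
  assumes cont: "continuous_on {a..b} f" "continuous_on {a..b} g" and ab: "a \<le> b"
    and der: "\<And>t. a \<le> t \<Longrightarrow> t < b \<Longrightarrow> (f has_vector_derivative g t) (at t within {t..b})"
  shows "(g has_integral (f b - f a)) {a..b}"
proof -
  define F where "F t = f t - integral {a..t} g" for t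
  have int: "g integrable_on {a..b}" by (rule integrable_continuous_real[OF cont(2)])
  have "F b = F a"
  proof (rule right_derivative_zero_imp_constant)
    show "continuous_on {a..b} F"
      unfolding F_def by (intro continuous_intros cont indefinite_integral_continuous_1 int)
    fix t assume t: "a \<le> t" "t < b"
    have "((\<lambda>u. integral {a..u} g) has_vector_derivative g t) (at t within {t..b})"
      using integral_has_vector_derivative[OF cont(2), of t] t
      by (auto intro: has_vector_derivative_within_subset)
    from has_vector_derivative_diff[OF der[OF t] this]
    show "(F has_vector_derivative 0) (at t within {t..b})"
      by (simp add: F_def[abs_def])
  qed (rule ab)
  then have "integral {a..b} g = f b - f a" by (simp add: F_def algebra_simps)
  then show ?thesis using int by (metis integrable_integral)
qed

lemma Gronwall:
  fixes u :: "real \<Rightarrow> real"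
  assumes u: "continuous_on {0..1} u" and b: "b \<ge> 0"
    and le: "\<And>t. t \<in> {0..1} \<Longrightarrow> u t \<le> a + b * integral {0..t} u"
    and t: "t \<in> {0..1}"
  shows "u t \<le> a * exp (b * t)"
proof -
  define g where "g s = exp (- b * s) * (a + b * integral {0..s} u)" for s
  have der: "(g has_vector_derivative exp (- b * s) * (b * u s - b * (a + b * integral {0..s} u)))
      (at s within {0..1})" if "s \<in> {0..1}" for s
  proof -
    have "((\<lambda>s. integral {0..s} u) has_real_derivative u s) (at s within {0..1})"
      using integral_has_vector_derivative[OF u that]
      by (simp add: has_real_derivative_iff_has_vector_derivative)
    then have "(g has_real_derivative exp (- b * s) * (b * u s - b * (a + b * integral {0..s} u)))
        (at s within {0..1})"
      unfolding g_def by (auto intro!: derivative_eq_intros simp: algebra_simps)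
    then show ?thesis by (simp add: has_real_derivative_iff_has_vector_derivative)
  qed
  have "g t \<le> g 0"
  proof -
    have "exp (- b * s) * (b * u s - b * (a + b * integral {0..s} u)) \<le> 0" if "s \<in> {0..t}" for s
    proof -
      have "b * u s \<le> b * (a + b * integral {0..s} u)"
        using le[of s] that t b by (intro mult_left_mono) auto
      then show ?thesis by (simp add: mult_nonneg_nonpos)
    qed
    moreover have "((\<lambda>s. exp (- b * s) * (b * u s - b * (a + b * integral {0..s} u))) has_integral g t - g 0) {0..t}"
    proof (rule fundamental_theorem_of_calculus)
      fix s assume "s \<in> {0..t}"
      then show "(g has_vector_derivative exp (- b * s) * (b * u s - b * (a + b * integral {0..s} u)))
          (at s within {0..t})"
        using t by (intro has_vector_derivative_within_subset[OF der]) auto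
    qed (use t in auto)
    ultimately have "g t - g 0 \<le> 0"
      using has_integral_le[OF _ has_integral_0] by blast
    then show ?thesis by simp
  qed
  then have "a + b * integral {0..t} u \<le> a * exp (b * t)"
    by (simp add: g_def exp_minus field_simps)
  with le[OF t] show ?thesis by simp
qed

subsection \<open>Strong differentiability\<close>

text \<open>Continuous images of a compact interval are bounded, so uniform boundedness applies. The
  operator bounds for strongly continuous families used below come from here.\<close>

lemma sot_bounded:
  fixes F :: "real \<Rightarrow> 'a::banach \<Rightarrow>\<^sub>L 'b::real_normed_vector"
  assumes "\<And>x. continuous_on {a..b} (\<lambda>t. F t x)"
  obtains K where "K > 0" "\<And>t. t \<in> {a..b} \<Longrightarrow> norm (F t) \<le> K"
proof (rule uniform_boundedness[where T = F and S = "{a..b}"])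
  show "bounded ((\<lambda>t. F t x) ` {a..b})" for x
    using assms[of x] compact_Icc by (intro compact_imp_bounded compact_continuous_image)
qed (use that in blast)

text \<open>The eventual bound replaces norm convergence: it controls \<open>T s (u s - x)\<close>,
  and strong convergence is needed only at the fixed vector \<open>x\<close>.\<close>

lemma tendsto_sot_apply:
  fixes T :: "'c \<Rightarrow> 'a::real_normed_vector \<Rightarrow>\<^sub>L 'b::real_normed_vector"
  assumes "\<forall>\<^sub>F s in F. norm (T s) \<le> K"
    and "((\<lambda>s. T s x) \<longlongrightarrow> y) F" and "(u \<longlongrightarrow> x) F"
  shows "((\<lambda>s. T s (u s)) \<longlongrightarrow> y) F"
proof -
  have "((\<lambda>s. T s (u s - x)) \<longlongrightarrow> 0) F"
  proof (rule Lim_null_comparison)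
    show "\<forall>\<^sub>F s in F. norm (T s (u s - x)) \<le> \<bar>K\<bar> * norm (u s - x)"
      using assms(1)
    proof eventually_elim
      case (elim s)
      have "norm (T s (u s - x)) \<le> norm (T s) * norm (u s - x)" by (rule norm_blinfun)
      also have "\<dots> \<le> \<bar>K\<bar> * norm (u s - x)" using elim by (intro mult_right_mono) auto
      finally show ?case .
    qed
    have "((\<lambda>s. \<bar>K\<bar> * norm (u s - x)) \<longlongrightarrow> \<bar>K\<bar> * norm (x - x)) F"
      by (intro tendsto_intros assms(3))
    then show "((\<lambda>s. \<bar>K\<bar> * norm (u s - x)) \<longlongrightarrow> 0) F" by simp
  qed
  from tendsto_add[OF this assms(2)] show ?thesis by (simp add: blinfun.bilinear_simps)
qed

lemma continuous_on_sot_apply: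
  fixes T :: "'c::topological_space \<Rightarrow> 'a::real_normed_vector \<Rightarrow>\<^sub>L 'b::real_normed_vector"
  assumes "\<And>s. s \<in> S \<Longrightarrow> norm (T s) \<le> K"
    and "\<And>x. continuous_on S (\<lambda>s. T s x)" and "continuous_on S u"
  shows "continuous_on S (\<lambda>s. T s (u s))"
  unfolding continuous_on_def
proof
  fix t assume t: "t \<in> S"
  show "((\<lambda>s. T s (u s)) \<longlongrightarrow> T t (u t)) (at t within S)"
  proof (rule tendsto_sot_apply)
    show "\<forall>\<^sub>F s in at t within S. norm (T s) \<le> K"
      using assms(1) by (simp add: eventually_at_filter)
    show "((\<lambda>s. T s (u t)) \<longlongrightarrow> T t (u t)) (at t within S)"
      using assms(2)[of "u t"] t unfolding continuous_on_def by blast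
    show "(u \<longlongrightarrow> u t) (at t within S)"
      using assms(3) t unfolding continuous_on_def by blast
  qed
qed

lemma continuous_on_sot_apply_interval:
  fixes T :: "real \<Rightarrow> 'a::banach \<Rightarrow>\<^sub>L 'b::real_normed_vector"
  assumes "\<And>x. continuous_on {a..b} (\<lambda>s. T s x)" and "continuous_on {a..b} u"
  shows "continuous_on {a..b} (\<lambda>s. T s (u s))"
proof -
  obtain K where "\<And>t. t \<in> {a..b} \<Longrightarrow> norm (T t) \<le> K" using sot_bounded[OF assms(1)] by blast
  then show ?thesis by (rule continuous_on_sot_apply[OF _ assms])
qed

text \<open>Product rule in the strong topology. The quotient splits into \<open>F s\<close> applied
  to the quotient of \<open>u\<close> and the quotient of \<open>F\<close> at the fixed vector
  \<open>u t\<close>, so \<open>F\<close> need not be norm continuous.\<close>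

lemma has_vector_derivative_sot_apply:
  fixes F :: "real \<Rightarrow> 'a::real_normed_vector \<Rightarrow>\<^sub>L 'b::real_normed_vector"
  assumes bound: "\<And>s. s \<in> S \<Longrightarrow> norm (F s) \<le> K"
    and cont: "((\<lambda>s. F s u') \<longlongrightarrow> F t u') (at t within S)"
    and F: "((\<lambda>s. F s (u t)) has_vector_derivative g) (at t within S)"
    and u: "(u has_vector_derivative u') (at t within S)"
  shows "((\<lambda>s. F s (u s)) has_vector_derivative g + F t u') (at t within S)"
proof -
  have "((\<lambda>s. F s ((1 / (s - t)) *\<^sub>R (u s - u t))) \<longlongrightarrow> F t u') (at t within S)"
  proof (rule tendsto_sot_apply[OF _ cont u[unfolded has_vector_derivative_iff_quotient]])
    show "\<forall>\<^sub>F s in at t within S. norm (F s) \<le> K"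
      using bound by (simp add: eventually_at_filter)
  qed
  from tendsto_add[OF F[unfolded has_vector_derivative_iff_quotient] this]
  show ?thesis
    unfolding has_vector_derivative_iff_quotient
    by (rule tendsto_cong[THEN iffD1, rotated])
      (auto simp: blinfun.bilinear_simps scaleR_diff_right intro!: always_eventually)
qed

section \<open>Strongly continuously differentiable families\<close>

lemma sot_C1_onE:
  fixes F :: "real \<Rightarrow> 'a::complex_banach \<Rightarrow>\<^sub>L 'a"
  assumes "sot_C1_on {0..1} F"
  obtains F' :: "real \<Rightarrow> 'a \<Rightarrow>\<^sub>L 'a" and K :: real where
    "\<And>t x. t \<in> {0..1} \<Longrightarrow> ((\<lambda>s. F s x) has_vector_derivative F' t x) (at t within {0..1})"
    "\<And>x. continuous_on {0..1} (\<lambda>t. F' t x)" "\<And>x. continuous_on {0..1} (\<lambda>t. F t x)"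
    "\<And>t. t \<in> {0..1} \<Longrightarrow> norm (F t) \<le> K" "\<And>t. t \<in> {0..1} \<Longrightarrow> norm (F' t) \<le> K" "K > 0"
proof -
  obtain F' :: "real \<Rightarrow> 'a \<Rightarrow>\<^sub>L 'a" where F': "\<And>t x. t \<in> {0..1} \<Longrightarrow> ((\<lambda>s. F s x) has_vector_derivative F' t x) (at t within {0..1})"
    "\<And>x. continuous_on {0..1} (\<lambda>t. F' t x)"
    using assms unfolding sot_C1_on_def has_sot_derivative_def by blast
  have c: "continuous_on {0..1} (\<lambda>t. F t x)" for x
    by (rule continuous_on_vector_derivative[OF F'(1)])
  obtain K1 where K1: "\<And>t. t \<in> {0..1} \<Longrightarrow> norm (F t) \<le> K1" "K1 > 0" using sot_bounded[OF c] by blast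
  obtain K2 where K2: "\<And>t. t \<in> {0..1} \<Longrightarrow> norm (F' t) \<le> K2" "K2 > 0" using sot_bounded[OF F'(2)] by blast
  show thesis
    by (rule that[OF F' c, of "K1 + K2"]) (use K1 K2 in \<open>force+\<close>)
qed

lemma sot_C1_onI:
  fixes F F' :: "real \<Rightarrow> 'a::complex_banach \<Rightarrow>\<^sub>L 'a"
  assumes "\<And>t x. t \<in> {0..1} \<Longrightarrow> ((\<lambda>s. F s x) has_vector_derivative F' t x) (at t within {0..1})"
    and "\<And>x. continuous_on {0..1} (\<lambda>t. F' t x)"
  shows "sot_C1_on {0..1} F"
  using assms unfolding sot_C1_on_def has_sot_derivative_def by blast

lemma sot_C1_on_continuous: "sot_C1_on {0..1} F \<Longrightarrow> continuous_on {0..1} (\<lambda>t. F t x)"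
  by (metis sot_C1_onE)

lemma at_within_01: "t \<in> {0..1} \<Longrightarrow> at t within {0..1::real} \<noteq> bot"
  by (auto simp: trivial_limit_within intro!: islimpt_closure_open[where s="{0 <..< 1}"])

lemma sot_deriv_eq:
  assumes "t \<in> {0..1}" "has_sot_derivative F G t {0..1}"
  shows "sot_deriv {0..1} F t = G"
  unfolding sot_deriv_def
proof (rule the_equality[where P = "\<lambda>G. has_sot_derivative F G t {0..1}", OF assms(2)])
  fix H assume "has_sot_derivative F H t {0..1}"
  then show "H = G"
    using assms(2) vector_derivative_unique_within[OF at_within_01[OF assms(1)]]
    unfolding has_sot_derivative_def by (intro blinfun_eqI) blast
qed

lemma sot_C1_on_sot_deriv:
  fixes F :: "real \<Rightarrow> 'a::complex_banach \<Rightarrow>\<^sub>L 'a"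
  assumes "sot_C1_on {0..1} F"
  shows "t \<in> {0..1} \<Longrightarrow> ((\<lambda>s. F s x) has_vector_derivative sot_deriv {0..1} F t x) (at t within {0..1})"
    "continuous_on {0..1} (\<lambda>t. sot_deriv {0..1} F t x)"
proof -
  obtain F' where F': "\<And>t. t \<in> {0..1} \<Longrightarrow> has_sot_derivative F (F' t) t {0..1}"
    "\<And>x. continuous_on {0..1} (\<lambda>t. F' t x)"
    using assms unfolding sot_C1_on_def by blast
  have eq: "sot_deriv {0..1} F t = F' t" if "t \<in> {0..1}" for t
    using sot_deriv_eq[OF that F'(1)[OF that]] .
  show "((\<lambda>s. F s x) has_vector_derivative sot_deriv {0..1} F t x) (at t within {0..1})" if "t \<in> {0..1}"
    using F'(1)[OF that] eq[OF that] by (simp add: has_sot_derivative_def)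
  show "continuous_on {0..1} (\<lambda>t. sot_deriv {0..1} F t x)"
    by (rule continuous_on_cong[THEN iffD1, OF refl _ F'(2)[of x]]) (simp add: eq)
qed

lemma sot_C1_on_compose:
  fixes F G :: "real \<Rightarrow> 'a::complex_banach \<Rightarrow>\<^sub>L 'a"
  assumes "sot_C1_on {0..1} F" "sot_C1_on {0..1} G"
  shows "sot_C1_on {0..1} (\<lambda>t. F t o\<^sub>L G t)"
proof -
  obtain F' :: "real \<Rightarrow> 'a \<Rightarrow>\<^sub>L 'a" and K :: real where F: "\<And>t x. t \<in> {0..1} \<Longrightarrow> ((\<lambda>s. F s x) has_vector_derivative F' t x) (at t within {0..1})"
    "\<And>x. continuous_on {0..1} (\<lambda>t. F' t x)" "\<And>x. continuous_on {0..1} (\<lambda>t. F t x)"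
    "\<And>t. t \<in> {0..1} \<Longrightarrow> norm (F t) \<le> K"
    using assms(1) by (rule sot_C1_onE) blast
  obtain G' :: "real \<Rightarrow> 'a \<Rightarrow>\<^sub>L 'a" where G: "\<And>t x. t \<in> {0..1} \<Longrightarrow> ((\<lambda>s. G s x) has_vector_derivative G' t x) (at t within {0..1})"
    "\<And>x. continuous_on {0..1} (\<lambda>t. G' t x)" "\<And>x. continuous_on {0..1} (\<lambda>t. G t x)"
    using assms(2) by (rule sot_C1_onE) blast
  show ?thesis
  proof (rule sot_C1_onI[where F' = "\<lambda>t. (F' t o\<^sub>L G t) + (F t o\<^sub>L G' t)"])
    fix t :: real and x assume t: "t \<in> {0..1}"
    have "((\<lambda>s. F s (G s x)) has_vector_derivative F' t (G t x) + F t (G' t x)) (at t within {0..1})"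
    proof (rule has_vector_derivative_sot_apply[OF F(4) _ F(1)[OF t] G(1)[OF t]])
      show "((\<lambda>s. F s (G' t x)) \<longlongrightarrow> F t (G' t x)) (at t within {0..1})"
        using F(3)[of "G' t x"] t unfolding continuous_on_def by blast
    qed
    then show "((\<lambda>s. (F s o\<^sub>L G s) x) has_vector_derivative ((F' t o\<^sub>L G t) + (F t o\<^sub>L G' t)) x) (at t within {0..1})"
      by (simp add: blinfun.bilinear_simps)
  next
    fix x
    show "continuous_on {0..1} (\<lambda>t. ((F' t o\<^sub>L G t) + (F t o\<^sub>L G' t)) x)"
      unfolding blinfun.add_left blinfun_apply_blinfun_compose
      by (rule continuous_on_add[OF continuous_on_sot_apply_interval[OF F(2) G(3)]
            continuous_on_sot_apply_interval[OF F(3) G(2)]])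
  qed
qed

lemma sot_C1_on_add:
  fixes F G :: "real \<Rightarrow> 'a::complex_banach \<Rightarrow>\<^sub>L 'a"
  assumes "sot_C1_on {0..1} F" "sot_C1_on {0..1} G"
  shows "sot_C1_on {0..1} (\<lambda>t. F t + G t)"
  by (rule sot_C1_onI[where F' = "\<lambda>t. sot_deriv {0..1} F t + sot_deriv {0..1} G t"])
    (auto simp: blinfun.bilinear_simps intro!: continuous_on_add has_vector_derivative_add sot_C1_on_sot_deriv assms)

lemma sot_C1_on_diff:
  fixes F G :: "real \<Rightarrow> 'a::complex_banach \<Rightarrow>\<^sub>L 'a"
  assumes "sot_C1_on {0..1} F" "sot_C1_on {0..1} G"
  shows "sot_C1_on {0..1} (\<lambda>t. F t - G t)"
  by (rule sot_C1_onI[where F' = "\<lambda>t. sot_deriv {0..1} F t - sot_deriv {0..1} G t"])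
    (auto simp: blinfun.bilinear_simps intro!: continuous_on_diff has_vector_derivative_diff sot_C1_on_sot_deriv assms)

lemma sot_C1_on_scaleR:
  fixes F :: "real \<Rightarrow> 'a::complex_banach \<Rightarrow>\<^sub>L 'a"
  assumes "sot_C1_on {0..1} F"
  shows "sot_C1_on {0..1} (\<lambda>t. c *\<^sub>R F t)"
proof (rule sot_C1_onI[where F' = "\<lambda>t. c *\<^sub>R sot_deriv {0..1} F t"])
  show "((\<lambda>s. (c *\<^sub>R F s) x) has_vector_derivative (c *\<^sub>R sot_deriv {0..1} F t) x) (at t within {0..1})"
    if "t \<in> {0..1}" for t x
    using bounded_linear.has_vector_derivative[OF bounded_linear_scaleR_right sot_C1_on_sot_deriv(1)[OF assms that]]
    by (simp add: blinfun.bilinear_simps)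
qed (auto simp: blinfun.bilinear_simps intro!: continuous_on_scaleR continuous_on_const sot_C1_on_sot_deriv assms)

lemma sot_C1_on_const: "sot_C1_on {0..1} (\<lambda>t. T :: 'a::complex_banach \<Rightarrow>\<^sub>L 'a)"
  by (rule sot_C1_onI[where F' = "\<lambda>t. 0"]) auto

text \<open>Meant for the difference quotients of \<open>P\<close>, whose sampling points are affine
  in \<open>t\<close>.\<close>

lemma sot_C1_on_affine:
  fixes F :: "real \<Rightarrow> 'a::complex_banach \<Rightarrow>\<^sub>L 'a"
  assumes F: "sot_C1_on {0..1} F" and ab: "a \<ge> 0" "b \<ge> 0" "a + b \<le> 1"
  shows "sot_C1_on {0..1} (\<lambda>t. F (a * t + b))"
proof (rule sot_C1_onI[where F' = "\<lambda>t. a *\<^sub>R sot_deriv {0..1} F (a * t + b)"])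
  have "a * t \<le> a" if "t \<in> {0..1}" for t using mult_left_mono[of t 1 a] that ab by simp
  then have im: "(\<lambda>t. a * t + b) ` {0..1} \<subseteq> {0..1}" using ab by fastforce
  fix x
  show "((\<lambda>s. F (a * s + b) x) has_vector_derivative (a *\<^sub>R sot_deriv {0..1} F (a * t + b)) x) (at t within {0..1})"
    if t: "t \<in> {0..1}" for t
  proof -
    have "((\<lambda>t. a * t + b) has_vector_derivative a) (at t within {0..1})"
      unfolding has_real_derivative_iff_has_vector_derivative[symmetric]
      by (auto intro!: derivative_eq_intros)
    moreover have "((\<lambda>s. F s x) has_vector_derivative sot_deriv {0..1} F (a * t + b) x)
        (at (a * t + b) within (\<lambda>t. a * t + b) ` {0..1})"
      using im t by (intro has_vector_derivative_within_subset[OF sot_C1_on_sot_deriv(1)[OF F] im]) blast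
    ultimately show ?thesis
      using vector_diff_chain_within by (fastforce simp: o_def blinfun.bilinear_simps)
  qed
  show "continuous_on {0..1} (\<lambda>t. (a *\<^sub>R sot_deriv {0..1} F (a * t + b)) x)"
    unfolding blinfun.scaleR_left
    by (intro continuous_on_scaleR continuous_on_const
        continuous_on_compose2[OF sot_C1_on_sot_deriv(2)[OF F] _ im] continuous_intros)
qed

definition cmul :: "complex \<Rightarrow> 'a::complex_banach \<Rightarrow>\<^sub>L 'a" where
  "cmul c = Blinfun (scaleC c)"

lemma cmul_apply [simp]: "cmul c x = c *\<^sub>C x"
  unfolding cmul_def
  by (simp add: bounded_linear_Blinfun_apply bounded_bilinear.bounded_linear_right[OF bounded_bilinear_scaleC])

lemma sot_C1_on_cmul:
  assumes "C1_on {0..1} c"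
  shows "sot_C1_on {0..1} (\<lambda>t. cmul (c t))"
proof -
  obtain c' where c': "\<And>t. t \<in> {0..1} \<Longrightarrow> (c has_vector_derivative c' t) (at t within {0..1})"
    "continuous_on {0..1} c'"
    using assms unfolding C1_on_def by blast
  have bl: "bounded_linear (\<lambda>c. c *\<^sub>C x)" for x :: 'a
    by (rule bounded_bilinear.bounded_linear_left[OF bounded_bilinear_scaleC])
  show ?thesis
    by (rule sot_C1_onI[where F' = "\<lambda>t. cmul (c' t)"])
      (auto intro!: bounded_linear.has_vector_derivative[OF bl] bounded_linear.continuous_on[OF bl] c')
qed

subsection \<open>Linear evolution equations with bounded generators\<close>

locale sot_generator =
  fixes B :: "real \<Rightarrow> 'a::complex_banach \<Rightarrow>\<^sub>L 'a" and K :: real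
  assumes cont: "\<And>x. continuous_on {0..1} (\<lambda>t. B t x)"
    and bound: "\<And>t. t \<in> {0..1} \<Longrightarrow> norm (B t) \<le> K"
    and lin: "\<And>t. t \<in> {0..1} \<Longrightarrow> complex_linear_op (B t)"
begin

lemma K_nonneg: "K \<ge> 0"
  by (rule order_trans[OF norm_ge_zero bound[of 0]]) simp

definition solves :: "(real \<Rightarrow> 'a) \<Rightarrow> bool" where
  "solves u \<longleftrightarrow> (\<forall>t\<in>{0..1}. (u has_vector_derivative B t (u t)) (at t within {0..1}))"

text \<open>The common induction step for uniqueness and for the Picard bounds. Times before
  \<open>s\<close> are included because transport backwards in time is needed later.\<close>

lemma iterate_bound:
  assumes s: "s \<in> {0..1}" and t: "t \<in> {0..1}"
    and w: "\<And>r. r \<in> {0..1} \<Longrightarrow> norm (w r) \<le> c * \<bar>r - s\<bar> ^ n"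
    and u: "\<And>r. r \<in> {0..1} \<Longrightarrow> (u has_vector_derivative B r (w r)) (at r within {0..1})" "u s = 0"
  shows "norm (u t) \<le> K * c * \<bar>t - s\<bar> ^ Suc n / Suc n"
proof -
  have cont_u: "continuous_on {0..1} u"
    by (rule continuous_on_vector_derivative[OF u(1)])
  have der: "(u has_vector_derivative B r (w r)) (at r)" if "0 < r" "r < 1" for r
    using u(1)[of r] that by (simp add: at_within_Icc_at)
  have bnd: "norm (B r (w r)) \<le> K * c * \<bar>r - s\<bar> ^ n" if "r \<in> {0..1}" for r
  proof -
    have "norm (B r (w r)) \<le> norm (B r) * norm (w r)" by (rule norm_blinfun)
    also have "\<dots> \<le> K * (c * \<bar>r - s\<bar> ^ n)"
      using bound[OF that] w[OF that] K_nonneg by (intro mult_mono) auto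
    finally show ?thesis by (simp add: mult_ac)
  qed
  consider "s < t" | "t < s" | "t = s" by linarith
  then show ?thesis
  proof cases
    case 1
    have "norm (u t - u s) \<le> K * c * (t - s) ^ Suc n / Suc n - K * c * (s - s) ^ Suc n / Suc n"
    proof (rule differentiable_bound_general[OF 1, of u "\<lambda>r. K * c * (r - s) ^ Suc n / Suc n"
          "\<lambda>r. B r (w r)" "\<lambda>r. K * c * (r - s) ^ n"])
      show "continuous_on {s..t} u" using cont_u s t by (auto intro: continuous_on_subset)
      show "continuous_on {s..t} (\<lambda>r. K * c * (r - s) ^ Suc n / Suc n)"
        by (intro continuous_intros) auto
      fix r assume r: "s < r" "r < t"
      show "(u has_vector_derivative B r (w r)) (at r)" using r s t by (intro der) auto
      have "((\<lambda>r. K * c * (r - s) ^ Suc n / Suc n) has_real_derivative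
          K * c * (real (Suc n) * (r - s) ^ n) / Suc n) (at r)"
        by (rule derivative_eq_intros refl | simp)+
      then show "((\<lambda>r. K * c * (r - s) ^ Suc n / Suc n) has_vector_derivative K * c * (r - s) ^ n) (at r)"
        by (simp add: has_real_derivative_iff_has_vector_derivative mult.assoc del: power_Suc of_nat_Suc)
      show "norm (B r (w r)) \<le> K * c * (r - s) ^ n" using bnd[of r] r s t by simp
    qed
    then show ?thesis using 1 u(2) by simp
  next
    case 2
    have "norm (u s - u t) \<le> - K * c * (s - s) ^ Suc n / Suc n - (- K * c * (s - t) ^ Suc n / Suc n)"
    proof (rule differentiable_bound_general[OF 2, of u "\<lambda>r. - K * c * (s - r) ^ Suc n / Suc n"
          "\<lambda>r. B r (w r)" "\<lambda>r. K * c * (s - r) ^ n"])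
      show "continuous_on {t..s} u" using cont_u s t by (auto intro: continuous_on_subset)
      show "continuous_on {t..s} (\<lambda>r. - K * c * (s - r) ^ Suc n / Suc n)"
        by (intro continuous_intros) auto
      fix r assume r: "t < r" "r < s"
      show "(u has_vector_derivative B r (w r)) (at r)" using r s t by (intro der) auto
      have "((\<lambda>r. - K * c * (s - r) ^ Suc n / Suc n) has_real_derivative
          - K * c * (real (Suc n) * (s - r) ^ n * (- 1)) / Suc n) (at r)"
        by (rule derivative_eq_intros refl | simp)+
      then show "((\<lambda>r. - K * c * (s - r) ^ Suc n / Suc n) has_vector_derivative K * c * (s - r) ^ n) (at r)"
        by (simp add: has_real_derivative_iff_has_vector_derivative mult.assoc del: power_Suc of_nat_Suc)
      show "norm (B r (w r)) \<le> K * c * (s - r) ^ n" using bnd[of r] r s t by (simp add: abs_minus_commute)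
    qed
    then show ?thesis using 2 u(2) by (simp add: abs_minus_commute)
  qed (use u(2) in simp)
qed

text \<open>The difference of two solutions is its own Picard iterate, so
  \<open>iterate_bound\<close> makes it smaller than any multiple of
  \<open>K ^ n / fact n\<close>.\<close>

lemma solves_unique:
  assumes u: "solves u" and v: "solves v" and s: "s \<in> {0..1}" "u s = v s" and t: "t \<in> {0..1}"
  shows "u t = v t"
proof -
  define d where "d r = u r - v r" for r
  have der: "(d has_vector_derivative B r (d r)) (at r within {0..1})" if "r \<in> {0..1}" for r
    using has_vector_derivative_diff u v that
    unfolding d_def[abs_def] solves_def by (fastforce simp: blinfun.bilinear_simps)
  have "continuous_on {0..1} d"
    by (rule continuous_on_vector_derivative[OF der])
  then have "bounded (d ` {0..1})"
    by (intro compact_imp_bounded compact_continuous_image) auto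
  then obtain C where "\<forall>x\<in>d ` {0..1}. norm x \<le> C" unfolding bounded_iff by blast
  then have C: "norm (d r) \<le> C" if "r \<in> {0..1}" for r using that by blast
  have C0: "C \<ge> 0" by (rule order_trans[OF norm_ge_zero C[of 0]]) simp
  have iter: "norm (d r) \<le> C * K ^ n / fact n * \<bar>r - s\<bar> ^ n" if "r \<in> {0..1}" for n r
    using that
  proof (induction n arbitrary: r)
    case 0
    then show ?case using C by simp
  next
    case (Suc n)
    have "norm (d r) \<le> K * (C * K ^ n / fact n) * \<bar>r - s\<bar> ^ Suc n / Suc n"
      using Suc s by (intro iterate_bound[where w = d] der) (auto simp: d_def)
    then show ?case by (simp add: mult_ac del: power_Suc) (simp add: mult_ac)
  qed
  have "norm (d t) \<le> C * (K ^ n / fact n)" for n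
  proof -
    have "\<bar>t - s\<bar> \<le> 1" using s t by auto
    then have "C * K ^ n / fact n * \<bar>t - s\<bar> ^ n \<le> C * K ^ n / fact n * 1"
      using C0 K_nonneg by (intro mult_left_mono power_le_one) auto
    with iter[OF t, of n] show ?thesis by simp
  qed
  moreover have "(\<lambda>n. C * (K ^ n / fact n)) \<longlonglongrightarrow> C * 0"
    using summable_LIMSEQ_zero[OF summable_exp_generic[of K]]
    by (intro tendsto_mult tendsto_const) (simp add: divide_inverse mult.commute)
  ultimately have "norm (d t) \<le> 0"
    by (intro tendsto_lowerbound[where F = sequentially]) auto
  then show ?thesis by (simp add: d_def)
qed

text \<open>These are the single terms of the Dyson series, not its partial sums. The integral from
  \<open>s\<close> to \<open>t\<close> is written as a difference of integrals from 0, so that it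
  makes sense also for \<open>t < s\<close>.\<close>

fun picard :: "real \<Rightarrow> 'a \<Rightarrow> nat \<Rightarrow> real \<Rightarrow> 'a" where
  "picard s x 0 = (\<lambda>t. x)"
| "picard s x (Suc n) = (\<lambda>t. integral {0..t} (\<lambda>r. B r (picard s x n r)) - integral {0..s} (\<lambda>r. B r (picard s x n r)))"

definition picard' :: "real \<Rightarrow> 'a \<Rightarrow> nat \<Rightarrow> real \<Rightarrow> 'a" where
  "picard' s x n t = (case n of 0 \<Rightarrow> 0 | Suc m \<Rightarrow> B t (picard s x m t))"

lemma picard_continuous: "continuous_on {0..1} (picard s x n)"
proof (induction n)
  case (Suc n)
  have "continuous_on {0..1} (\<lambda>r. B r (picard s x n r))"
    by (rule continuous_on_sot_apply_interval[OF cont Suc])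
  then show ?case
    by (auto intro!: continuous_intros indefinite_integral_continuous_1 integrable_continuous_real)
qed (simp add: continuous_on_const)

lemma picard_derivative:
  assumes "t \<in> {0..1}"
  shows "(picard s x n has_vector_derivative picard' s x n t) (at t within {0..1})"
proof (cases n)
  case (Suc m)
  have "continuous_on {0..1} (\<lambda>r. B r (picard s x m r))"
    by (rule continuous_on_sot_apply_interval[OF cont picard_continuous])
  from has_vector_derivative_diff[OF integral_has_vector_derivative[OF this assms] has_vector_derivative_const]
  show ?thesis by (simp add: Suc picard'_def)
qed (simp add: picard'_def)

lemma picard_bound:
  assumes "s \<in> {0..1}" "t \<in> {0..1}"
  shows "norm (picard s x n t) \<le> K ^ n / fact n * norm x"
proof -
  have "norm (picard s x n t) \<le> norm x * K ^ n / fact n * \<bar>t - s\<bar> ^ n" if "t \<in> {0..1}" for t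
    using that
  proof (induction n arbitrary: t)
    case (Suc n)
    have "norm (picard s x (Suc n) t) \<le> K * (norm x * K ^ n / fact n) * \<bar>t - s\<bar> ^ Suc n / Suc n"
      using Suc assms picard_derivative[of _ s x "Suc n"]
      by (intro iterate_bound[where w = "picard s x n"]) (auto simp: picard'_def)
    then show ?case by (simp add: mult_ac del: power_Suc picard.simps) (simp add: mult_ac)
  qed simp
  from this[OF assms(2)] have "norm (picard s x n t) \<le> norm x * K ^ n / fact n * \<bar>t - s\<bar> ^ n" .
  also have "\<dots> \<le> norm x * K ^ n / fact n * 1"
    using assms K_nonneg by (intro mult_left_mono power_le_one) auto
  finally show ?thesis by (simp add: mult.commute)
qed

definition sol :: "real \<Rightarrow> 'a \<Rightarrow> real \<Rightarrow> 'a" where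
  "sol s x t = (\<Sum>n. picard s x n t)"

lemma summable_bound: "summable (\<lambda>n. K ^ n / fact n * norm (x::'a))"
  using summable_exp_generic[of K] by (intro summable_mult2) (simp add: divide_inverse mult.commute)

lemma picard_sums:
  assumes "s \<in> {0..1}" "t \<in> {0..1}"
  shows "(\<lambda>n. picard s x n t) sums sol s x t" "norm (sol s x t) \<le> exp K * norm x"
proof -
  have s: "summable (\<lambda>n. norm (picard s x n t))"
    by (rule summable_comparison_test'[OF summable_bound[of x], of 0]) (use picard_bound[OF assms] in auto)
  then show "(\<lambda>n. picard s x n t) sums sol s x t"
    unfolding sol_def by (rule summable_sums[OF summable_norm_cancel])
  have "norm (sol s x t) \<le> (\<Sum>n. norm (picard s x n t))"
    unfolding sol_def by (rule summable_norm[OF s])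
  also have "\<dots> \<le> (\<Sum>n. K ^ n / fact n * norm x)"
    by (intro suminf_le s summable_bound picard_bound assms)
  also have "\<dots> = exp K * norm x"
    using sums_mult2[OF exp_converges[of K], of "norm x"]
    by (intro sums_unique[symmetric]) (simp add: divide_inverse mult.commute mult.left_commute)
  finally show "norm (sol s x t) \<le> exp K * norm x" .
qed

lemma sol_init:
  assumes "s \<in> {0..1}"
  shows "sol s x s = x"
proof -
  have "picard s x n s = (if n = 0 then x else 0)" for n by (cases n) auto
  then have "sol s x s = (\<Sum>n. if n = 0 then x else 0)" by (simp add: sol_def)
  also have "\<dots> = x" using sums_unique[OF sums_single[of 0 "\<lambda>_. x"]] by simp
  finally show ?thesis .
qed

lemma sol_solves:
  assumes s: "s \<in> {0..1}"
  shows "solves (sol s x)"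
proof -
  have ul: "uniform_limit {0..1} (\<lambda>n t. \<Sum>i<n. picard s x i t) (sol s x) sequentially"
    unfolding sol_def[abs_def]
    by (rule Weierstrass_m_test[OF picard_bound[OF s] summable_bound])
  have "\<exists>g. \<forall>t\<in>{0..1}. (\<lambda>n. picard s x n t) sums g t \<and>
      (g has_derivative (\<lambda>h. h *\<^sub>R B t (sol s x t))) (at t within {0..1})"
  proof (rule has_derivative_series[where f' = "\<lambda>n t h. h *\<^sub>R picard' s x n t"])
    show "convex {0..1::real}" by simp
    show "(picard s x n has_derivative (\<lambda>h. h *\<^sub>R picard' s x n t)) (at t within {0..1})"
      if "t \<in> {0..1}" for n t
      using picard_derivative[OF that] by (simp add: has_vector_derivative_def)
    show "\<forall>\<^sub>F n in sequentially. \<forall>t\<in>{0..1}. \<forall>h.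
        norm ((\<Sum>i<n. h *\<^sub>R picard' s x i t) - h *\<^sub>R B t (sol s x t)) \<le> e * norm h"
      if e: "e > 0" for e
    proof -
      have "\<forall>\<^sub>F n in sequentially. \<forall>t\<in>{0..1}. dist (\<Sum>i<n. picard s x i t) (sol s x t) < e / (K + 1)"
        using ul e K_nonneg by (auto simp: uniform_limit_iff)
      then obtain N where N: "\<And>n t. n \<ge> N \<Longrightarrow> t \<in> {0..1} \<Longrightarrow>
          dist (\<Sum>i<n. picard s x i t) (sol s x t) < e / (K + 1)"
        unfolding eventually_sequentially by blast
      have "norm ((\<Sum>i<n. h *\<^sub>R picard' s x i t) - h *\<^sub>R B t (sol s x t)) \<le> e * norm h"
        if "n \<ge> Suc N" "t \<in> {0..1}" for n t h
      proof -
        \<comment> \<open>The constant term has derivative zero, so the first \<open>n\<close>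
          derivatives add up to \<open>B t\<close> applied to a partial sum of only
          \<open>n - 1\<close> terms.\<close>
        define m where "m = n - 1"
        have m: "n = Suc m" "m \<ge> N" using that(1) by (auto simp: m_def)
        have "(\<Sum>i<n. picard' s x i t) = B t (\<Sum>i<m. picard s x i t)"
          unfolding m(1) sum.lessThan_Suc_shift by (simp add: picard'_def blinfun.sum_right)
        then have "(\<Sum>i<n. h *\<^sub>R picard' s x i t) - h *\<^sub>R B t (sol s x t) =
            h *\<^sub>R B t ((\<Sum>i<m. picard s x i t) - sol s x t)"
          by (simp add: blinfun.bilinear_simps scaleR_diff_right flip: scaleR_sum_right)
        moreover have le1: "norm (B t ((\<Sum>i<m. picard s x i t) - sol s x t)) \<le> K * (e / (K + 1))"
          using N[OF m(2) that(2)] bound[OF that(2)] K_nonneg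
          by (intro order_trans[OF norm_blinfun] mult_mono) (auto simp: dist_norm)
        moreover have le2: "K * (e / (K + 1)) \<le> e" using e K_nonneg by (simp add: field_simps)
        moreover have "\<bar>h\<bar> * norm (B t ((\<Sum>i<m. picard s x i t) - sol s x t)) \<le> \<bar>h\<bar> * e"
          by (rule mult_left_mono[OF order_trans[OF le1 le2]]) simp
        ultimately show ?thesis by (simp add: mult.commute)
      qed
      then show ?thesis unfolding eventually_sequentially by blast
    qed
    show "0 \<in> {0..1::real}" by simp
    show "(\<lambda>n. picard s x n 0) sums sol s x 0" by (rule picard_sums) (use s in auto)
  qed
  then obtain g where g: "\<And>t. t \<in> {0..1} \<Longrightarrow> (\<lambda>n. picard s x n t) sums g t"
    "\<And>t. t \<in> {0..1} \<Longrightarrow> (g has_vector_derivative B t (sol s x t)) (at t within {0..1})"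
    unfolding has_vector_derivative_def by blast
  have "g t = sol s x t" if "t \<in> {0..1}" for t
    using sums_unique2[OF g(1)[OF that] picard_sums(1)[OF s that]] .
  then show ?thesis
    unfolding solves_def using has_vector_derivative_transform[OF _ _ g(2)] by metis
qed

section \<open>The propagator, for both directions of time\<close>

definition propagator :: "real \<Rightarrow> real \<Rightarrow> 'a \<Rightarrow>\<^sub>L 'a" where
  "propagator t s = Blinfun (\<lambda>x. sol s x t)"

lemma solves_add: "solves u \<Longrightarrow> solves v \<Longrightarrow> solves (\<lambda>t. u t + v t)"
  unfolding solves_def by (auto simp: blinfun.bilinear_simps intro!: has_vector_derivative_add)

lemma solves_scaleC:
  assumes "solves u"
  shows "solves (\<lambda>t. c *\<^sub>C u t)"
  unfolding solves_def
proof
  fix t :: real assume t: "t \<in> {0..1}"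
  have "(\<lambda>t. c *\<^sub>C u t) = (\<lambda>t. cmul c (u t))" by simp
  moreover have "((\<lambda>t. cmul c (u t)) has_vector_derivative cmul c (B t (u t))) (at t within {0..1})"
    using assms t by (intro bounded_linear.has_vector_derivative[OF blinfun.bounded_linear_right]) (simp add: solves_def)
  ultimately show "((\<lambda>t. c *\<^sub>C u t) has_vector_derivative B t (c *\<^sub>C u t)) (at t within {0..1})"
    by (simp add: complex_linear_opD[OF lin[OF t]])
qed

lemma propagator_apply:
  assumes st: "s \<in> {0..1}" "t \<in> {0..1}"
  shows "propagator t s x = sol s x t" "complex_linear_op (propagator t s)" "norm (propagator t s) \<le> exp K"
proof -
  have add: "sol s (x + y) t = sol s x t + sol s y t" for x y
    by (rule solves_unique[OF sol_solves[OF st(1)] solves_add[OF sol_solves[OF st(1)] sol_solves[OF st(1)]]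
          st(1) _ st(2)]) (simp add: sol_init[OF st(1)])
  have scale: "sol s (c *\<^sub>C x) t = c *\<^sub>C sol s x t" for c x
    by (rule solves_unique[OF sol_solves[OF st(1)] solves_scaleC[OF sol_solves[OF st(1)]]
          st(1) _ st(2)]) (simp add: sol_init[OF st(1)])
  have "bounded_linear (\<lambda>x. sol s x t)"
    using picard_sums(2)[OF st]
    by (intro bounded_linear_intro[where K = "exp K"]) (simp_all add: add scaleR_scaleC scale mult.commute)
  then show ap: "propagator t s x = sol s x t" for x
    by (simp add: propagator_def bounded_linear_Blinfun_apply)
  show "complex_linear_op (propagator t s)" by (simp add: complex_linear_op_def ap scale)
  show "norm (propagator t s) \<le> exp K"
    using picard_sums(2)[OF st] by (intro norm_blinfun_bound) (auto simp: ap)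
qed

lemma propagator_init: "s \<in> {0..1} \<Longrightarrow> propagator s s x = x"
  by (simp add: propagator_apply sol_init)

lemma propagator_solves: "s \<in> {0..1} \<Longrightarrow> solves (\<lambda>t. propagator t s x)"
  using sol_solves[of s x] unfolding solves_def
  by (auto simp: propagator_apply intro: has_vector_derivative_transform[rotated 2])

lemma propagator_unique:
  assumes "solves u" "s \<in> {0..1}" "t \<in> {0..1}"
  shows "u t = propagator t s (u s)"
  by (rule solves_unique[OF assms(1) propagator_solves]) (use assms propagator_init in auto)

lemma propagator_compose:
  assumes "r \<in> {0..1}" "s \<in> {0..1}" "t \<in> {0..1}"
  shows "propagator t s (propagator s r x) = propagator t r x"
  using propagator_unique[OF propagator_solves[OF assms(1)] assms(2,3)] by simp

lemma propagator_continuous: "s \<in> {0..1} \<Longrightarrow> continuous_on {0..1} (\<lambda>t. propagator t s x)"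
  using propagator_solves[of s x] unfolding solves_def by (intro continuous_on_vector_derivative) blast

text \<open>The cocycle rule gives \<open>propagator 0 s x - propagator 0 r x = propagator 0 s (x -
  propagator s r x)\<close>, which reduces continuity in the initial time to continuity in the final
  one.\<close>

lemma propagator_continuous_start: "continuous_on {0..1} (\<lambda>s. propagator 0 s x)"
  unfolding continuous_on_def
proof
  fix r :: real assume r: "r \<in> {0..1}"
  have "((\<lambda>s. propagator 0 s (x - propagator s r x)) \<longlongrightarrow> 0) (at r within {0..1})"
  proof (rule Lim_null_comparison)
    show "\<forall>\<^sub>F s in at r within {0..1}. norm (propagator 0 s (x - propagator s r x)) \<le>
        exp K * norm (x - propagator s r x)"
      unfolding eventually_at_filter
      by (intro always_eventually allI impI order_trans[OF norm_blinfun] mult_right_mono propagator_apply) auto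
    have "((\<lambda>s. propagator s r x) \<longlongrightarrow> propagator r r x) (at r within {0..1})"
      using propagator_continuous[OF r, of x] r unfolding continuous_on_def by blast
    then have "((\<lambda>s. exp K * norm (x - propagator s r x)) \<longlongrightarrow> exp K * norm (x - x)) (at r within {0..1})"
      unfolding propagator_init[OF r] by (intro tendsto_intros)
    then show "((\<lambda>s. exp K * norm (x - propagator s r x)) \<longlongrightarrow> 0) (at r within {0..1})" by simp
  qed
  then have "((\<lambda>s. propagator 0 s x - propagator 0 r x) \<longlongrightarrow> 0) (at r within {0..1})"
    by (rule Lim_transform_eventually)
      (use r in \<open>auto simp: eventually_at_filter blinfun.diff_right propagator_compose intro!: always_eventually\<close>)
  then show "((\<lambda>s. propagator 0 s x) \<longlongrightarrow> propagator 0 r x) (at r within {0..1})"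
    by (rule LIM_zero_cancel)
qed

lemma propagator_evolution_system:
  assumes G: "\<And>t x. t \<in> {0..1} \<Longrightarrow> G t x = B t x"
  shows "evolution_system (\<lambda>t. UNIV) G propagator"
proof -
  have der: "((\<lambda>r. propagator r s y) has_vector_derivative G t (propagator t s y)) (at t within {s..1})"
    if "s \<in> {0..<1}" "t \<in> {s..1}" for s t y
    using propagator_solves[of s y] that unfolding solves_def
    by (auto simp: G intro!: has_vector_derivative_within_subset[of _ _ _ "{0..1}" "{s..1}"])
  have contG: "continuous_on {s..1} (\<lambda>t. G t (propagator t s y))" if "s \<in> {0..<1}" for s y
  proof -
    have "continuous_on {0..1} (\<lambda>t. propagator t s y)"
      using that by (intro propagator_continuous) auto
    then have "continuous_on {0..1} (\<lambda>t. B t (propagator t s y))"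
      by (rule continuous_on_sot_apply_interval[OF cont])
    then have "continuous_on {s..1} (\<lambda>t. B t (propagator t s y))"
      by (rule continuous_on_subset) (use that in auto)
    then show ?thesis
      by (rule continuous_on_cong[THEN iffD2, OF refl, rotated]) (use that in \<open>auto simp: G\<close>)
  qed
  have joint: "continuous_on {(s, t). 0 \<le> s \<and> s \<le> t \<and> t \<le> 1} (\<lambda>(s, t). propagator t s x)" for x
  proof -
    let ?T = "{(s, t). 0 \<le> s \<and> s \<le> t \<and> t \<le> (1::real)}"
    \<comment> \<open>Passing through time 0, which requires running backwards, separates the two
      time variables.\<close>
    have "continuous_on ?T (\<lambda>p. propagator (snd p) 0 (propagator 0 (fst p) x))"
    proof (rule continuous_on_sot_apply[where K = "exp K"])
      show "norm (propagator (snd p) 0) \<le> exp K" if "p \<in> ?T" for p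
        using that by (intro propagator_apply) auto
      show "continuous_on ?T (\<lambda>p. propagator (snd p) 0 y)" for y
        by (rule continuous_on_compose2[OF propagator_continuous[of 0]]) (auto intro!: continuous_intros)
      show "continuous_on ?T (\<lambda>p. propagator 0 (fst p) x)"
        by (rule continuous_on_compose2[OF propagator_continuous_start]) (auto intro!: continuous_intros)
    qed
    then show ?thesis
      by (rule continuous_on_cong[THEN iffD1, OF refl, rotated]) (auto simp: propagator_compose)
  qed
  show ?thesis
    unfolding evolution_system_def
  proof (intro conjI allI ballI impI)
    show "complex_linear_op (propagator t s)" if "0 \<le> s \<and> s \<le> t \<and> t \<le> 1" for s t
      using that by (intro propagator_apply) auto
    show "propagator s s y = y" if "s \<in> {0..<1}" for s y
      using that by (intro propagator_init) auto
    show "propagator t s o\<^sub>L propagator s r = propagator t r" if "0 \<le> r \<and> r \<le> s \<and> s \<le> t \<and> t \<le> 1" for r s t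
      using that by (intro blinfun_eqI) (simp add: propagator_compose)
    show "propagator t s y \<in> UNIV" for s t y by simp
    show "continuous_on {s..1} (\<lambda>t. G t (propagator t s y))" if "s \<in> {0..<1}" for s y
      by (rule contG[OF that])
    show "((\<lambda>r. propagator r s y) has_vector_derivative G t (propagator t s y)) (at t within {s..1})"
      if "s \<in> {0..<1}" "t \<in> {s..1}" for s t y
      by (rule der[OF that])
  qed (rule joint)
qed

end

subsection \<open>Difference quotients and dominated convergence\<close>

lemma straddling_points:
  assumes "h \<in> {0..1::real}" "t \<in> {0..1}"
  shows "(1 - h) * t \<in> {0..1}" "(1 - h) * t + h \<in> {0..1}" "(1 - h) * t \<le> t" "t \<le> (1 - h) * t + h"
proof -
  have *: "0 \<le> h * t" "h * t \<le> h" "h * t \<le> t" "(1 - h) * (1 - t) \<ge> 0"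
    using assms by (auto simp: mult_left_le mult_left_le_one_le)
  then show "(1 - h) * t \<in> {0..1}" "(1 - h) * t + h \<in> {0..1}" "(1 - h) * t \<le> t" "t \<le> (1 - h) * t + h"
    using assms by (auto simp: algebra_simps)
qed

text \<open>The two points straddle \<open>t\<close> and stay inside the unit interval, so that the quotient is
  defined up to the endpoints and inherits the smoothness of \<open>f\<close> as a function of \<open>t\<close>.\<close>

lemma straddled_quotient_tendsto:
  fixes f :: "real \<Rightarrow> 'b::real_normed_vector"
  assumes f: "(f has_vector_derivative f') (at t within {0..1})" and t: "t \<in> {0..1}"
    and h: "h \<longlonglongrightarrow> 0" "\<And>n. h n \<in> {0<..1}"
  shows "(\<lambda>n. (1 / h n) *\<^sub>R (f ((1 - h n) * t + h n) - f ((1 - h n) * t))) \<longlonglongrightarrow> f'"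
proof (rule LIMSEQ_I)
  fix r :: real assume r: "r > 0"
  obtain d where d: "d > 0" "\<And>y. y \<in> {0..1} \<Longrightarrow> norm (y - t) < d \<Longrightarrow>
      norm (f y - f t - (y - t) *\<^sub>R f') \<le> r / 2 * norm (y - t)"
    using f r unfolding has_vector_derivative_def has_derivative_within_alt
    by (metis half_gt_zero)
  obtain N where N: "\<And>n. n \<ge> N \<Longrightarrow> \<bar>h n\<bar> < d"
    using LIMSEQ_D[OF h(1) d(1)] by auto
  have "norm ((1 / h n) *\<^sub>R (f ((1 - h n) * t + h n) - f ((1 - h n) * t)) - f') < r" if n: "n \<ge> N" for n
  proof -
    let ?a = "(1 - h n) * t" and ?b = "(1 - h n) * t + h n"
    have hn: "h n > 0" "h n \<in> {0..1}" using h(2)[of n] by auto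
    note p = straddling_points[OF hn(2) t]
    have "\<bar>?a - t\<bar> < d" "\<bar>?b - t\<bar> < d" using N[OF n] p hn by auto
    then have ab: "norm (f ?a - f t - (?a - t) *\<^sub>R f') \<le> r / 2 * (t - ?a)"
      "norm (f ?b - f t - (?b - t) *\<^sub>R f') \<le> r / 2 * (?b - t)"
      using d(2)[OF p(1)] d(2)[OF p(2)] p(3,4) by auto
    \<comment> \<open>Each remainder is bounded by the distance of its point from \<open>t\<close>;
      as \<open>t\<close> lies between the points, the distances add up to
      \<open>h n\<close>.\<close>
    have "f ?b - f ?a - h n *\<^sub>R f' =
        (f ?b - f t - (?b - t) *\<^sub>R f') - (f ?a - f t - (?a - t) *\<^sub>R f')"
      by (simp add: algebra_simps)
    then have "norm (f ?b - f ?a - h n *\<^sub>R f') \<le> r / 2 * (?b - t) + r / 2 * (t - ?a)"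
      by (metis (no_types, lifting) ab order_trans[OF norm_triangle_ineq4 add_mono])
    also have "\<dots> = r / 2 * h n" by (simp add: algebra_simps)
    finally have le: "norm (f ?b - f ?a - h n *\<^sub>R f') \<le> r / 2 * h n" .
    have "(1 / h n) *\<^sub>R (f ?b - f ?a) - f' = (1 / h n) *\<^sub>R (f ?b - f ?a - h n *\<^sub>R f')"
      using hn by (simp add: scaleR_diff_right)
    then have "norm ((1 / h n) *\<^sub>R (f ?b - f ?a) - f') = (1 / h n) * norm (f ?b - f ?a - h n *\<^sub>R f')"
      using hn by simp
    also have "\<dots> \<le> (1 / h n) * (r / 2 * h n)" using hn by (intro mult_left_mono le) auto
    also have "\<dots> < r" using hn r by simp
    finally show ?thesis .
  qed
  then show "\<exists>N. \<forall>n\<ge>N. norm ((1 / h n) *\<^sub>R (f ((1 - h n) * t + h n) - f ((1 - h n) * t)) - f') < r"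
    by blast
qed

lemma straddled_quotient_bound:
  fixes f :: "real \<Rightarrow> 'b::real_normed_vector"
  assumes f: "\<And>t. t \<in> {0..1} \<Longrightarrow> (f has_vector_derivative f' t) (at t within {0..1})"
    "\<And>t. t \<in> {0..1} \<Longrightarrow> norm (f' t) \<le> K" and t: "t \<in> {0..1}" and h: "h \<in> {0<..1}"
  shows "norm ((1 / h) *\<^sub>R (f ((1 - h) * t + h) - f ((1 - h) * t))) \<le> K"
proof -
  have K: "K \<ge> 0" by (rule order_trans[OF norm_ge_zero f(2)[OF t]])
  have "norm (f ((1 - h) * t + h) - f ((1 - h) * t)) \<le> K * norm ((1 - h) * t + h - (1 - h) * t)"
  proof (rule differentiable_bound[where S = "{0..1::real}"])
    show "(f has_derivative (\<lambda>h. h *\<^sub>R f' s)) (at s within {0..1})" if "s \<in> {0..1}" for s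
      using f(1)[OF that] by (simp add: has_vector_derivative_def)
    show "onorm (\<lambda>h. h *\<^sub>R f' s) \<le> K" if "s \<in> {0..1}" for s
      by (rule onorm_bound[OF K]) (use mult_left_mono[OF f(2)[OF that] abs_ge_zero] in \<open>simp add: mult.commute\<close>)
  qed (use straddling_points[of h t] t h in auto)
  then have "norm (f ((1 - h) * t + h) - f ((1 - h) * t)) / h \<le> K"
    using h by (simp add: pos_divide_le_eq)
  then show ?thesis using h by simp
qed

text \<open>As a supremum of continuous functions the operator norm is lower semicontinuous in
  \<open>t\<close>: its sublevel sets are intersections of closed sets. It need not be
  continuous.\<close>

lemma borel_measurable_norm_sot:
  fixes F :: "real \<Rightarrow> 'a::real_normed_vector \<Rightarrow>\<^sub>L 'b::real_normed_vector"
  assumes "\<And>x. continuous_on {0..1} (\<lambda>t. F t x)"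
  shows "(\<lambda>t. norm (F t)) \<in> borel_measurable (lebesgue_on {0..1})"
proof (rule borel_measurableI_le)
  fix y :: real
  \<comment> \<open>Negative \<open>y\<close> is split off because on the zero space the
    intersection would be the whole interval.\<close>
  have "{t \<in> {0..1}. norm (F t) \<le> y} =
      (if y < 0 then {} else (\<Inter>x. {t \<in> {0..1}. norm (F t x) \<le> y * norm x}))"
  proof (cases "y < 0")
    case False
    have "norm (F t) \<le> y \<longleftrightarrow> (\<forall>x. norm (F t x) \<le> y * norm x)" for t
      using False norm_blinfun_bound[of y "F t"] norm_blinfun[of "F t"] mult_right_mono[of "norm (F t)" y]
      by (meson linorder_not_less norm_ge_zero order_trans)
    then show ?thesis using False by auto
  next
    case True
    then have "\<not> norm (F t) \<le> y" for t using norm_ge_zero[of "F t"] by linarith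
    then show ?thesis using True by auto
  qed
  moreover have "closed (\<Inter>x. {t \<in> {0..1}. norm (F t x) \<le> y * norm x})"
    by (intro closed_INT ballI continuous_on_closed_Collect_le continuous_intros assms closed_atLeastAtMost)
  ultimately have "closed {t \<in> {0..1}. norm (F t) \<le> y}" by simp
  then have "{t \<in> {0..1}. norm (F t) \<le> y} \<in> sets lebesgue" by auto
  then show "{t \<in> space (lebesgue_on {0..1}). norm (F t) \<le> y} \<in> sets (lebesgue_on {0..1})"
    by (auto simp: sets_restrict_space_iff)
qed

lemma continuous_imp_borel_measurable_lebesgue_on:
  "continuous_on {0..1::real} (f :: real \<Rightarrow> real) \<Longrightarrow> f \<in> borel_measurable (lebesgue_on {0..1})"
  by (rule continuous_imp_measurable_on_sets_lebesgue) auto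

lemma integral_null_sequence:
  fixes f :: "nat \<Rightarrow> real \<Rightarrow> real"
  assumes meas: "\<And>n. f n \<in> borel_measurable (lebesgue_on {0..1})"
    and bound: "\<And>n t. t \<in> {0..1} \<Longrightarrow> \<bar>f n t\<bar> \<le> K"
    and lim: "AE t in lebesgue. t \<in> {0..1} \<longrightarrow> (\<lambda>n. f n t) \<longlonglongrightarrow> 0"
  shows "f n integrable_on {0..1}" "(\<lambda>n. integral {0..1} (f n)) \<longlonglongrightarrow> 0"
proof -
  have fm: "finite_measure (lebesgue_on {0..1::real})"
    by (rule finite_measure_lebesgue_on) simp
  then have finite: "integrable (lebesgue_on {0..1}) (\<lambda>t::real. K)"
    by (rule finite_measure.integrable_const)
  have lim': "AE t in lebesgue_on {0..1}. (\<lambda>n. f n t) \<longlonglongrightarrow> 0"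
    using lim by (simp add: AE_restrict_space_iff)
  have bnd: "AE t in lebesgue_on {0..1}. norm (f n t) \<le> K" for n
    using bound by (intro AE_I2) auto
  have int: "integrable (lebesgue_on {0..1}) (f n)" for n
    by (rule finite_measure.integrable_const_bound[OF fm bnd meas])
  show "f n integrable_on {0..1}"
    using int by (simp add: integrable_on_lebesgue_on)
  have "(\<lambda>n. integral\<^sup>L (lebesgue_on {0..1}) (f n)) \<longlonglongrightarrow> integral\<^sup>L (lebesgue_on {0..1}) (\<lambda>t :: real. 0 :: real)"
    by (rule integral_dominated_convergence[where w = "\<lambda>_. K"])
      (use meas finite lim' bnd in auto)
  then show "(\<lambda>n. integral {0..1} (f n)) \<longlonglongrightarrow> 0"
    using lebesgue_integral_eq_integral[OF int] by simp
qed

subsection \<open>The adiabatic setting\<close>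

text \<open>The direction \<open>cis (\<theta> t)\<close> enters as the unimodular function
  \<open>z\<close>, and the resolvents as a family \<open>R\<close> characterised by
  \<open>is_resolvent\<close>.\<close>

locale adiabatic =
  fixes D :: "real \<Rightarrow> 'a::complex_banach set"
    and A :: "real \<Rightarrow> 'a \<Rightarrow> 'a"
    and U :: "real \<Rightarrow> real \<Rightarrow> real \<Rightarrow> 'a \<Rightarrow>\<^sub>L 'a"
    and M \<delta>\<^sub>0 M\<^sub>0 :: real
    and l z :: "real \<Rightarrow> complex"
    and R :: "real \<Rightarrow> real \<Rightarrow> 'a \<Rightarrow>\<^sub>L 'a"
    and P P' :: "real \<Rightarrow> 'a \<Rightarrow>\<^sub>L 'a"
    and m\<^sub>0 :: nat
  assumes A_linear: "\<And>t. t \<in> {0..1} \<Longrightarrow> linear_operator (D t) (A t)"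
    and D_dense: "\<And>t. t \<in> {0..1} \<Longrightarrow> closure (D t) = UNIV"
    and U_evol: "\<And>\<epsilon>. \<epsilon> > 0 \<Longrightarrow> evolution_system D (\<lambda>t x. (1 / \<epsilon>) *\<^sub>R A t x) (U \<epsilon>)"
    and M_ge: "M \<ge> 1"
    and U_bound: "\<And>\<epsilon> s t. \<epsilon> > 0 \<Longrightarrow> 0 \<le> s \<Longrightarrow> s \<le> t \<Longrightarrow> t \<le> 1 \<Longrightarrow> norm (U \<epsilon> t s) \<le> M"
    and delta0_pos: "\<delta>\<^sub>0 > 0"
    and R_resolvent: "\<And>t \<delta>. t \<in> {0..1} \<Longrightarrow> \<delta> \<in> {0<..\<delta>\<^sub>0} \<Longrightarrow>
                   is_resolvent (D t) (A t) (l t + of_real \<delta> * z t) (R \<delta> t)"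
    and z_C1: "C1_on {0..1} z"
    and z_norm: "\<And>t. cmod (z t) = 1"
    and R_C1: "\<And>\<delta>. \<delta> \<in> {0<..\<delta>\<^sub>0} \<Longrightarrow> sot_C1_on {0..1} (R \<delta>)"
    and l_C1: "C1_on {0..1} l"
    and P_proj: "\<And>t. t \<in> {0..1} \<Longrightarrow> bounded_projection (P t)"
    and P_comm: "\<And>t. t \<in> {0..1} \<Longrightarrow> commutes_with (P t) (D t) (A t)"
    and P_assoc: "AE t in lebesgue. t \<in> {0..1} \<longrightarrow> weakly_associated (D t) (A t) (l t) (P t)"
    and P_ker: "\<And>t. t \<in> {0..1} \<Longrightarrow> range (P t) \<subseteq> kernel_power (D t) (A t) (l t) m\<^sub>0"
    and R_bound: "\<And>t \<delta>. t \<in> {0..1} \<Longrightarrow> \<delta> \<in> {0<..\<delta>\<^sub>0} \<Longrightarrow>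
                    norm (R \<delta> t o\<^sub>L (id_blinfun - P t)) \<le> M\<^sub>0 / \<delta>"
    and P0_rank: "finite_rank (P 0)"
    and P_deriv: "\<And>t x. t \<in> {0..1} \<Longrightarrow> ((\<lambda>s. P s x) has_vector_derivative P' t x) (at t within {0..1})"
    and P'_cont: "\<And>x. continuous_on {0..1} (\<lambda>t. P' t x)"
begin

section \<open>Algebra of \<open>A\<close>, \<open>P\<close>, \<open>P'\<close> and the
  resolvents\<close>

lemma D_simps:
  assumes "t \<in> {0..1}"
  shows "0 \<in> D t" "x \<in> D t \<Longrightarrow> y \<in> D t \<Longrightarrow> x + y \<in> D t" "x \<in> D t \<Longrightarrow> y \<in> D t \<Longrightarrow> x - y \<in> D t"
    "x \<in> D t \<Longrightarrow> c *\<^sub>C x \<in> D t" "x \<in> D t \<Longrightarrow> r *\<^sub>R x \<in> D t"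
  using A_linear[OF assms] unfolding linear_operator_def scaleR_scaleC
  by (auto intro: complex_vector.subspace_0 complex_vector.subspace_add complex_vector.subspace_diff
      complex_vector.subspace_scale)

lemma A_simps:
  assumes "t \<in> {0..1}" "x \<in> D t"
  shows "y \<in> D t \<Longrightarrow> A t (x + y) = A t x + A t y" "y \<in> D t \<Longrightarrow> A t (x - y) = A t x - A t y"
    "A t (c *\<^sub>C x) = c *\<^sub>C A t x" "A t (r *\<^sub>R x) = r *\<^sub>R A t x" "A t 0 = 0"
proof -
  note lin = A_linear[OF assms(1), unfolded linear_operator_def]
  show add: "A t (x + y) = A t x + A t y" if "y \<in> D t" for y using lin assms(2) that by blast
  show scale: "A t (c *\<^sub>C x) = c *\<^sub>C A t x" for c using lin assms(2) by blast
  show "A t (r *\<^sub>R x) = r *\<^sub>R A t x" by (simp add: scaleR_scaleC scale)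
  show "A t (x - y) = A t x - A t y" if y: "y \<in> D t"
  proof -
    have "A t ((- 1) *\<^sub>C y) = (- 1) *\<^sub>C A t y" using lin y by blast
    then show ?thesis using add[OF D_simps(4)[OF assms(1) y, of "- 1"]] by simp
  qed
  show "A t 0 = 0" using scale[of 0] by simp
qed

lemma P_simps:
  assumes "t \<in> {0..1}"
  shows "P t (P t x) = P t x" "complex_linear_op (P t)" "P t (c *\<^sub>C x) = c *\<^sub>C P t x"
    "x \<in> D t \<Longrightarrow> P t x \<in> D t" "x \<in> D t \<Longrightarrow> P t (A t x) = A t (P t x)" "P t x \<in> D t"
proof -
  note pr = P_proj[OF assms, unfolded bounded_projection_def]
  show "P t (P t x) = P t x" using pr by (metis blinfun_apply_blinfun_compose)
  show "complex_linear_op (P t)" using pr by blast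
  then show "P t (c *\<^sub>C x) = c *\<^sub>C P t x" by (rule complex_linear_opD)
  show "x \<in> D t \<Longrightarrow> P t x \<in> D t" "x \<in> D t \<Longrightarrow> P t (A t x) = A t (P t x)"
    using P_comm[OF assms] by (auto simp: commutes_with_def)
  have "P t x \<in> kernel_power (D t) (A t) (l t) m\<^sub>0" using P_ker[OF assms] by auto
  \<comment> \<open>For \<open>m\<^sub>0 = 0\<close> the kernel is zero; otherwise the domain
    condition for \<open>k = 0\<close> is the claim.\<close>
  then show "P t x \<in> D t"
    by (cases "m\<^sub>0 = 0") (auto simp: kernel_power_def D_simps[OF assms])
qed

lemma P_AP: "t \<in> {0..1} \<Longrightarrow> P t (A t (P t x)) = A t (P t x)"
  by (simp add: P_simps)

lemma P_continuous: "continuous_on {0..1} (\<lambda>t. P t x)"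
  by (rule continuous_on_vector_derivative[OF P_deriv])

lemma P_C1: "sot_C1_on {0..1} P"
  by (rule sot_C1_onI[OF P_deriv P'_cont])

lemma P'_product:
  assumes t: "t \<in> {0..1}"
  shows "P' t x = P' t (P t x) + P t (P' t x)"
proof -
  obtain K where "\<And>s. s \<in> {0..1} \<Longrightarrow> norm (P s) \<le> K" using sot_bounded[OF P_continuous] by blast
  moreover have "((\<lambda>s. P s (P' t x)) \<longlongrightarrow> P t (P' t x)) (at t within {0..1})"
    using P_continuous t unfolding continuous_on_def by blast
  ultimately have "((\<lambda>s. P s (P s x)) has_vector_derivative P' t (P t x) + P t (P' t x)) (at t within {0..1})"
    by (rule has_vector_derivative_sot_apply[OF _ _ P_deriv[OF t] P_deriv[OF t]])
  then have "((\<lambda>s. P s x) has_vector_derivative P' t (P t x) + P t (P' t x)) (at t within {0..1})"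
    by (rule has_vector_derivative_transform[OF t, rotated]) (simp add: P_simps)
  with P_deriv[OF t] show ?thesis
    by (rule vector_derivative_unique_within[OF at_within_01[OF t]])
qed

text \<open>Inserting \<open>P t x\<close> in the product rule for \<open>P = P P\<close> leaves
  nothing on the diagonal: \<open>P'\<close> maps the range of \<open>P\<close> into its
  kernel.\<close>

lemma P_P'_P:
  assumes t: "t \<in> {0..1}"
  shows "P t (P' t (P t x)) = 0"
  using arg_cong[OF P'_product[OF t, of "P t x"], of "P t"] by (simp add: P_simps[OF t] blinfun.add_right)

lemma P'_linear:
  assumes t: "t \<in> {0..1}"
  shows "complex_linear_op (P' t)"
  unfolding complex_linear_op_def
proof (intro allI)
  fix c x
  have "((\<lambda>s. cmul c (P s x)) has_vector_derivative cmul c (P' t x)) (at t within {0..1})"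
    by (intro bounded_linear.has_vector_derivative[OF blinfun.bounded_linear_right] P_deriv t)
  then have "((\<lambda>s. P s (c *\<^sub>C x)) has_vector_derivative c *\<^sub>C P' t x) (at t within {0..1})"
    unfolding cmul_apply by (rule has_vector_derivative_transform[OF t, rotated]) (simp add: P_simps)
  with P_deriv[OF t] show "P' t (c *\<^sub>C x) = c *\<^sub>C P' t x"
    by (rule vector_derivative_unique_within[OF at_within_01[OF t]])
qed

text \<open>Kato's generator of the transport along the ranges of \<open>P\<close>.\<close>

definition Kc :: "real \<Rightarrow> 'a \<Rightarrow>\<^sub>L 'a" where
  "Kc t = commutator (P' t) (P t)"

lemma Kc_apply: "Kc t x = P' t (P t x) - P t (P' t x)"
  by (simp add: Kc_def commutator_def blinfun.bilinear_simps)

lemma Kc_continuous: "continuous_on {0..1} (\<lambda>t. Kc t x)"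
  unfolding Kc_apply
  by (intro continuous_on_diff continuous_on_sot_apply_interval[OF P'_cont P_continuous] continuous_on_sot_apply_interval[OF P_continuous P'_cont])

lemma Kc_P: "t \<in> {0..1} \<Longrightarrow> Kc t (P t x) = P' t (P t x)"
  by (simp add: Kc_apply P_simps P_P'_P)

lemma P_Kc: "t \<in> {0..1} \<Longrightarrow> P t (Kc t x) = - P t (P' t x)"
  by (simp add: Kc_apply P_simps P_P'_P blinfun.diff_right)

text \<open>The identity \<open>P' = [Kc, P]\<close>: if \<open>v\<close> follows a flow generated
  by \<open>Kc\<close> plus something commuting with \<open>P\<close>, then so does
  \<open>P v\<close>.\<close>

lemma Kc_intertwine: "t \<in> {0..1} \<Longrightarrow> P' t x + P t (Kc t x) = Kc t (P t x)"
  using P'_product[of t x] by (simp add: Kc_P P_Kc diff_eq_eq)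

lemma Kc_generator: obtains K where "sot_generator Kc K" "K > 0"
proof -
  obtain K where K: "K > 0" "\<And>t. t \<in> {0..1} \<Longrightarrow> norm (Kc t) \<le> K" using sot_bounded[OF Kc_continuous] by blast
  have "complex_linear_op (Kc t)" if "t \<in> {0..1}" for t
    using P'_linear[OF that] P_simps(2)[OF that]
    by (simp add: complex_linear_op_def Kc_apply complex_vector.scale_right_diff_distrib)
  then have "sot_generator Kc K"
    by (intro sot_generator.intro Kc_continuous K(2))
  then show thesis using that K(1) by blast
qed

lemma R_simps:
  assumes t: "t \<in> {0..1}" and d: "\<delta> \<in> {0<..\<delta>\<^sub>0}"
  shows "R \<delta> t y \<in> D t" "A t (R \<delta> t y) = (l t + of_real \<delta> * z t) *\<^sub>C R \<delta> t y - y"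
    "x \<in> D t \<Longrightarrow> R \<delta> t (A t x) = (l t + of_real \<delta> * z t) *\<^sub>C R \<delta> t x - x"
    "complex_linear_op (R \<delta> t)" "R \<delta> t (P t y) = P t (R \<delta> t y)"
proof -
  define c where "c = l t + of_real \<delta> * z t"
  have r: "R \<delta> t y \<in> D t" "c *\<^sub>C R \<delta> t y - A t (R \<delta> t y) = y" "x \<in> D t \<Longrightarrow> R \<delta> t (c *\<^sub>C x - A t x) = x" for x y
    using R_resolvent[OF t d] by (auto simp: is_resolvent_def c_def)
  show "R \<delta> t y \<in> D t" by (rule r(1))
  show AR: "A t (R \<delta> t y) = (l t + of_real \<delta> * z t) *\<^sub>C R \<delta> t y - y" for y
    using r(2)[of y] by (simp add: c_def algebra_simps)
  \<comment> \<open>Identities for the resolvent are obtained by checking that a candidate is mapped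
    to the right vector.\<close>
  have RI: "R \<delta> t y = x" if "x \<in> D t" "c *\<^sub>C x - A t x = y" for x y using r(3) that by blast
  show lin: "complex_linear_op (R \<delta> t)"
    unfolding complex_linear_op_def
  proof (intro allI RI D_simps t r(1))
    fix k x
    show "c *\<^sub>C k *\<^sub>C R \<delta> t x - A t (k *\<^sub>C R \<delta> t x) = k *\<^sub>C x"
      using arg_cong[OF r(2)[of x], of "scaleC k"]
      by (simp add: A_simps(3)[OF t r(1)] complex_vector.scale_right_diff_distrib scaleC_scaleC mult.commute)
  qed
  show "R \<delta> t (A t x) = (l t + of_real \<delta> * z t) *\<^sub>C R \<delta> t x - x" if "x \<in> D t"
    using r(3)[OF that, unfolded blinfun.diff_right complex_linear_opD[OF lin]]
    by (simp add: c_def algebra_simps)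
  show "R \<delta> t (P t y) = P t (R \<delta> t y)"
  proof (rule RI)
    show "P t (R \<delta> t y) \<in> D t" by (rule P_simps(6)[OF t])
    show "c *\<^sub>C P t (R \<delta> t y) - A t (P t (R \<delta> t y)) = P t y"
      using arg_cong[OF r(2)[of y], of "P t"]
      by (simp add: P_simps(3)[OF t] P_simps(5)[OF t r(1)] blinfun.diff_right)
  qed
qed

subsection \<open>Comparison of solutions with the evolution\<close>

lemma U_compose:
  assumes "\<epsilon> > 0" "0 \<le> r" "r \<le> s" "s \<le> t" "t \<le> 1"
  shows "U \<epsilon> t s (U \<epsilon> s r x) = U \<epsilon> t r x"
proof -
  have "U \<epsilon> t s o\<^sub>L U \<epsilon> s r = U \<epsilon> t r"
    using U_evol[OF assms(1)] assms unfolding evolution_system_def by blast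
  then show ?thesis by (metis blinfun_apply_blinfun_compose)
qed

lemma U_derivative:
  assumes "\<epsilon> > 0" "s \<in> {0..<1}" "y \<in> D s" "t \<in> {s..1}"
  shows "((\<lambda>r. U \<epsilon> r s y) has_vector_derivative (1 / \<epsilon>) *\<^sub>R A t (U \<epsilon> t s y)) (at t within {s..1})"
  using U_evol[OF assms(1)] assms(2-) unfolding evolution_system_def by blast

lemma U_joint_continuous:
  "\<epsilon> > 0 \<Longrightarrow> continuous_on {(s, t). 0 \<le> s \<and> s \<le> t \<and> t \<le> 1} (\<lambda>(s, t). U \<epsilon> t s x)"
  using U_evol unfolding evolution_system_def by blast

lemma U_continuous:
  assumes "\<epsilon> > 0" "t \<le> 1"
  shows "continuous_on {0..t} (\<lambda>s. U \<epsilon> t s x)"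
proof -
  have "continuous_on {0..t} (\<lambda>s. case (s, t) of (s, t) \<Rightarrow> U \<epsilon> t s x)"
    by (rule continuous_on_compose2[OF U_joint_continuous[OF assms(1)]])
      (use assms in \<open>auto intro!: continuous_intros\<close>)
  then show ?thesis by simp
qed

text \<open>The definition gives this only for \<open>s < 1\<close> and on \<open>D s\<close>.
  Density extends it to the whole space, and continuity along the diagonal to
  \<open>s = 1\<close>.\<close>

lemma U_refl:
  assumes e: "\<epsilon> > 0" and s: "s \<in> {0..1}"
  shows "U \<epsilon> s s x = x"
proof -
  have 1: "U \<epsilon> s s x = x" if s: "s \<in> {0..<1}" for s x
  proof -
    have "closed {y. U \<epsilon> s s y = y}" by (intro closed_Collect_eq continuous_intros)
    moreover have "D s \<subseteq> {y. U \<epsilon> s s y = y}"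
      using U_evol[OF e] s unfolding evolution_system_def by blast
    ultimately have "closure (D s) \<subseteq> {y. U \<epsilon> s s y = y}" by (rule closure_minimal[rotated])
    then show ?thesis using D_dense[of s] s by auto
  qed
  have "continuous_on {0..1} (\<lambda>s. case (s, s) of (s, t) \<Rightarrow> U \<epsilon> t s x)"
    by (rule continuous_on_compose2[OF U_joint_continuous[OF e]]) (auto intro!: continuous_intros)
  then have "continuous_on (closure {0..<1}) (\<lambda>s. U \<epsilon> s s x)" by simp
  then show ?thesis
    using continuous_constant_on_closure[of "{0..<1}" "\<lambda>s. U \<epsilon> s s x" x s] 1 s by simp
qed

text \<open>Duhamel's formula for a curve that solves the equation only up to a defect, with the
  domains varying in time.\<close>

lemma U_integral:
  assumes e: "\<epsilon> > 0" and t: "t \<in> {0..1}"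
    and v: "\<And>s. s \<in> {0..1} \<Longrightarrow> v s \<in> D s"
    and v': "\<And>s. s \<in> {0..1} \<Longrightarrow> (v has_vector_derivative v' s) (at s within {0..1})"
    and cont: "continuous_on {0..1} v'" "continuous_on {0..1} (\<lambda>s. A s (v s))"
  shows "((\<lambda>s. U \<epsilon> t s (v' s - (1 / \<epsilon>) *\<^sub>R A s (v s))) has_integral (v t - U \<epsilon> t 0 (v 0))) {0..t}"
proof -
  have sub: "{0..t} \<subseteq> {0..1}" using t by auto
  have cont_v: "continuous_on {0..1} v"
    by (rule continuous_on_vector_derivative[OF v'])
  have bnd: "norm (U \<epsilon> t s) \<le> M" if "s \<in> {0..t}" for s using that t e by (intro U_bound) auto
  have cU: "continuous_on {0..t} (\<lambda>s. U \<epsilon> t s x)" for x using t by (intro U_continuous e) auto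
  have "((\<lambda>s. U \<epsilon> t s (v' s - (1 / \<epsilon>) *\<^sub>R A s (v s))) has_integral (U \<epsilon> t t (v t) - U \<epsilon> t 0 (v 0))) {0..t}"
  proof (rule right_derivative_fundamental_theorem)
    show "continuous_on {0..t} (\<lambda>s. U \<epsilon> t s (v s))"
      by (rule continuous_on_sot_apply[OF bnd cU continuous_on_subset[OF cont_v sub]])
    show "continuous_on {0..t} (\<lambda>s. U \<epsilon> t s (v' s - (1 / \<epsilon>) *\<^sub>R A s (v s)))"
    proof (rule continuous_on_sot_apply[OF bnd cU])
      show "continuous_on {0..t} (\<lambda>s. v' s - (1 / \<epsilon>) *\<^sub>R A s (v s))"
        by (intro continuous_intros continuous_on_subset[OF cont(1) sub] continuous_on_subset[OF cont(2) sub])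
    qed
    show "0 \<le> t" using t by simp
    fix s assume s: "0 \<le> s" "s < t"
    then have s1: "s \<in> {0..<1}" "s \<in> {0..1}" using t by auto
    \<comment> \<open>By the cocycle rule the increment of \<open>U \<epsilon> t s (v s)\<close>
      from \<open>s\<close> to \<open>r\<close> equals \<open>U \<epsilon> t r (g r)\<close>.
      Differentiating \<open>g\<close> involves only the later time argument of
      \<open>U\<close>.\<close>
    define g where "g r = v r - U \<epsilon> r s (v s)" for r
    have "((\<lambda>r. U \<epsilon> r s (v s)) has_vector_derivative (1 / \<epsilon>) *\<^sub>R A s (U \<epsilon> s s (v s))) (at s within {s..1})"
      using s1 by (intro U_derivative e v) auto
    then have "((\<lambda>r. U \<epsilon> r s (v s)) has_vector_derivative (1 / \<epsilon>) *\<^sub>R A s (v s)) (at s within {s..t})"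
      using t by (simp add: U_refl[OF e s1(2)] has_vector_derivative_within_subset)
    moreover have "(v has_vector_derivative v' s) (at s within {s..t})"
      using s t by (intro has_vector_derivative_within_subset[OF v'[OF s1(2)]]) auto
    ultimately have "(g has_vector_derivative v' s - (1 / \<epsilon>) *\<^sub>R A s (v s)) (at s within {s..t})"
      unfolding g_def[abs_def] by (rule has_vector_derivative_diff[rotated])
    then have lim: "((\<lambda>r. (1 / (r - s)) *\<^sub>R (g r - g s)) \<longlongrightarrow> v' s - (1 / \<epsilon>) *\<^sub>R A s (v s)) (at s within {s..t})"
      unfolding has_vector_derivative_iff_quotient .
    have gs: "g s = 0" by (simp add: g_def U_refl[OF e s1(2)])
    have "((\<lambda>r. U \<epsilon> t r ((1 / (r - s)) *\<^sub>R (g r - g s))) \<longlongrightarrow> U \<epsilon> t s (v' s - (1 / \<epsilon>) *\<^sub>R A s (v s)))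
        (at s within {s..t})"
    proof (rule tendsto_sot_apply[OF _ _ lim])
      show "\<forall>\<^sub>F r in at s within {s..t}. norm (U \<epsilon> t r) \<le> M"
        unfolding eventually_at_filter using bnd s by (intro always_eventually) auto
      have "((\<lambda>r. U \<epsilon> t r x) \<longlongrightarrow> U \<epsilon> t s x) (at s within {0..t})" for x
        using cU[of x] s unfolding continuous_on_def by auto
      from tendsto_within_subset[OF this, of "{s..t}"] show "((\<lambda>r. U \<epsilon> t r (v' s - (1 / \<epsilon>) *\<^sub>R A s (v s))) \<longlongrightarrow> U \<epsilon> t s (v' s - (1 / \<epsilon>) *\<^sub>R A s (v s)))
          (at s within {s..t})"
        using s by auto
    qed
    moreover have "U \<epsilon> t r ((1 / (r - s)) *\<^sub>R (g r - g s)) = (1 / (r - s)) *\<^sub>R (U \<epsilon> t r (v r) - U \<epsilon> t s (v s))"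
      if "r \<in> {s..t}" for r
      unfolding gs using that s t e
      by (simp add: g_def blinfun.bilinear_simps U_compose)
    ultimately show "((\<lambda>s. U \<epsilon> t s (v s)) has_vector_derivative U \<epsilon> t s (v' s - (1 / \<epsilon>) *\<^sub>R A s (v s)))
        (at s within {s..t})"
      unfolding has_vector_derivative_iff_quotient
      by (elim tendsto_cong[THEN iffD1, rotated])
        (auto simp: eventually_at_filter intro!: always_eventually)
  qed
  then show ?thesis by (simp add: U_refl[OF e t])
qed

text \<open>One notion for the trajectories of both comparison evolutions and for their components
  in the range and in the kernel of \<open>P\<close>.\<close>

definition Sol :: "real \<Rightarrow> (real \<Rightarrow> 'a) \<Rightarrow> bool" where
  "Sol \<epsilon> v \<longleftrightarrow> (\<forall>t\<in>{0..1}. v t \<in> D t \<and>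
       (v has_vector_derivative (1 / \<epsilon>) *\<^sub>R A t (v t) + Kc t (v t)) (at t within {0..1})) \<and>
     continuous_on {0..1} (\<lambda>t. A t (v t))"

lemma SolD:
  assumes "Sol \<epsilon> v"
  shows "t \<in> {0..1} \<Longrightarrow> v t \<in> D t"
    "t \<in> {0..1} \<Longrightarrow> (v has_vector_derivative (1 / \<epsilon>) *\<^sub>R A t (v t) + Kc t (v t)) (at t within {0..1})"
    "continuous_on {0..1} (\<lambda>t. A t (v t))" "continuous_on {0..1} v"
proof -
  show 1: "t \<in> {0..1} \<Longrightarrow> v t \<in> D t"
    "t \<in> {0..1} \<Longrightarrow> (v has_vector_derivative (1 / \<epsilon>) *\<^sub>R A t (v t) + Kc t (v t)) (at t within {0..1})"
    "continuous_on {0..1} (\<lambda>t. A t (v t))" for t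
    using assms unfolding Sol_def by blast+
  show "continuous_on {0..1} v"
    by (rule continuous_on_vector_derivative[OF 1(2)])
qed

lemma U_integrand_continuous:
  assumes "\<epsilon> > 0" "t \<in> {0..1}" "continuous_on {0..1} g"
  shows "continuous_on {0..t} (\<lambda>s. U \<epsilon> t s (g s))"
proof (rule continuous_on_sot_apply)
  show "norm (U \<epsilon> t s) \<le> M" if "s \<in> {0..t}" for s using that assms by (intro U_bound) auto
  show "continuous_on {0..t} (\<lambda>s. U \<epsilon> t s x)" for x using assms by (intro U_continuous) auto
  show "continuous_on {0..t} g" using assms by (auto intro: continuous_on_subset)
qed

lemma U_integral_bound:
  assumes "\<epsilon> > 0" "t \<in> {0..1}" "continuous_on {0..1} g" "h integrable_on {0..1}"
    and le: "\<And>s. s \<in> {0..1} \<Longrightarrow> norm (g s) \<le> h s"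
  shows "norm (integral {0..t} (\<lambda>s. U \<epsilon> t s (g s))) \<le> M * integral {0..t} h"
    "norm (integral {0..t} (\<lambda>s. U \<epsilon> t s (g s))) \<le> M * integral {0..1} h"
proof -
  have h: "h integrable_on {0..t}" using assms by (auto intro: integrable_on_subinterval)
  have "norm (integral {0..t} (\<lambda>s. U \<epsilon> t s (g s))) \<le> integral {0..t} (\<lambda>s. M * h s)"
  proof (rule Henstock_Kurzweil_Integration.integral_norm_bound_integral)
    show "(\<lambda>s. U \<epsilon> t s (g s)) integrable_on {0..t}"
      by (intro integrable_continuous_real U_integrand_continuous assms)
    show "(\<lambda>s. M * h s) integrable_on {0..t}" using integrable_cmul[OF h, of M] by simp
    fix s assume s: "s \<in> {0..t}"
    have "norm (U \<epsilon> t s (g s)) \<le> norm (U \<epsilon> t s) * norm (g s)" by (rule norm_blinfun)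
    also have "\<dots> \<le> M * h s"
      using s assms M_ge by (intro mult_mono le U_bound) auto
    finally show "norm (U \<epsilon> t s (g s)) \<le> M * h s" .
  qed
  then show 1: "norm (integral {0..t} (\<lambda>s. U \<epsilon> t s (g s))) \<le> M * integral {0..t} h" by simp
  have "0 \<le> h s" if "s \<in> {0..1}" for s using norm_ge_zero le[OF that] by (rule order_trans)
  then have "M * integral {0..t} h \<le> M * integral {0..1} h"
    using assms M_ge h by (intro mult_left_mono integral_subset_le) auto
  with 1 show "norm (integral {0..t} (\<lambda>s. U \<epsilon> t s (g s))) \<le> M * integral {0..1} h" by simp
qed

lemma Sol_integral:
  assumes e: "\<epsilon> > 0" and v: "Sol \<epsilon> v" and t: "t \<in> {0..1}"
  shows "v t - U \<epsilon> t 0 (v 0) = integral {0..t} (\<lambda>s. U \<epsilon> t s (Kc s (v s)))"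
proof -
  have "continuous_on {0..1} (\<lambda>s. (1 / \<epsilon>) *\<^sub>R A s (v s) + Kc s (v s))"
    by (intro continuous_on_add continuous_on_scaleR continuous_on_const SolD(3)[OF v]
        continuous_on_sot_apply_interval[OF Kc_continuous SolD(4)[OF v]])
  from U_integral[OF e t SolD(1)[OF v] SolD(2)[OF v] this SolD(3)[OF v]]
  show ?thesis by (intro integral_unique[symmetric]) simp
qed

text \<open>The perturbation \<open>Kc\<close> carries no factor \<open>1 / \<epsilon>\<close>, so
  Gronwall's inequality yields a constant independent of \<epsilon>, although no bound is assumed
  for the comparison evolutions.\<close>

lemma Sol_bound:
  obtains C where "C \<ge> 0" "\<And>\<epsilon> v t. \<epsilon> > 0 \<Longrightarrow> Sol \<epsilon> v \<Longrightarrow> t \<in> {0..1} \<Longrightarrow> norm (v t) \<le> C * norm (v 0)"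
proof -
  obtain K where K: "K > 0" "\<And>t. t \<in> {0..1} \<Longrightarrow> norm (Kc t) \<le> K" using sot_bounded[OF Kc_continuous] by blast
  show thesis
  proof (rule that[of "M * exp (M * K)"])
    show "0 \<le> M * exp (M * K)" using M_ge by simp
    fix \<epsilon> v and t :: real assume e: "\<epsilon> > 0" and v: "Sol \<epsilon> v" and t: "t \<in> {0..1}"
    have cn: "continuous_on {0..1} (\<lambda>s. norm (v s))" by (intro continuous_intros SolD[OF v])
    have "norm (v t) \<le> (M * norm (v 0)) * exp ((M * K) * t)"
    proof (rule Gronwall[OF cn _ _ t])
      show "0 \<le> M * K" using M_ge K by simp
      fix s :: real assume s: "s \<in> {0..1}"
      have "norm (v s - U \<epsilon> s 0 (v 0)) \<le> M * integral {0..s} (\<lambda>r. K * norm (v r))"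
        unfolding Sol_integral[OF e v s]
      proof (rule U_integral_bound[OF e s])
        show "continuous_on {0..1} (\<lambda>r. Kc r (v r))"
          by (rule continuous_on_sot_apply_interval[OF Kc_continuous SolD(4)[OF v]])
        show "(\<lambda>r. K * norm (v r)) integrable_on {0..1}"
          by (intro integrable_continuous_real continuous_intros cn)
        show "norm (Kc r (v r)) \<le> K * norm (v r)" if "r \<in> {0..1}" for r
          by (rule order_trans[OF norm_blinfun mult_right_mono[OF K(2)[OF that] norm_ge_zero]])
      qed
      moreover have "norm (U \<epsilon> s 0 (v 0)) \<le> M * norm (v 0)"
        using s e by (intro order_trans[OF norm_blinfun] mult_right_mono U_bound) auto
      moreover have "norm (v s) \<le> norm (v s - U \<epsilon> s 0 (v 0)) + norm (U \<epsilon> s 0 (v 0))"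
        using norm_triangle_ineq[of "v s - U \<epsilon> s 0 (v 0)" "U \<epsilon> s 0 (v 0)"] by simp
      ultimately show "norm (v s) \<le> M * norm (v 0) + M * K * integral {0..s} (\<lambda>r. norm (v r))"
        by simp
    qed
    also have "\<dots> \<le> (M * norm (v 0)) * exp (M * K)"
      using M_ge K t by (intro mult_left_mono) (auto simp: mult_left_le)
    finally show "norm (v t) \<le> M * exp (M * K) * norm (v 0)" by (simp add: mult_ac)
  qed
qed

text \<open>By \<open>Kc_intertwine\<close> and \<open>P A = A P\<close> on the domain. Each
  solution thus splits into one in the range and one in the kernel of \<open>P\<close>, to be
  estimated separately.\<close>

lemma Sol_P:
  assumes v: "Sol \<epsilon> v"
  shows "Sol \<epsilon> (\<lambda>t. P t (v t))"
  unfolding Sol_def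
proof (intro conjI ballI)
  fix t :: real assume t: "t \<in> {0..1}"
  show "P t (v t) \<in> D t" by (rule P_simps(6)[OF t])
  obtain K where K: "\<And>s. s \<in> {0..1} \<Longrightarrow> norm (P s) \<le> K" using sot_bounded[OF P_continuous] by blast
  have "((\<lambda>s. P s (v s)) has_vector_derivative P' t (v t) + P t ((1 / \<epsilon>) *\<^sub>R A t (v t) + Kc t (v t)))
      (at t within {0..1})"
    using P_continuous t
    by (intro has_vector_derivative_sot_apply[OF K _ P_deriv[OF t] SolD(2)[OF v t]]) (auto simp: continuous_on_def)
  moreover have "P' t (v t) + P t ((1 / \<epsilon>) *\<^sub>R A t (v t) + Kc t (v t)) =
      (1 / \<epsilon>) *\<^sub>R A t (P t (v t)) + Kc t (P t (v t))"
    using Kc_intertwine[OF t, of "v t"]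
    by (simp add: blinfun.bilinear_simps P_simps(5)[OF t SolD(1)[OF v t]] algebra_simps)
  ultimately show "((\<lambda>s. P s (v s)) has_vector_derivative (1 / \<epsilon>) *\<^sub>R A t (P t (v t)) + Kc t (P t (v t)))
      (at t within {0..1})" by simp
next
  have "continuous_on {0..1} (\<lambda>t. P t (A t (v t)))"
    by (rule continuous_on_sot_apply_interval[OF P_continuous SolD(3)[OF v]])
  then show "continuous_on {0..1} (\<lambda>t. A t (P t (v t)))"
    by (rule continuous_on_cong[THEN iffD1, OF refl, rotated]) (use P_simps(5) SolD(1)[OF v] in auto)
qed

lemma Sol_diff:
  assumes v: "Sol \<epsilon> v" and w: "Sol \<epsilon> w"
  shows "Sol \<epsilon> (\<lambda>t. v t - w t)"
  unfolding Sol_def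
proof (intro conjI ballI)
  fix t :: real assume t: "t \<in> {0..1}"
  note vw = SolD(1)[OF v t] SolD(1)[OF w t]
  show "v t - w t \<in> D t" by (intro D_simps t vw)
  show "((\<lambda>t. v t - w t) has_vector_derivative (1 / \<epsilon>) *\<^sub>R A t (v t - w t) + Kc t (v t - w t)) (at t within {0..1})"
    using has_vector_derivative_diff[OF SolD(2)[OF v t] SolD(2)[OF w t]]
    by (simp add: A_simps(2)[OF t vw] blinfun.bilinear_simps algebra_simps)
next
  have "continuous_on {0..1} (\<lambda>t. A t (v t) - A t (w t))"
    by (intro continuous_intros SolD[OF v] SolD[OF w])
  then show "continuous_on {0..1} (\<lambda>t. A t (v t - w t))"
    by (rule continuous_on_cong[THEN iffD1, OF refl, rotated]) (use A_simps(2) SolD(1)[OF v] SolD(1)[OF w] in auto)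
qed

subsection \<open>Negligible perturbations\<close>

definition Sol_in :: "(real \<Rightarrow> 'a \<Rightarrow> bool) \<Rightarrow> real \<Rightarrow> (real \<Rightarrow> 'a) \<Rightarrow> bool" where
  "Sol_in S \<epsilon> v \<longleftrightarrow> \<epsilon> > 0 \<and> Sol \<epsilon> v \<and> (\<forall>t\<in>{0..1}. S t (v t))"

lemma Sol_inD:
  assumes "Sol_in S \<epsilon> v"
  shows "\<epsilon> > 0" "Sol \<epsilon> v" "t \<in> {0..1} \<Longrightarrow> S t (v t)"
  using assms by (auto simp: Sol_in_def)

text \<open>Uniformity over all solutions and times, measured against the initial value, is what
  later yields operator norms and the supremum over time.\<close>

definition negl :: "(real \<Rightarrow> 'a \<Rightarrow> bool) \<Rightarrow> (real \<Rightarrow> 'a \<Rightarrow>\<^sub>L 'a) \<Rightarrow> bool" where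
  "negl S E \<longleftrightarrow> (\<forall>\<eta>>0. \<forall>\<^sub>F \<epsilon> in at_right 0. \<forall>v t. Sol_in S \<epsilon> v \<longrightarrow> t \<in> {0..1} \<longrightarrow>
     norm (integral {0..t} (\<lambda>s. U \<epsilon> t s (E s (v s)))) \<le> \<eta> * norm (v 0))"

lemma E_v_continuous:
  fixes E :: "real \<Rightarrow> 'a \<Rightarrow>\<^sub>L 'a"
  assumes "\<And>x. continuous_on {0..1} (\<lambda>t. E t x)" "Sol \<epsilon> v"
  shows "continuous_on {0..1} (\<lambda>t. E t (v t))"
  by (rule continuous_on_sot_apply_interval[OF assms(1) SolD(4)[OF assms(2)]])

lemma U_integral_add:
  fixes E F :: "real \<Rightarrow> 'a \<Rightarrow>\<^sub>L 'a"
  assumes "\<And>x. continuous_on {0..1} (\<lambda>t. E t x)" "\<And>x. continuous_on {0..1} (\<lambda>t. F t x)"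
    and "Sol_in S \<epsilon> v" "t \<in> {0..1}"
  shows "integral {0..t} (\<lambda>s. U \<epsilon> t s ((E s + F s) (v s))) =
    integral {0..t} (\<lambda>s. U \<epsilon> t s (E s (v s))) + integral {0..t} (\<lambda>s. U \<epsilon> t s (F s (v s)))"
  unfolding blinfun.add_left blinfun.add_right
  by (intro Henstock_Kurzweil_Integration.integral_add integrable_continuous_real U_integrand_continuous
      Sol_inD(1)[OF assms(3)] assms(4) E_v_continuous[OF assms(1) Sol_inD(2)[OF assms(3)]]
      E_v_continuous[OF assms(2) Sol_inD(2)[OF assms(3)]])

lemma negl_add:
  fixes E F :: "real \<Rightarrow> 'a \<Rightarrow>\<^sub>L 'a"
  assumes E: "\<And>x. continuous_on {0..1} (\<lambda>t. E t x)" "negl S E"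
    and F: "\<And>x. continuous_on {0..1} (\<lambda>t. F t x)" "negl S F"
  shows "negl S (\<lambda>t. E t + F t)"
  unfolding negl_def
proof (intro allI impI)
  fix \<eta> :: real assume "\<eta> > 0"
  then have eta: "\<eta> / 2 > 0" by simp
  from E(2)[unfolded negl_def, rule_format, OF eta] F(2)[unfolded negl_def, rule_format, OF eta]
  show "\<forall>\<^sub>F \<epsilon> in at_right 0. \<forall>v t. Sol_in S \<epsilon> v \<longrightarrow> t \<in> {0..1} \<longrightarrow>
      norm (integral {0..t} (\<lambda>s. U \<epsilon> t s ((E s + F s) (v s)))) \<le> \<eta> * norm (v 0)"
  proof (eventually_elim, intro allI impI)
    fix \<epsilon> v and t :: real
    assume *: "\<forall>v t. Sol_in S \<epsilon> v \<longrightarrow> t \<in> {0..1} \<longrightarrow>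
        norm (integral {0..t} (\<lambda>s. U \<epsilon> t s (E s (v s)))) \<le> \<eta> / 2 * norm (v 0)"
      "\<forall>v t. Sol_in S \<epsilon> v \<longrightarrow> t \<in> {0..1} \<longrightarrow>
        norm (integral {0..t} (\<lambda>s. U \<epsilon> t s (F s (v s)))) \<le> \<eta> / 2 * norm (v 0)"
      and elim: "Sol_in S \<epsilon> v" "t \<in> {0..1}"
    then have "norm (integral {0..t} (\<lambda>s. U \<epsilon> t s (E s (v s)))) +
        norm (integral {0..t} (\<lambda>s. U \<epsilon> t s (F s (v s)))) \<le> \<eta> / 2 * norm (v 0) + \<eta> / 2 * norm (v 0)"
      by (intro add_mono) auto
    then show "norm (integral {0..t} (\<lambda>s. U \<epsilon> t s ((E s + F s) (v s)))) \<le> \<eta> * norm (v 0)"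
      unfolding U_integral_add[OF E(1) F(1) elim] by (intro order_trans[OF norm_triangle_ineq]) simp
  qed
qed

lemma negl_uminus:
  assumes "negl S E"
  shows "negl S (\<lambda>t. - E t)"
  using assms by (simp add: negl_def blinfun.bilinear_simps)

lemma negl_diff:
  fixes E F :: "real \<Rightarrow> 'a \<Rightarrow>\<^sub>L 'a"
  assumes E: "\<And>x. continuous_on {0..1} (\<lambda>t. E t x)" "negl S E"
    and F: "\<And>x. continuous_on {0..1} (\<lambda>t. F t x)" "negl S F"
  shows "negl S (\<lambda>t. E t - F t)"
  using negl_add[OF E _ negl_uminus[OF F(2)]] F(1) by (simp add: blinfun.minus_left continuous_on_minus)

text \<open>First \<open>n\<close> is chosen so that the mean of \<open>g n\<close> is small, and
  then \<epsilon> according to \<open>F n\<close>. This is the step in which \<delta> or the width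
  of the difference quotient tends to zero.\<close>

lemma negl_approx:
  fixes E :: "real \<Rightarrow> 'a \<Rightarrow>\<^sub>L 'a"
    and F :: "nat \<Rightarrow> real \<Rightarrow> 'a \<Rightarrow>\<^sub>L 'a"
  assumes E: "\<And>x. continuous_on {0..1} (\<lambda>t. E t x)"
    and F: "\<And>n x. continuous_on {0..1} (\<lambda>t. F n t x)" "\<And>n. negl S (F n)"
    and g: "\<And>n. g n \<in> borel_measurable (lebesgue_on {0..1})" "\<And>n t. t \<in> {0..1} \<Longrightarrow> \<bar>g n t\<bar> \<le> K"
      "AE t in lebesgue. t \<in> {0..1} \<longrightarrow> (\<lambda>n. g n t) \<longlonglongrightarrow> 0"
    and le: "\<And>n \<epsilon> v t. Sol_in S \<epsilon> v \<Longrightarrow> t \<in> {0..1} \<Longrightarrow> norm ((E t - F n t) (v t)) \<le> g n t * norm (v 0)"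
  shows "negl S E"
  unfolding negl_def
proof (intro allI impI)
  fix \<eta> :: real assume eta: "\<eta> > 0"
  note g = integral_null_sequence[OF g]
  obtain n where "norm (integral {0..1} (g n) - 0) < \<eta> / 2 / M"
    using LIMSEQ_D[OF g(2), of "\<eta> / 2 / M"] eta M_ge by auto
  then have "integral {0..1} (g n) \<le> \<eta> / 2 / M" by simp
  then have n: "M * integral {0..1} (g n) \<le> \<eta> / 2" using M_ge by (simp add: field_simps)
  have EF: "continuous_on {0..1} (\<lambda>t. (E t - F n t) x)" for x
    unfolding blinfun.diff_left by (intro continuous_intros E F(1))
  from F(2)[of n, unfolded negl_def, rule_format, OF half_gt_zero[OF eta]]
  show "\<forall>\<^sub>F \<epsilon> in at_right 0. \<forall>v t. Sol_in S \<epsilon> v \<longrightarrow> t \<in> {0..1} \<longrightarrow>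
      norm (integral {0..t} (\<lambda>s. U \<epsilon> t s (E s (v s)))) \<le> \<eta> * norm (v 0)"
  proof (eventually_elim, intro allI impI)
    fix \<epsilon> v and t :: real
    assume *: "\<forall>v t. Sol_in S \<epsilon> v \<longrightarrow> t \<in> {0..1} \<longrightarrow>
        norm (integral {0..t} (\<lambda>s. U \<epsilon> t s (F n s (v s)))) \<le> \<eta> / 2 * norm (v 0)"
      and v: "Sol_in S \<epsilon> v" and t: "t \<in> {0..1}"
    have "norm (integral {0..t} (\<lambda>s. U \<epsilon> t s ((E s - F n s) (v s)))) \<le>
        M * integral {0..1} (\<lambda>s. g n s * norm (v 0))"
      by (rule U_integral_bound(2)[OF Sol_inD(1)[OF v] t E_v_continuous[OF EF Sol_inD(2)[OF v]]
            integrable_on_mult_left[OF g(1)] le[OF v]])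
    also have "\<dots> = M * integral {0..1} (g n) * norm (v 0)" by simp
    also have "\<dots> \<le> \<eta> / 2 * norm (v 0)" by (intro mult_right_mono n) auto
    finally show "norm (integral {0..t} (\<lambda>s. U \<epsilon> t s (E s (v s)))) \<le> \<eta> * norm (v 0)"
      using * v t norm_triangle_ineq[of "integral {0..t} (\<lambda>s. U \<epsilon> t s ((E s - F n s) (v s)))"
          "integral {0..t} (\<lambda>s. U \<epsilon> t s (F n s (v s)))"]
        U_integral_add[OF EF F(1) v t, of n] by force
  qed
qed

text \<open>Integration by parts: a perturbation of commutator form \<open>AB - BA\<close> is averaged out.\<close>

lemma negl_commutator:
  fixes B G :: "real \<Rightarrow> 'a \<Rightarrow>\<^sub>L 'a"
  assumes B: "sot_C1_on {0..1} B" and G: "\<And>x. continuous_on {0..1} (\<lambda>t. G t x)"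
    and dom: "\<And>\<epsilon> v t. Sol_in S \<epsilon> v \<Longrightarrow> t \<in> {0..1} \<Longrightarrow> B t (v t) \<in> D t"
    and comm: "\<And>\<epsilon> v t. Sol_in S \<epsilon> v \<Longrightarrow> t \<in> {0..1} \<Longrightarrow>
      A t (B t (v t)) = B t (A t (v t)) + G t (v t)"
  shows "negl S G"
proof -
  obtain B' :: "real \<Rightarrow> 'a \<Rightarrow>\<^sub>L 'a" and KB :: real where B': "\<And>t x. t \<in> {0..1} \<Longrightarrow> ((\<lambda>s. B s x) has_vector_derivative B' t x) (at t within {0..1})"
    "\<And>x. continuous_on {0..1} (\<lambda>t. B' t x)" "\<And>x. continuous_on {0..1} (\<lambda>t. B t x)"
    "\<And>t. t \<in> {0..1} \<Longrightarrow> norm (B t) \<le> KB" "\<And>t. t \<in> {0..1} \<Longrightarrow> norm (B' t) \<le> KB" "KB > 0"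
    by (rule sot_C1_onE[OF B]) blast
  obtain K where K: "K > 0" "\<And>t. t \<in> {0..1} \<Longrightarrow> norm (Kc t) \<le> K" using sot_bounded[OF Kc_continuous] by blast
  obtain C where C: "C \<ge> 0" "\<And>\<epsilon> v t. \<epsilon> > 0 \<Longrightarrow> Sol \<epsilon> v \<Longrightarrow> t \<in> {0..1} \<Longrightarrow> norm (v t) \<le> C * norm (v 0)"
    using Sol_bound by blast
  \<comment> \<open>The three groups bound the integral of \<open>h\<close>, the end value
    \<open>w t\<close> and the propagated initial value
    \<open>U \<epsilon> t 0 (w 0)\<close>.\<close>
  define c where "c = M * (KB * C + KB * (K * C)) + KB * C + M * KB"
  have c: "c > 0" unfolding c_def using M_ge B'(6) K(1) C(1) by (intro add_nonneg_pos) auto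
  have main: "norm (integral {0..t} (\<lambda>s. U \<epsilon> t s (G s (v s)))) \<le> \<epsilon> * c * norm (v 0)"
    if Sv: "Sol_in S \<epsilon> v" and t: "t \<in> {0..1}" for \<epsilon> v t
  proof -
    note e = Sol_inD(1)[OF Sv] and v = Sol_inD(2)[OF Sv]
    \<comment> \<open>In the defect \<open>w' - (1 / \<epsilon>) A w\<close> the terms with
      \<open>B A v\<close> cancel, leaving the bounded \<open>h\<close> and
      \<open>- (1 / \<epsilon>) G v\<close>. Duhamel's formula for \<open>w\<close>, multiplied by
      \<epsilon>, then isolates the integral of \<open>G v\<close>.\<close>
    define w where "w s = B s (v s)" for s
    define h where "h s = B' s (v s) + B s (Kc s (v s))" for s
    have h_cont: "continuous_on {0..1} h"
      unfolding h_def
      by (intro continuous_on_add continuous_on_sot_apply_interval[OF B'(2) SolD(4)[OF v]]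
          continuous_on_sot_apply_interval[OF B'(3) continuous_on_sot_apply_interval[OF Kc_continuous SolD(4)[OF v]]])
    have wD: "w s \<in> D s" if "s \<in> {0..1}" for s unfolding w_def by (rule dom[OF Sv that])
    have w': "(w has_vector_derivative B' s (v s) + B s ((1 / \<epsilon>) *\<^sub>R A s (v s) + Kc s (v s))) (at s within {0..1})"
      if s: "s \<in> {0..1}" for s
      unfolding w_def[abs_def]
      using B'(3) s
      by (intro has_vector_derivative_sot_apply[OF B'(4) _ B'(1)[OF s] SolD(2)[OF v s]]) (auto simp: continuous_on_def)
    have w'_cont: "continuous_on {0..1} (\<lambda>s. B' s (v s) + B s ((1 / \<epsilon>) *\<^sub>R A s (v s) + Kc s (v s)))"
      by (intro continuous_on_add continuous_on_sot_apply_interval[OF B'(2) SolD(4)[OF v]] continuous_on_sot_apply_interval[OF B'(3)]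
          continuous_on_scaleR continuous_on_const SolD(3)[OF v] continuous_on_sot_apply_interval[OF Kc_continuous SolD(4)[OF v]])
    have "continuous_on {0..1} (\<lambda>s. B s (A s (v s)) + G s (v s))"
      by (intro continuous_on_add continuous_on_sot_apply_interval[OF B'(3) SolD(3)[OF v]] continuous_on_sot_apply_interval[OF G SolD(4)[OF v]])
    then have Aw_cont: "continuous_on {0..1} (\<lambda>s. A s (w s))"
      unfolding w_def by (rule continuous_on_cong[THEN iffD2, OF refl, rotated]) (rule comm[OF Sv])
    have "((\<lambda>s. U \<epsilon> t s (h s - (1 / \<epsilon>) *\<^sub>R G s (v s))) has_integral (w t - U \<epsilon> t 0 (w 0))) {0..t}"
    proof (rule has_integral_eq[OF _ U_integral[OF e t wD w' w'_cont Aw_cont]])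
      fix s assume "s \<in> {0..t}"
      then have s: "s \<in> {0..1}" using t by auto
      show "U \<epsilon> t s (B' s (v s) + B s ((1 / \<epsilon>) *\<^sub>R A s (v s) + Kc s (v s)) - (1 / \<epsilon>) *\<^sub>R A s (w s)) =
          U \<epsilon> t s (h s - (1 / \<epsilon>) *\<^sub>R G s (v s))"
        unfolding w_def comm[OF Sv s] h_def by (simp add: blinfun.bilinear_simps scaleR_add_right)
    qed
    then have "w t - U \<epsilon> t 0 (w 0) = integral {0..t} (\<lambda>s. U \<epsilon> t s (h s) - (1 / \<epsilon>) *\<^sub>R U \<epsilon> t s (G s (v s)))"
      by (intro integral_unique[symmetric]) (simp add: blinfun.bilinear_simps)
    also have "\<dots> = integral {0..t} (\<lambda>s. U \<epsilon> t s (h s)) - integral {0..t} (\<lambda>s. (1 / \<epsilon>) *\<^sub>R U \<epsilon> t s (G s (v s)))"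
      by (intro Henstock_Kurzweil_Integration.integral_diff integrable_continuous_real continuous_intros
          U_integrand_continuous E_v_continuous[OF G v] h_cont e t)
    finally have fin: "(1 / \<epsilon>) *\<^sub>R integral {0..t} (\<lambda>s. U \<epsilon> t s (G s (v s))) =
        integral {0..t} (\<lambda>s. U \<epsilon> t s (h s)) - w t + U \<epsilon> t 0 (w 0)"
      by (simp add: algebra_simps)
    have eq: "integral {0..t} (\<lambda>s. U \<epsilon> t s (G s (v s))) =
        \<epsilon> *\<^sub>R (integral {0..t} (\<lambda>s. U \<epsilon> t s (h s)) - w t + U \<epsilon> t 0 (w 0))"
      using arg_cong[OF fin, of "scaleR \<epsilon>"] e by simp
    have Bv: "norm (T (v s)) \<le> L * (C * norm (v 0))" if "norm T \<le> L" "s \<in> {0..1}" for T :: "'a \<Rightarrow>\<^sub>L 'a" and L s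
      using that C(2)[OF e v that(2)]
      by (intro order_trans[OF norm_blinfun] mult_mono) (auto intro: order_trans[OF norm_ge_zero])
    have "norm (integral {0..t} (\<lambda>s. U \<epsilon> t s (h s))) \<le> M * integral {0..1} (\<lambda>s :: real. (KB * C + KB * (K * C)) * norm (v 0))"
    proof (rule U_integral_bound(2)[OF e t h_cont])
      fix s :: real assume s: "s \<in> {0..1}"
      have "norm (B s (Kc s (v s))) \<le> KB * (K * (C * norm (v 0)))"
        by (rule order_trans[OF norm_blinfun mult_mono[OF B'(4)[OF s] Bv[OF K(2)[OF s] s]]]) (use B'(6) in auto)
      then show "norm (h s) \<le> (KB * C + KB * (K * C)) * norm (v 0)"
        unfolding h_def using Bv[OF B'(5)[OF s] s] by (intro order_trans[OF norm_triangle_ineq]) (simp add: algebra_simps)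
    qed (auto intro: integrable_continuous_real continuous_on_const)
    then have 1: "norm (integral {0..t} (\<lambda>s. U \<epsilon> t s (h s))) \<le> M * (KB * C + KB * (K * C)) * norm (v 0)"
      by (simp add: mult.assoc)
    have 2: "norm (w t) \<le> KB * C * norm (v 0)"
      using Bv[OF B'(4)[OF t] t] by (simp add: w_def mult.assoc)
    have "norm (w 0) \<le> KB * norm (v 0)"
      unfolding w_def by (rule order_trans[OF norm_blinfun mult_right_mono[OF B'(4)]]) auto
    then have 3: "norm (U \<epsilon> t 0 (w 0)) \<le> M * KB * norm (v 0)"
      unfolding mult.assoc using t e M_ge
      by (intro order_trans[OF norm_blinfun] mult_mono U_bound) auto
    have "norm (integral {0..t} (\<lambda>s. U \<epsilon> t s (h s)) - w t + U \<epsilon> t 0 (w 0)) \<le> c * norm (v 0)"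
      using norm_triangle_ineq[of "integral {0..t} (\<lambda>s. U \<epsilon> t s (h s)) - w t" "U \<epsilon> t 0 (w 0)"]
        norm_triangle_ineq4[of "integral {0..t} (\<lambda>s. U \<epsilon> t s (h s))" "w t"] 1 2 3
      unfolding c_def distrib_right by linarith
    then show ?thesis unfolding eq using e by (simp add: mult.assoc)
  qed
  show ?thesis
    unfolding negl_def
  proof (intro allI impI)
    fix \<eta> :: real assume "\<eta> > 0"
    then have "\<forall>\<^sub>F \<epsilon> in at_right 0. \<epsilon> < \<eta> / c" 
      using c unfolding eventually_at_right_field by (intro exI[of _ "\<eta> / c"]) simp
    then show "\<forall>\<^sub>F \<epsilon> in at_right 0. \<forall>v t. Sol_in S \<epsilon> v \<longrightarrow> t \<in> {0..1} \<longrightarrow>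
        norm (integral {0..t} (\<lambda>s. U \<epsilon> t s (G s (v s)))) \<le> \<eta> * norm (v 0)"
    proof (eventually_elim, intro allI impI)
      fix \<epsilon> v and t :: real assume e: "\<epsilon> < \<eta> / c" and v: "Sol_in S \<epsilon> v" "t \<in> {0..1}"
      have "\<epsilon> * c \<le> \<eta>" using e c by (simp add: field_simps)
      then show "norm (integral {0..t} (\<lambda>s. U \<epsilon> t s (G s (v s)))) \<le> \<eta> * norm (v 0)"
        by (rule order_trans[OF main[OF v] mult_right_mono[OF _ norm_ge_zero]])
    qed
  qed
qed

end

lemma sot_C1_on_sum:
  fixes F :: "nat \<Rightarrow> real \<Rightarrow> 'a::complex_banach \<Rightarrow>\<^sub>L 'a"
  assumes "\<And>j. sot_C1_on {0..1} (F j)"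
  shows "sot_C1_on {0..1} (\<lambda>t. \<Sum>j<n. F j t)"
  by (induction n) (auto intro: sot_C1_on_const sot_C1_on_add assms)

lemma complex_linear_op_simps:
  "complex_linear_op S \<Longrightarrow> complex_linear_op T \<Longrightarrow> complex_linear_op (S o\<^sub>L T)"
  "complex_linear_op S \<Longrightarrow> complex_linear_op T \<Longrightarrow> complex_linear_op (S + T)"
  "complex_linear_op S \<Longrightarrow> complex_linear_op T \<Longrightarrow> complex_linear_op (S - T)"
  "complex_linear_op S \<Longrightarrow> complex_linear_op (r *\<^sub>R S)"
  "complex_linear_op (cmul c)" "complex_linear_op id_blinfun"
  by (simp_all add: complex_linear_op_def blinfun.bilinear_simps scaleC_add_right
      complex_vector.scale_right_diff_distrib scaleR_scaleC scaleC_scaleC mult.commute)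

lemma SUP_tendsto_zero:
  fixes f :: "real \<Rightarrow> real \<Rightarrow> real"
  assumes nonneg: "\<And>\<epsilon> t. 0 \<le> f \<epsilon> t"
    and le: "\<And>\<eta>. \<eta> > 0 \<Longrightarrow> \<forall>\<^sub>F \<epsilon> in at_right 0. \<forall>t\<in>{0..1}. f \<epsilon> t \<le> \<eta>"
  shows "((\<lambda>\<epsilon>. SUP t\<in>{0..1}. f \<epsilon> t) \<longlongrightarrow> 0) (at_right 0)"
proof (rule tendstoI)
  fix e :: real assume e: "e > 0"
  from le[OF half_gt_zero[OF e]] show "\<forall>\<^sub>F \<epsilon> in at_right 0. dist (SUP t\<in>{0..1}. f \<epsilon> t) 0 < e"
  proof eventually_elim
    case (elim \<epsilon>)
    then have "(SUP t\<in>{0..1}. f \<epsilon> t) \<le> e / 2" by (intro cSUP_least) auto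
    moreover have "f \<epsilon> 0 \<le> (SUP t\<in>{0..1}. f \<epsilon> t)"
      using elim by (intro cSUP_upper bdd_aboveI2[where M = "e / 2"]) auto
    ultimately show ?case using nonneg[of \<epsilon> 0] e by (simp add: dist_norm)
  qed
qed

context adiabatic
begin

subsection \<open>The nilpotent part\<close>

text \<open>On the range of \<open>P\<close> this is \<open>- R (A - \<lambda>)\<close> with the
  resolvent \<open>R\<close> at distance \<open>\<delta>\<^sub>0\<close>, hence nilpotent like
  \<open>A - \<lambda>\<close>.\<close>

definition res_part :: "real \<Rightarrow> 'a \<Rightarrow>\<^sub>L 'a" where
  "res_part t = P t - (cmul (of_real \<delta>\<^sub>0 * z t) o\<^sub>L R \<delta>\<^sub>0 t o\<^sub>L P t)"

primrec res_power :: "nat \<Rightarrow> real \<Rightarrow> 'a \<Rightarrow>\<^sub>L 'a" where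
  "res_power 0 t = P t"
| "res_power (Suc j) t = (res_part t o\<^sub>L res_power j t)"

text \<open>This is \<open>(A - \<lambda>) P\<close>, obtained from the resolvent by a finite Neumann series. In this form
  it is visibly bounded and strongly continuously differentiable.\<close>

definition N :: "real \<Rightarrow> 'a \<Rightarrow>\<^sub>L 'a" where
  "N t = (cmul (of_real \<delta>\<^sub>0 * z t) o\<^sub>L (P t - (\<Sum>j<m\<^sub>0. res_power j t)))"

lemma delta_z_C1: "sot_C1_on {0..1} (\<lambda>t. cmul (of_real \<delta> * z t) :: 'a \<Rightarrow>\<^sub>L 'a)"
proof (rule sot_C1_on_cmul)
  obtain z' where z': "\<And>t. t \<in> {0..1} \<Longrightarrow> (z has_vector_derivative z' t) (at t within {0..1})"
    "continuous_on {0..1} z'"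
    using z_C1 unfolding C1_on_def by blast
  have 1: "((\<lambda>t. of_real \<delta> * z t) has_vector_derivative of_real \<delta> * z' t) (at t within {0..1})" if "t \<in> {0..1}" for t
    by (rule bounded_linear.has_vector_derivative[OF bounded_linear_mult_right z'(1)[OF that]])
  have 2: "continuous_on {0..1} (\<lambda>t. of_real \<delta> * z' t)" by (rule continuous_on_mult_left[OF z'(2)])
  show "C1_on {0..1} (\<lambda>t. of_real \<delta> * z t)"
    unfolding C1_on_def by (intro exI[of _ "\<lambda>t. of_real \<delta> * z' t"] conjI ballI 1 2)
qed

lemma delta0_in: "\<delta>\<^sub>0 \<in> {0<..\<delta>\<^sub>0}"
  using delta0_pos by simp

lemma N_C1: "sot_C1_on {0..1} N"
proof -
  have part: "sot_C1_on {0..1} res_part"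
    unfolding res_part_def[abs_def]
    by (rule sot_C1_on_diff[OF P_C1 sot_C1_on_compose[OF sot_C1_on_compose[OF delta_z_C1 R_C1[OF delta0_in]] P_C1]])
  have power: "sot_C1_on {0..1} (res_power j)" for j
  proof (induction j)
    case 0
    have "res_power 0 = P" by (rule ext) simp
    then show ?case using P_C1 by simp
  next
    case (Suc j)
    have "res_power (Suc j) = (\<lambda>t. res_part t o\<^sub>L res_power j t)" by (rule ext) simp
    then show ?case using sot_C1_on_compose[OF part Suc] by simp
  qed
  show ?thesis
    unfolding N_def[abs_def]
    by (rule sot_C1_on_compose[OF delta_z_C1 sot_C1_on_diff[OF P_C1 sot_C1_on_sum[OF power]]])
qed

text \<open>On the range of \<open>P\<close>, \<open>1 - res_part\<close> is \<open>q R\<close> with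
  \<open>q = \<delta>\<^sub>0 z\<close>. The finite Neumann sum \<open>G\<close> of
  \<open>y = P x\<close> therefore solves \<open>q R G = y\<close>, and applying \<open>A\<close> to
  this equation gives \<open>(A - \<lambda>) y = q (y - G)\<close>. Since \<open>A\<close> is linear
  on its domain only, all computations stay inside the range \<open>X\<close>.\<close>

lemma N_apply:
  assumes t: "t \<in> {0..1}"
  shows "N t x = A t (P t x) - l t *\<^sub>C P t x"
proof -
  define q where "q = of_real \<delta>\<^sub>0 * z t"
  define a where "a = shifted (A t) (l t)"
  define X where "X = range (P t)"
  note Rs = R_simps[OF t delta0_in, folded q_def]
  have X: "P t u = u" "u \<in> D t" if "u \<in> X" for u
    using that P_simps(1,6)[OF t] by (auto simp: X_def)
  have XI: "u \<in> X" if "P t u = u" for u using that unfolding X_def by (metis rangeI)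
  have a_X: "a u \<in> X" if u: "u \<in> X" for u
    using P_simps(5)[OF t X(2)[OF u]] X(1)[OF u]
    by (intro XI) (simp add: a_def shifted_def blinfun.diff_right P_simps(3)[OF t])
  have R_X: "R \<delta>\<^sub>0 t u \<in> X" if "u \<in> X" for u
    using Rs(5)[of u] X(1)[OF that] by (intro XI) simp
  have neg_X: "- u \<in> X" if "u \<in> X" for u
    using X(1)[OF that] by (intro XI) (simp add: blinfun.minus_right)
  have aR: "a (R \<delta>\<^sub>0 t u) = q *\<^sub>C R \<delta>\<^sub>0 t u - u" for u
    by (simp add: a_def shifted_def Rs(2) scaleC_add_left)
  have Ra: "R \<delta>\<^sub>0 t (a u) = q *\<^sub>C R \<delta>\<^sub>0 t u - u" if "u \<in> X" for u
    using Rs(3)[OF X(2)[OF that]]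
    by (simp add: a_def shifted_def blinfun.diff_right complex_linear_opD[OF Rs(4)] scaleC_add_left)
  have aR_power: "(a ^^ k) (R \<delta>\<^sub>0 t u) = R \<delta>\<^sub>0 t ((a ^^ k) u)" if "u \<in> X" for k u
    using that
  proof (induction k arbitrary: u)
    case (Suc k)
    have "(a ^^ Suc k) (R \<delta>\<^sub>0 t u) = (a ^^ k) (R \<delta>\<^sub>0 t (a u))"
      by (simp add: funpow_swap1 aR Ra[OF Suc.prems])
    also have "\<dots> = R \<delta>\<^sub>0 t ((a ^^ Suc k) u)"
      using Suc.IH[OF a_X[OF Suc.prems]] by (simp add: funpow_swap1)
    finally show ?case .
  qed simp
  have a_neg_power: "(a ^^ k) (- u) = - (a ^^ k) u" if "u \<in> X" for k u
    using that
  proof (induction k arbitrary: u)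
    case (Suc k)
    have "a (- u) = - a u"
      using A_simps(4)[OF t X(2)[OF Suc.prems], of "- 1"] by (simp add: a_def shifted_def)
    then show ?case using Suc.IH[OF a_X[OF Suc.prems]] by (simp add: funpow_swap1)
  qed simp
  have part: "res_part t u = - R \<delta>\<^sub>0 t (a u)" "res_part t u = u - q *\<^sub>C R \<delta>\<^sub>0 t u" if "u \<in> X" for u
    using Ra[OF that] X(1)[OF that]
    by (simp_all add: res_part_def blinfun.bilinear_simps q_def)
  have part_X: "res_part t u \<in> X" if "u \<in> X" for u
    unfolding part(1)[OF that] by (intro neg_X R_X a_X that)
  \<comment> \<open>As \<open>R\<close> and \<open>a\<close> commute on \<open>X\<close>,
    \<open>res_part\<close> maps the kernel of \<open>a ^^ Suc k\<close> into that of
    \<open>a ^^ k\<close>.\<close>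
  have nilpotent: "(blinfun_apply (res_part t) ^^ k) u = 0" if "u \<in> X" "(a ^^ k) u = 0" for k u
    using that
  proof (induction k arbitrary: u)
    case (Suc k)
    have "(a ^^ k) (res_part t u) = - R \<delta>\<^sub>0 t ((a ^^ k) (a u))"
      unfolding part(1)[OF Suc.prems(1)]
      by (simp add: a_neg_power[OF R_X[OF a_X[OF Suc.prems(1)]]] aR_power[OF a_X[OF Suc.prems(1)]])
    also have "\<dots> = 0" using Suc.prems(2) by (simp add: funpow_swap1)
    finally show ?case
      using Suc.IH[OF part_X[OF Suc.prems(1)]] by (simp add: funpow_swap1)
  qed simp
  define y where "y = P t x"
  have yX: "y \<in> X" by (simp add: y_def X_def)
  have power: "res_power j t x = (blinfun_apply (res_part t) ^^ j) y" for j by (induction j) (simp_all add: y_def)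
  have power_X: "(blinfun_apply (res_part t) ^^ j) y \<in> X" for j by (induction j) (simp_all add: yX part_X)
  define G where "G = (\<Sum>j<m\<^sub>0. (blinfun_apply (res_part t) ^^ j) y)"
  have "P t G = G" unfolding G_def blinfun.sum_right using X(1)[OF power_X] by simp
  then have GX: "G \<in> X" by (rule XI)
  have "y \<in> kernel_power (D t) (A t) (l t) m\<^sub>0" using P_ker[OF t] by (auto simp: y_def)
  then have "(a ^^ m\<^sub>0) y = 0" by (simp add: kernel_power_def a_def)
  then have zero: "(blinfun_apply (res_part t) ^^ m\<^sub>0) y = 0" by (rule nilpotent[OF yX])
  have "G - res_part t G = (\<Sum>j<m\<^sub>0. (blinfun_apply (res_part t) ^^ j) y - (blinfun_apply (res_part t) ^^ Suc j) y)"
    by (simp add: G_def blinfun.sum_right sum_subtractf)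
  also have "\<dots> = y - (blinfun_apply (res_part t) ^^ m\<^sub>0) y"
    by (subst sum_lessThan_telescope') simp
  finally have "q *\<^sub>C R \<delta>\<^sub>0 t G = y" unfolding part(2)[OF GX] zero by simp
  then have "A t y = q *\<^sub>C A t (R \<delta>\<^sub>0 t G)" using A_simps(3)[OF t Rs(1)] by metis
  also have "\<dots> = (l t + q) *\<^sub>C (q *\<^sub>C R \<delta>\<^sub>0 t G) - q *\<^sub>C G"
    by (simp add: Rs(2) complex_vector.scale_right_diff_distrib scaleC_scaleC mult.commute)
  also have "\<dots> = (l t + q) *\<^sub>C y - q *\<^sub>C G" using \<open>q *\<^sub>C R \<delta>\<^sub>0 t G = y\<close> by simp
  finally have "A t y - l t *\<^sub>C y = q *\<^sub>C (y - G)"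
    by (simp add: scaleC_add_left complex_vector.scale_right_diff_distrib)
  then show ?thesis
    by (simp add: N_def q_def[symmetric] y_def[symmetric] blinfun.diff_left blinfun.sum_left power G_def)
qed

lemma N_simps:
  assumes t: "t \<in> {0..1}"
  shows "N t (P t x) = N t x" "P t (N t x) = N t x" "complex_linear_op (N t)" "(blinfun_apply (N t) ^^ m\<^sub>0) (P t x) = 0"
    "A t (P t x) = N t x + l t *\<^sub>C P t x"
proof -
  show NP: "N t (P t x) = N t x" for x by (simp add: N_apply[OF t] P_simps(1)[OF t])
  show PN: "P t (N t x) = N t x" for x
    by (simp add: N_apply[OF t] P_simps(1,3)[OF t] P_AP[OF t] blinfun.diff_right)
  show "complex_linear_op (N t)"
    by (simp add: complex_linear_op_def N_apply[OF t] P_simps(3)[OF t] A_simps(3)[OF t P_simps(6)[OF t]]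
      complex_vector.scale_right_diff_distrib scaleC_scaleC mult.commute)
  show "A t (P t x) = N t x + l t *\<^sub>C P t x" by (simp add: N_apply[OF t])
  have "P t u = u \<Longrightarrow> (blinfun_apply (N t) ^^ k) u = (shifted (A t) (l t) ^^ k) u" for u k
  proof (induction k arbitrary: u)
    case (Suc k)
    have "N t u = shifted (A t) (l t) u" using N_apply[OF t, of u] Suc.prems by (simp add: shifted_def)
    then show ?case using Suc.IH[OF PN[of u]] by (simp add: funpow_swap1)
  qed simp
  moreover have "(shifted (A t) (l t) ^^ m\<^sub>0) (P t x) = 0"
    using P_ker[OF t] unfolding kernel_power_def by auto
  ultimately show "(blinfun_apply (N t) ^^ m\<^sub>0) (P t x) = 0" by (simp add: P_simps(1)[OF t])
qed

lemma N_continuous: "continuous_on {0..1} (\<lambda>t. N t x)"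
  by (rule sot_C1_on_continuous[OF N_C1])

subsection \<open>Transport of the spectral subspaces\<close>

text \<open>Both sides solve the transport equation with the same value at time \<open>s\<close>;
  for the left one this is \<open>Kc_intertwine\<close>.\<close>

lemma propagator_intertwines:
  assumes gen: "sot_generator Kc K" and st: "s \<in> {0..1}" "t \<in> {0..1}"
  shows "P t (sot_generator.propagator Kc t s x) = sot_generator.propagator Kc t s (P s x)"
proof -
  interpret gen: sot_generator Kc K by (rule gen)
  have "gen.solves (\<lambda>t. P t (gen.propagator t s x))"
    unfolding gen.solves_def
  proof
    fix t :: real assume t: "t \<in> {0..1}"
    obtain C where C: "\<And>s. s \<in> {0..1} \<Longrightarrow> norm (P s) \<le> C" using sot_bounded[OF P_continuous] by blast
    have lim: "((\<lambda>r. P r (Kc t (gen.propagator t s x))) \<longlongrightarrow> P t (Kc t (gen.propagator t s x))) (at t within {0..1})"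
      using P_continuous t unfolding continuous_on_def by blast
    have W': "((\<lambda>t. gen.propagator t s x) has_vector_derivative Kc t (gen.propagator t s x)) (at t within {0..1})"
      using gen.propagator_solves[OF st(1)] t unfolding gen.solves_def by blast
    have "((\<lambda>r. P r (gen.propagator r s x)) has_vector_derivative
        P' t (gen.propagator t s x) + P t (Kc t (gen.propagator t s x))) (at t within {0..1})"
      by (rule has_vector_derivative_sot_apply[OF C lim P_deriv[OF t] W'])
    then show "((\<lambda>r. P r (gen.propagator r s x)) has_vector_derivative
        Kc t (P t (gen.propagator t s x))) (at t within {0..1})"
      by (simp add: Kc_intertwine[OF t])
  qed
  from gen.propagator_unique[OF this st] show ?thesis by (simp add: gen.propagator_init[OF st(1)])
qed

abbreviation (input) in_range :: "real \<Rightarrow> 'a \<Rightarrow> bool" where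
  "in_range t y \<equiv> P t y = y"

abbreviation (input) in_kernel :: "real \<Rightarrow> 'a \<Rightarrow> bool" where
  "in_kernel t y \<equiv> P t y = 0"

text \<open>Finite rank is known at time 0 only. Conjugation by the transport,
  \<open>P t = W P 0 W\<inverse>\<close>, turns a decomposition of \<open>P 0\<close> into one of
  every \<open>P t\<close>, with continuous vectors and uniformly bounded coefficients.\<close>

lemma P_expansion:
  obtains B :: "'a set" and w :: "'a \<Rightarrow> real \<Rightarrow> 'a" and f :: "'a \<Rightarrow> real \<Rightarrow> 'a \<Rightarrow> complex" and C :: real
  where "finite B" "C \<ge> 0" "\<And>b. continuous_on {0..1} (w b)"
    "\<And>t x. t \<in> {0..1} \<Longrightarrow> P t x = (\<Sum>b\<in>B. f b t x *\<^sub>C w b t)"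
    "\<And>b t x. b \<in> B \<Longrightarrow> t \<in> {0..1} \<Longrightarrow> cmod (f b t x) \<le> C * norm x"
proof -
  obtain K where gen: "sot_generator Kc K" using Kc_generator by blast
  interpret gen: sot_generator Kc K by (rule gen)
  have 0: "(0::real) \<in> {0..1}" by simp
  obtain B and g :: "'a \<Rightarrow> 'a \<Rightarrow>\<^sub>L complex"
    where B: "finite B" "\<And>b. b \<in> B \<Longrightarrow> g b \<in> complex_dual" "\<And>x. P 0 x = (\<Sum>b\<in>B. g b x *\<^sub>C b)"
    by (rule finite_rank_decomposition[OF P_simps(2)[OF 0] P0_rank]) (rule that)
  define C where "C = (\<Sum>b\<in>B. norm (g b)) * exp K"
  show thesis
  proof (rule that[of B C "\<lambda>b t. gen.propagator t 0 b" "\<lambda>b t x. g b (gen.propagator 0 t x)"])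
    show "C \<ge> 0" unfolding C_def by (intro mult_nonneg_nonneg sum_nonneg) auto
    show "continuous_on {0..1} (\<lambda>t. gen.propagator t 0 b)" for b
      by (rule continuous_on_vector_derivative[OF gen.propagator_solves[OF 0, of b, unfolded gen.solves_def, rule_format]])
    show "P t x = (\<Sum>b\<in>B. g b (gen.propagator 0 t x) *\<^sub>C gen.propagator t 0 b)" if t: "t \<in> {0..1}" for t x
    proof -
      have "P t x = gen.propagator t 0 (P 0 (gen.propagator 0 t x))"
        using propagator_intertwines[OF gen 0 t, of "gen.propagator 0 t x"] gen.propagator_compose[OF t 0 t]
          gen.propagator_init[OF t] by simp
      then show ?thesis
        unfolding B(3) blinfun.sum_right by (simp add: complex_linear_opD[OF gen.propagator_apply(2)[OF 0 t]])
    qed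
    show "cmod (g b (gen.propagator 0 t x)) \<le> C * norm x" if b: "b \<in> B" and t: "t \<in> {0..1}" for b t x
    proof -
      have 1: "norm (gen.propagator 0 t x) \<le> exp K * norm x"
        by (rule order_trans[OF norm_blinfun mult_right_mono[OF gen.propagator_apply(3)[OF t 0]]]) simp
      have 2: "norm (g b) \<le> (\<Sum>b\<in>B. norm (g b))"
        by (rule member_le_sum[OF b]) (auto simp: B)
      show ?thesis
        unfolding C_def mult.assoc
        by (rule order_trans[OF norm_blinfun mult_mono[OF 2 1]]) (auto intro: sum_nonneg)
    qed
  qed (rule B(1))
qed

lemma finite_rank_P_compose:
  fixes E :: "'a \<Rightarrow>\<^sub>L 'a"
  assumes t: "t \<in> {0..1}" and E: "\<And>x. P t (E x) = E x"
  shows "finite_rank E"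
proof -
  obtain B :: "'a set" and w :: "'a \<Rightarrow> real \<Rightarrow> 'a" and f :: "'a \<Rightarrow> real \<Rightarrow> 'a \<Rightarrow> complex"
    where B: "finite B" "\<And>t x. t \<in> {0..1} \<Longrightarrow> P t x = (\<Sum>b\<in>B. f b t x *\<^sub>C w b t)"
    by (rule P_expansion) blast
  have "E x \<in> complex_vector.span ((\<lambda>b. w b t) ` B)" for x
  proof -
    have "E x = (\<Sum>b\<in>B. f b t (E x) *\<^sub>C w b t)" using B(2)[OF t, of "E x"] E by simp
    also have "\<dots> \<in> complex_vector.span ((\<lambda>b. w b t) ` B)"
      by (intro complex_vector.span_sum complex_vector.span_scale complex_vector.span_base imageI)
    finally show ?thesis .
  qed
  then show ?thesis unfolding finite_rank_def using B(1) by blast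
qed

text \<open>Reduces estimates on all solutions in the range of \<open>P\<close> to the finitely many
  fixed curves \<open>w b\<close>, so that pointwise convergence of operators becomes uniform over
  solutions.\<close>

lemma Sol_expansion:
  obtains B :: "'a set" and w :: "'a \<Rightarrow> real \<Rightarrow> 'a" and C :: real
  where "finite B" "C \<ge> 0" "\<And>b. continuous_on {0..1} (w b)"
    "\<And>\<epsilon> v t T. Sol_in in_range \<epsilon> v \<Longrightarrow> t \<in> {0..1} \<Longrightarrow> complex_linear_op T \<Longrightarrow>
      norm (T (v t)) \<le> (C * (\<Sum>b\<in>B. norm (T (w b t)))) * norm (v 0)"
proof -
  obtain B :: "'a set" and w :: "'a \<Rightarrow> real \<Rightarrow> 'a" and f :: "'a \<Rightarrow> real \<Rightarrow> 'a \<Rightarrow> complex" and C :: real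
    where B: "finite B" "C \<ge> 0" "\<And>b. continuous_on {0..1} (w b)"
    "\<And>t x. t \<in> {0..1} \<Longrightarrow> P t x = (\<Sum>b\<in>B. f b t x *\<^sub>C w b t)"
    "\<And>b t x. b \<in> B \<Longrightarrow> t \<in> {0..1} \<Longrightarrow> cmod (f b t x) \<le> C * norm x"
    by (rule P_expansion) (rule that)
  obtain C' where C': "C' \<ge> 0" "\<And>\<epsilon> v t. \<epsilon> > 0 \<Longrightarrow> Sol \<epsilon> v \<Longrightarrow> t \<in> {0..1} \<Longrightarrow> norm (v t) \<le> C' * norm (v 0)"
    using Sol_bound by blast
  show thesis
  proof (rule that[OF B(1) _ B(3), of "C * C'"])
    show "C * C' \<ge> 0" using B(2) C'(1) by simp
    fix \<epsilon> v and t :: real and T :: "'a \<Rightarrow>\<^sub>L 'a"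
    assume v: "Sol_in in_range \<epsilon> v" and t: "t \<in> {0..1}"
      and T: "complex_linear_op T"
    have "T (v t) = T (P t (v t))" using Sol_inD(3)[OF v t] by simp
    also have "\<dots> = (\<Sum>b\<in>B. f b t (v t) *\<^sub>C T (w b t))"
      unfolding B(4)[OF t] by (simp add: blinfun.sum_right complex_linear_opD[OF T])
    also have "norm \<dots> \<le> (\<Sum>b\<in>B. (C * C' * norm (v 0)) * norm (T (w b t)))"
    proof (rule sum_norm_le)
      fix b assume b: "b \<in> B"
      have "cmod (f b t (v t)) \<le> C * (C' * norm (v 0))"
        by (rule order_trans[OF B(5)[OF b t] mult_left_mono[OF C'(2)[OF Sol_inD(1,2)[OF v] t] B(2)]])
      then show "norm (f b t (v t) *\<^sub>C T (w b t)) \<le> (C * C' * norm (v 0)) * norm (T (w b t))"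
        unfolding norm_scaleC by (intro mult_right_mono) (auto simp: mult.assoc)
    qed
    also have "\<dots> = (C * C' * (\<Sum>b\<in>B. norm (T (w b t)))) * norm (v 0)"
      by (simp add: sum_distrib_left[symmetric] mult_ac)
    finally show "norm (T (v t)) \<le> (C * C' * (\<Sum>b\<in>B. norm (T (w b t)))) * norm (v 0)" .
  qed
qed

subsection \<open>Vanishing of the reduced resolvents\<close>

text \<open>The factor \<delta> just compensates the resolvent estimate, giving a bound uniform in
  \<delta>.\<close>

definition red_res :: "real \<Rightarrow> real \<Rightarrow> 'a \<Rightarrow>\<^sub>L 'a" where
  "red_res \<delta> t = \<delta> *\<^sub>R (R \<delta> t o\<^sub>L (id_blinfun - P t))"

lemma red_res_apply: "red_res \<delta> t x = \<delta> *\<^sub>R R \<delta> t (x - P t x)"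
  by (simp add: red_res_def blinfun.bilinear_simps)

lemma red_res_norm:
  assumes "t \<in> {0..1}" "\<delta> \<in> {0<..\<delta>\<^sub>0}"
  shows "norm (red_res \<delta> t) \<le> M\<^sub>0"
  using R_bound[OF assms] assms by (simp add: red_res_def field_simps)

text \<open>On the kernel of \<open>P\<close>,
  \<open>R (A - \<lambda>) x = \<delta> z R x - x\<close> is bounded uniformly in \<delta>, so the
  factor \<delta> in front survives.\<close>

lemma red_res_shifted:
  assumes t: "t \<in> {0..1}" and d: "\<delta> \<in> {0<..\<delta>\<^sub>0}" and x: "x \<in> D t" "P t x = 0"
  shows "norm (red_res \<delta> t (shifted (A t) (l t) x)) \<le> \<delta> * ((M\<^sub>0 + 1) * norm x)"
proof -
  note Rs = R_simps[OF t d]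
  have "P t (shifted (A t) (l t) x) = 0"
    using P_simps(5)[OF t x(1)] x(2) A_simps(5)[OF t x(1)]
    by (simp add: shifted_def blinfun.diff_right P_simps(3)[OF t])
  moreover have "R \<delta> t (shifted (A t) (l t) x) = (of_real \<delta> * z t) *\<^sub>C R \<delta> t x - x"
    using Rs(3)[OF x(1)] by (simp add: shifted_def blinfun.diff_right complex_linear_opD[OF Rs(4)] scaleC_add_left)
  ultimately have "red_res \<delta> t (shifted (A t) (l t) x) = \<delta> *\<^sub>R ((of_real \<delta> * z t) *\<^sub>C R \<delta> t x - x)"
    by (simp add: red_res_apply)
  also have "(of_real \<delta> * z t) *\<^sub>C R \<delta> t x = z t *\<^sub>C red_res \<delta> t x"
    using x(2) by (simp add: red_res_apply scaleR_scaleC scaleC_scaleC mult.commute)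
  also have "norm (\<delta> *\<^sub>R (z t *\<^sub>C red_res \<delta> t x - x)) = \<delta> * norm (z t *\<^sub>C red_res \<delta> t x - x)"
    using d by simp
  also have "\<dots> \<le> \<delta> * (M\<^sub>0 * norm x + norm x)"
  proof (intro mult_left_mono order_trans[OF norm_triangle_ineq4] add_mono order_refl)
    show "norm (z t *\<^sub>C red_res \<delta> t x) \<le> M\<^sub>0 * norm x"
      using order_trans[OF norm_blinfun mult_right_mono[OF red_res_norm[OF t d] norm_ge_zero], of x]
      by (simp add: norm_scaleC z_norm)
  qed (use d in auto)
  finally show ?thesis by (simp add: algebra_simps)
qed

text \<open>An ergodic argument: convergence at rate \<delta> holds on the image of
  \<open>A - \<lambda>\<close>, which by weak associatedness is dense in the range of
  \<open>1 - P\<close>, and the uniform bound \<open>M\<^sub>0\<close> extends it to the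
  closure.\<close>

lemma red_res_null:
  assumes t: "t \<in> {0..1}" and wa: "weakly_associated (D t) (A t) (l t) (P t)"
    and d: "d \<longlonglongrightarrow> 0" "\<And>n. d n \<in> {0<..\<delta>\<^sub>0}"
  shows "(\<lambda>n. red_res (d n) t y) \<longlonglongrightarrow> 0"
proof (rule LIMSEQ_I)
  fix r :: real assume r: "r > 0"
  have M0: "M\<^sub>0 \<ge> 0" by (rule order_trans[OF norm_ge_zero red_res_norm[OF t d(2)[of 0]]])
  have "y - P t y \<in> range (id_blinfun - P t)"
    by (rule image_eqI[of _ _ y]) (simp_all add: blinfun.diff_left)
  then have "y - P t y \<in> closure (shifted (A t) (l t) ` (id_blinfun - P t) ` D t)"
    using wa unfolding weakly_associated_def by blast
  moreover have "r / (2 * (M\<^sub>0 + 1)) > 0" using r M0 by simp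
  ultimately obtain u where u: "u \<in> D t"
      "norm (shifted (A t) (l t) ((id_blinfun - P t) u) - (y - P t y)) < r / (2 * (M\<^sub>0 + 1))"
    unfolding closure_approachable dist_norm by blast
  define x where "x = u - P t u"
  have x: "x \<in> D t" "P t x = 0"
    using u(1) by (auto simp: x_def blinfun.diff_right P_simps(1)[OF t] intro!: D_simps(3)[OF t] P_simps(6)[OF t])
  have close: "norm (shifted (A t) (l t) x - (y - P t y)) < r / (2 * (M\<^sub>0 + 1))"
    using u(2) by (simp add: x_def blinfun.diff_left)
  have "(\<lambda>n. d n * ((M\<^sub>0 + 1) * norm x)) \<longlonglongrightarrow> 0" using d(1) by (rule tendsto_mult_left_zero)
  then obtain n0 where n0: "\<And>n. n \<ge> n0 \<Longrightarrow> norm (d n * ((M\<^sub>0 + 1) * norm x) - 0) < r / 2"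
    using LIMSEQ_D[of _ 0 "r / 2"] half_gt_zero[OF r] by blast
  have "norm (red_res (d n) t y) < r" if "n \<ge> n0" for n
  proof -
    have idem: "red_res (d n) t (y - P t y) = red_res (d n) t y"
      by (simp add: red_res_apply blinfun.diff_right P_simps(1)[OF t])
    have "norm (red_res (d n) t y) \<le> norm (red_res (d n) t (shifted (A t) (l t) x)) +
        norm (red_res (d n) t (shifted (A t) (l t) x - (y - P t y)))"
      using norm_triangle_ineq4[of "red_res (d n) t (shifted (A t) (l t) x)"
          "red_res (d n) t (shifted (A t) (l t) x - (y - P t y))"]
      unfolding blinfun.diff_right[of _ _ "y - P t y"] idem by simp
    also have "\<dots> \<le> d n * ((M\<^sub>0 + 1) * norm x) + M\<^sub>0 * (r / (2 * (M\<^sub>0 + 1)))"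
    proof (rule add_mono)
      show "norm (red_res (d n) t (shifted (A t) (l t) x)) \<le> d n * ((M\<^sub>0 + 1) * norm x)"
        by (rule red_res_shifted[OF t d(2) x])
      show "norm (red_res (d n) t (shifted (A t) (l t) x - (y - P t y))) \<le> M\<^sub>0 * (r / (2 * (M\<^sub>0 + 1)))"
        by (rule order_trans[OF norm_blinfun mult_mono[OF red_res_norm[OF t d(2)] less_imp_le[OF close]]])
          (use M0 in auto)
    qed
    also have "\<dots> < r / 2 + r / 2"
    proof (rule add_less_le_mono)
      show "d n * ((M\<^sub>0 + 1) * norm x) < r / 2" using n0[OF that] by simp
      show "M\<^sub>0 * (r / (2 * (M\<^sub>0 + 1))) \<le> r / 2" using M0 r by (simp add: field_simps)
    qed
    finally show ?thesis by simp
  qed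
  then show "\<exists>n0. \<forall>n\<ge>n0. norm (red_res (d n) t y - 0) < r" by auto
qed

text \<open>Here the injectivity of \<open>A - \<lambda>\<close> on the complement takes the place
  of the dense range. It yields an injective bounded \<open>L\<close> with
  \<open>L o\<^sub>L red_res\<close> of order \<delta> in norm, and reflexivity removes
  \<open>L\<close>.\<close>

lemma red_res_null_dual:
  assumes refl: "reflexive_space TYPE('a)"
    and t: "t \<in> {0..1}" and wa: "weakly_associated (D t) (A t) (l t) (P t)"
    and d: "d \<longlonglongrightarrow> 0" "\<And>n. d n \<in> {0<..\<delta>\<^sub>0}"
    and E: "complex_linear_op E" "finite_rank E"
  shows "(\<lambda>n. E o\<^sub>L red_res (d n) t) \<longlonglongrightarrow> 0"
proof -
  define q where "q = of_real \<delta>\<^sub>0 * z t"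
  note Rs = R_simps[OF t delta0_in, folded q_def]
  \<comment> \<open>By the resolvent equation \<open>q R - 1 = (A - \<lambda>) R\<close>, so
    \<open>L\<close> is a bounded version of \<open>A - \<lambda>\<close> on the kernel of
    \<open>P\<close>. Adding \<open>P t\<close> makes it injective on the range as well.\<close>
  define L where "L = (((cmul q o\<^sub>L R \<delta>\<^sub>0 t) - id_blinfun) o\<^sub>L (id_blinfun - P t)) + P t"
  have L_apply: "L x = q *\<^sub>C R \<delta>\<^sub>0 t (x - P t x) - (x - P t x) + P t x" for x
    by (simp add: L_def blinfun.add_left blinfun.diff_left)
  have M0: "M\<^sub>0 \<ge> 0" by (rule order_trans[OF norm_ge_zero red_res_norm[OF t d(2)[of 0]]])
  show ?thesis
  proof (rule reflexive_dual_convergence[OF refl])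
    show "complex_linear_op L"
      unfolding L_def by (intro complex_linear_op_simps Rs P_simps(2)[OF t])
    show "x = 0" if Lx: "L x = 0" for x
    proof -
      have PR0: "P t (R \<delta>\<^sub>0 t (x - P t x)) = 0"
        by (simp add: Rs(5)[symmetric] blinfun.diff_right P_simps(1)[OF t])
      have "P t (L x) = P t x"
        unfolding L_apply by (simp add: blinfun.add_right blinfun.diff_right P_simps(1,3)[OF t] PR0[unfolded blinfun.diff_right])
      then have Px: "P t x = 0" using Lx by simp
      define y where "y = R \<delta>\<^sub>0 t x"
      have yD: "y \<in> D t" unfolding y_def by (rule Rs(1))
      have Py: "P t y = 0" using PR0 Px by (simp add: y_def)
      have "q *\<^sub>C R \<delta>\<^sub>0 t (x - P t x) - (x - P t x) + P t x = 0" using Lx by (simp only: L_apply)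
      then have qx: "q *\<^sub>C y = x" unfolding Px y_def by simp
      have "shifted (A t) (l t) y = q *\<^sub>C y - x"
        by (simp add: shifted_def y_def Rs(2) scaleC_add_left)
      then have "shifted (A t) (l t) y = 0" by (simp add: qx)
      moreover have "shifted (A t) (l t) 0 = 0" using A_simps(5)[OF t yD] by (simp add: shifted_def)
      moreover have "y \<in> (id_blinfun - P t) ` D t"
        by (rule image_eqI[OF _ yD]) (simp add: blinfun.diff_left Py)
      moreover have "0 \<in> (id_blinfun - P t) ` D t"
        by (rule image_eqI[OF _ D_simps(1)[OF t]]) simp
      moreover have "inj_on (shifted (A t) (l t)) ((id_blinfun - P t) ` D t)"
        using wa unfolding weakly_associated_def by blast
      ultimately have "y = 0" unfolding inj_on_def by metis
      then show "x = 0" using qx by simp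
    qed
    show "norm (red_res (d n) t) \<le> M\<^sub>0" for n by (rule red_res_norm[OF t d(2)])
    have bound: "norm (L o\<^sub>L red_res (d n) t) \<le> d n * (norm (R \<delta>\<^sub>0 t) * (M\<^sub>0 + norm (id_blinfun - P t)))" for n
    proof (rule norm_blinfun_bound)
      show "0 \<le> d n * (norm (R \<delta>\<^sub>0 t) * (M\<^sub>0 + norm (id_blinfun - P t)))"
        using d(2)[of n] M0 by simp
      fix x
      note Rn = R_simps[OF t d(2)[of n]]
      define x' where "x' = (id_blinfun - P t) x"
      define y where "y = red_res (d n) t x"
      have y: "y = d n *\<^sub>R R (d n) t x'" by (simp add: y_def red_res_apply x'_def blinfun.diff_left)
      have Px': "P t x' = 0" by (simp add: x'_def blinfun.diff_left blinfun.diff_right P_simps(1)[OF t])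
      have yD: "y \<in> D t" unfolding y by (rule D_simps(5)[OF t Rn(1)])
      have Py: "P t y = 0" unfolding y using Px' by (simp add: blinfun.scaleR_right Rn(5)[symmetric])
      \<comment> \<open>This displays the factor \<delta> in \<open>(A - \<lambda>) y\<close>; on
        \<open>y\<close> the operator \<open>L\<close> acts as
        \<open>R (A - \<lambda>)\<close>.\<close>
      have Ay: "A t y = l t *\<^sub>C y + d n *\<^sub>R (z t *\<^sub>C y - x')"
        unfolding y A_simps(4)[OF t Rn(1)] Rn(2)
        by (simp add: scaleC_add_left scaleC_add_right complex_vector.scale_right_diff_distrib
            scaleR_scaleC scaleC_scaleC mult_ac)
      have "L y = R \<delta>\<^sub>0 t (A t y) - l t *\<^sub>C R \<delta>\<^sub>0 t y"
        unfolding Rs(3)[OF yD] by (simp add: L_apply Py scaleC_add_left)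
      also have "\<dots> = d n *\<^sub>R R \<delta>\<^sub>0 t (z t *\<^sub>C y - x')"
        unfolding Ay by (simp add: blinfun.add_right blinfun.scaleR_right complex_linear_opD[OF Rs(4)])
      finally have "norm (L y) = d n * norm (R \<delta>\<^sub>0 t (z t *\<^sub>C y - x'))" using d(2)[of n] by simp
      also have "\<dots> \<le> d n * (norm (R \<delta>\<^sub>0 t) * (M\<^sub>0 * norm x + norm (id_blinfun - P t) * norm x))"
      proof (intro mult_left_mono order_trans[OF norm_blinfun] order_trans[OF norm_triangle_ineq4] add_mono)
        show "norm (z t *\<^sub>C y) \<le> M\<^sub>0 * norm x"
          unfolding y_def norm_scaleC z_norm
          using order_trans[OF norm_blinfun mult_right_mono[OF red_res_norm[OF t d(2)] norm_ge_zero]] by simp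
        show "norm x' \<le> norm (id_blinfun - P t) * norm x" unfolding x'_def by (rule norm_blinfun)
      qed (use d(2)[of n] in auto)
      finally show "norm ((L o\<^sub>L red_res (d n) t) x) \<le>
          d n * (norm (R \<delta>\<^sub>0 t) * (M\<^sub>0 + norm (id_blinfun - P t))) * norm x"
        by (simp add: y_def algebra_simps)
    qed
    have "(\<lambda>n. d n * (norm (R \<delta>\<^sub>0 t) * (M\<^sub>0 + norm (id_blinfun - P t)))) \<longlonglongrightarrow> 0"
      using d(1) by (rule tendsto_mult_left_zero)
    then show "(\<lambda>n. L o\<^sub>L red_res (d n) t) \<longlonglongrightarrow> 0"
      by (rule Lim_null_comparison[OF always_eventually[OF allI[OF bound]]])
  qed (rule E)+
qed

subsection \<open>Negligible off-diagonal perturbations\<close>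

lemma negl_zero:
  fixes E :: "real \<Rightarrow> 'a \<Rightarrow>\<^sub>L 'a"
  assumes "\<And>t y. t \<in> {0..1} \<Longrightarrow> S t y \<Longrightarrow> E t y = 0"
  shows "negl S E"
  unfolding negl_def
proof (intro allI impI always_eventually)
  fix \<eta> \<epsilon> :: real and v and t :: real
  assume "\<eta> > 0" and v: "Sol_in S \<epsilon> v" and t: "t \<in> {0..1}"
  have "integral {0..t} (\<lambda>s. U \<epsilon> t s (E s (v s))) = integral {0..t} (\<lambda>s. 0)"
    by (rule Henstock_Kurzweil_Integration.integral_cong) (use assms Sol_inD(3)[OF v] t in auto)
  then show "norm (integral {0..t} (\<lambda>s. U \<epsilon> t s (E s (v s)))) \<le> \<eta> * norm (v 0)"
    using \<open>\<eta> > 0\<close> by simp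
qed

definition dseq :: "nat \<Rightarrow> real" where
  "dseq n = \<delta>\<^sub>0 / Suc n"

lemma dseq: "dseq \<longlonglongrightarrow> 0" "dseq n \<in> {0<..\<delta>\<^sub>0}"
proof -
  have "(\<lambda>n. \<delta>\<^sub>0 * inverse (real (Suc n))) \<longlonglongrightarrow> \<delta>\<^sub>0 * 0"
    by (intro tendsto_mult tendsto_const LIMSEQ_inverse_real_of_nat)
  then show "dseq \<longlonglongrightarrow> 0" unfolding dseq_def[abs_def] by (simp add: divide_inverse)
  show "dseq n \<in> {0<..\<delta>\<^sub>0}" using delta0_pos by (simp add: dseq_def field_simps)
qed

text \<open>The commutator equation is solved up to the two errors \<open>\<delta> e R\<^sub>\<delta> E\<close>, which is small for
  small \<open>\<delta>\<close>, and \<open>R\<^sub>\<delta> E N\<close>, which is removed by induction on the nilpotency index.\<close>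

lemma negl_range_complement:
  fixes E :: "real \<Rightarrow> 'a \<Rightarrow>\<^sub>L 'a"
  assumes "sot_C1_on {0..1} E" "\<And>t. t \<in> {0..1} \<Longrightarrow> complex_linear_op (E t)"
    and "\<And>t x. t \<in> {0..1} \<Longrightarrow> P t (E t x) = 0"
    and "\<And>t x. t \<in> {0..1} \<Longrightarrow> E t ((blinfun_apply (N t) ^^ k) (P t x)) = 0"
  shows "negl in_range E"
  using assms
proof (induction k arbitrary: E)
  case 0
  show ?case by (rule negl_zero) (use 0(4) in \<open>metis funpow_0\<close>)
next
  case (Suc k)
  note E_C1 = Suc.prems(1) and E_lin = Suc.prems(2) and PE = Suc.prems(3)
  note E_cont = sot_C1_on_continuous[OF E_C1]
  define B where "B n t = (R (dseq n) t o\<^sub>L E t)" for n t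
  define zB where "zB n t = (cmul (of_real (dseq n) * z t) o\<^sub>L B n t)" for n t
  define BN where "BN n t = (B n t o\<^sub>L N t)" for n t
  have B_C1: "sot_C1_on {0..1} (B n)" for n
    unfolding B_def[abs_def] by (rule sot_C1_on_compose[OF R_C1[OF dseq(2)] E_C1])
  have zB_C1: "sot_C1_on {0..1} (zB n)" for n
    unfolding zB_def[abs_def] by (rule sot_C1_on_compose[OF delta_z_C1 B_C1])
  have BN_C1: "sot_C1_on {0..1} (BN n)" for n
    unfolding BN_def[abs_def] by (rule sot_C1_on_compose[OF B_C1 N_C1])
  have B_lin: "complex_linear_op (B n t)" if "t \<in> {0..1}" for n t
    unfolding B_def by (intro complex_linear_op_simps R_simps(4)[OF that dseq(2)] E_lin that)
  \<comment> \<open>The factor \<open>N\<close> now belongs to the family, so one power less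
    suffices to annihilate it and the induction hypothesis applies.\<close>
  have BN_negl: "negl in_range (BN n)" for n
  proof (rule Suc.IH[OF BN_C1])
    fix t :: real and x assume t: "t \<in> {0..1}"
    show "complex_linear_op (BN n t)"
      unfolding BN_def by (intro complex_linear_op_simps B_lin N_simps(3)[OF t] t)
    show "P t (BN n t x) = 0"
      using R_simps(5)[OF t dseq(2), of n] PE[OF t] by (simp add: BN_def B_def flip: R_simps(5)[OF t dseq(2)])
    show "BN n t ((blinfun_apply (N t) ^^ k) (P t x)) = 0"
      using Suc.prems(4)[OF t, of x] by (simp add: BN_def B_def)
  qed
  have G_C1: "sot_C1_on {0..1} (\<lambda>t. (E t - zB n t) + BN n t)" for n
    by (intro sot_C1_on_add sot_C1_on_diff E_C1 zB_C1 BN_C1)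
  have G_negl: "negl in_range (\<lambda>t. (E t - zB n t) + BN n t)" for n
  \<comment> \<open>On the range of \<open>P\<close> one has
    \<open>A B - B A = zB - E - B N\<close>, so the required perturbation is the commutator of
    \<open>A\<close> with \<open>- B\<close>.\<close>
  proof (rule negl_commutator[OF sot_C1_on_scaleR[OF B_C1, of "- 1" n] sot_C1_on_continuous[OF G_C1]])
    fix \<epsilon> v and t :: real
    assume v: "Sol_in in_range \<epsilon> v" and t: "t \<in> {0..1}"
    note Rs = R_simps[OF t dseq(2)[of n]]
    have RD: "B n t (v t) \<in> D t" by (simp add: B_def Rs(1))
    then show "((- 1) *\<^sub>R B n t) (v t) \<in> D t"
      unfolding blinfun.scaleR_left by (rule D_simps(5)[OF t])
    have Av: "A t (v t) = N t (v t) + l t *\<^sub>C v t" using N_simps(5)[OF t, of "v t"] Sol_inD(3)[OF v t] by simp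
    have AB: "A t (B n t (v t)) = (l t + of_real (dseq n) * z t) *\<^sub>C B n t (v t) - E t (v t)"
      by (simp add: B_def Rs(2))
    show "A t (((- 1) *\<^sub>R B n t) (v t)) = ((- 1) *\<^sub>R B n t) (A t (v t)) + ((E t - zB n t) + BN n t) (v t)"
      unfolding blinfun.scaleR_left A_simps(4)[OF t RD] AB Av
      by (simp add: blinfun.bilinear_simps BN_def zB_def complex_linear_opD[OF B_lin[OF t]] scaleC_add_left)
  qed
  have "negl in_range (\<lambda>t. ((E t - zB n t) + BN n t) - BN n t)" for n
    by (rule negl_diff[OF sot_C1_on_continuous[OF G_C1] G_negl sot_C1_on_continuous[OF BN_C1] BN_negl])
  then have F_negl: "negl in_range (\<lambda>t. E t - zB n t)" for n by simp
  obtain Bs :: "'a set" and w :: "'a \<Rightarrow> real \<Rightarrow> 'a" and C :: real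
    where Bs: "finite Bs" "C \<ge> 0" "\<And>b. continuous_on {0..1} (w b)"
    and bound: "\<And>\<epsilon> v t T. Sol_in in_range \<epsilon> v \<Longrightarrow> t \<in> {0..1} \<Longrightarrow> complex_linear_op T \<Longrightarrow>
      norm (T (v t)) \<le> (C * (\<Sum>b\<in>Bs. norm (T (w b t)))) * norm (v 0)"
    by (rule Sol_expansion) (rule that)
  \<comment> \<open>Testing on the curves \<open>w b\<close> only, the strong convergence of
    \<open>red_res\<close> makes this tend to zero. The projection \<open>1 - P\<close> inside
    \<open>red_res\<close> is invisible because \<open>P E = 0\<close>.\<close>
  define g where "g n t = C * (\<Sum>b\<in>Bs. norm (zB n t (w b t)))" for n t
  have zB_eq: "norm (zB n t x) = norm (red_res (dseq n) t (E t x))" if t: "t \<in> {0..1}" for n t x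
    using PE[OF t] dseq(2)[of n] by (simp add: zB_def B_def red_res_apply norm_scaleC norm_mult z_norm)
  have Ew: "continuous_on {0..1} (\<lambda>t. E t (w b t))" for b
    by (rule continuous_on_sot_apply_interval[OF E_cont Bs(3)])
  have zBw: "continuous_on {0..1} (\<lambda>t. zB n t (w b t))" for n b
    by (rule continuous_on_sot_apply_interval[OF sot_C1_on_continuous[OF zB_C1] Bs(3)])
  have "\<exists>L. \<forall>t\<in>{0..1}. norm (E t (w b t)) \<le> L" for b
    using compact_imp_bounded[OF compact_continuous_image[OF Ew compact_Icc]] by (simp add: bounded_iff)
  then obtain L where L: "\<And>b t. t \<in> {0..1} \<Longrightarrow> norm (E t (w b t)) \<le> L b" by metis
  have M0: "M\<^sub>0 \<ge> 0" by (rule order_trans[OF norm_ge_zero red_res_norm[OF _ dseq(2), of 0 0]]) simp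
  have g_bound: "\<bar>g n t\<bar> \<le> C * (\<Sum>b\<in>Bs. M\<^sub>0 * L b)" if t: "t \<in> {0..1}" for n t
  proof -
    have "norm (zB n t (w b t)) \<le> M\<^sub>0 * L b" for b
      unfolding zB_eq[OF t]
      by (rule order_trans[OF norm_blinfun mult_mono[OF red_res_norm[OF t dseq(2)] L[OF t]]]) (use M0 in auto)
    then have "g n t \<le> C * (\<Sum>b\<in>Bs. M\<^sub>0 * L b)"
      unfolding g_def using Bs(2) by (intro mult_left_mono sum_mono)
    moreover have "g n t \<ge> 0" unfolding g_def using Bs(2) by (intro mult_nonneg_nonneg sum_nonneg) auto
    ultimately show ?thesis by simp
  qed
  have g_meas: "g n \<in> borel_measurable (lebesgue_on {0..1})" for n
    unfolding g_def[abs_def]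
    by (intro continuous_imp_borel_measurable_lebesgue_on continuous_on_mult continuous_on_const
        continuous_on_sum continuous_on_norm zBw)
  have g_lim: "AE t in lebesgue. t \<in> {0..1} \<longrightarrow> (\<lambda>n. g n t) \<longlonglongrightarrow> 0"
    using P_assoc
  proof eventually_elim
    case (elim t)
    show ?case
    proof
      assume t: "t \<in> {0..1}"
      have "(\<lambda>n. norm (zB n t (w b t))) \<longlonglongrightarrow> 0" for b
        unfolding zB_eq[OF t] by (rule tendsto_norm_zero[OF red_res_null[OF t _ dseq]]) (use elim t in blast)
      then show "(\<lambda>n. g n t) \<longlonglongrightarrow> 0"
        unfolding g_def by (intro tendsto_mult_right_zero tendsto_null_sum)
    qed
  qed
  show ?case
  proof (rule negl_approx[where F = "\<lambda>n t. E t - zB n t" and g = g])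
    show "continuous_on {0..1} (\<lambda>t. (E t - zB n t) x)" for n x
      by (rule sot_C1_on_continuous[OF sot_C1_on_diff[OF E_C1 zB_C1]])
    show "norm ((E t - (E t - zB n t)) (v t)) \<le> g n t * norm (v 0)"
      if "Sol_in in_range \<epsilon> v" "t \<in> {0..1}" for n \<epsilon> v t
    proof -
      have "complex_linear_op (zB n t)"
        unfolding zB_def by (intro complex_linear_op_simps B_lin that)
      from bound[OF that this] show ?thesis by (simp add: g_def)
    qed
  qed (rule E_cont F_negl g_meas g_bound g_lim; assumption)+
qed

text \<open>The order of factors is reversed: the resolvent stands to the right of \<open>E\<close>
  and the powers of \<open>N\<close> to its left. With \<open>B = E R\<close> one gets
  \<open>A B - B A = E - zB + N B\<close> on solutions, now without a change of sign. No finite set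
  of curves describes these solutions, so \<open>zB\<close> must be small in operator norm.\<close>

lemma negl_kernel:
  fixes E :: "real \<Rightarrow> 'a \<Rightarrow>\<^sub>L 'a"
  assumes refl: "reflexive_space TYPE('a)"
    and "sot_C1_on {0..1} E" "\<And>t. t \<in> {0..1} \<Longrightarrow> complex_linear_op (E t)"
    and "\<And>t x. t \<in> {0..1} \<Longrightarrow> P t (E t x) = E t x"
    and "\<And>t x. t \<in> {0..1} \<Longrightarrow> E t (P t x) = 0"
    and "\<And>t x. t \<in> {0..1} \<Longrightarrow> (blinfun_apply (N t) ^^ k) (E t x) = 0"
  shows "negl in_kernel E"
  using assms(2-)
proof (induction k arbitrary: E)
  case 0
  show ?case by (rule negl_zero) (use 0(5) in \<open>metis funpow_0\<close>)
next
  case (Suc k)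
  note E_C1 = Suc.prems(1) and E_lin = Suc.prems(2) and PE = Suc.prems(3) and EP = Suc.prems(4)
  note E_cont = sot_C1_on_continuous[OF E_C1]
  define B where "B n t = (E t o\<^sub>L R (dseq n) t)" for n t
  define zB where "zB n t = (cmul (of_real (dseq n) * z t) o\<^sub>L B n t)" for n t
  define NB where "NB n t = (N t o\<^sub>L B n t)" for n t
  have B_C1: "sot_C1_on {0..1} (B n)" for n
    unfolding B_def[abs_def] by (rule sot_C1_on_compose[OF E_C1 R_C1[OF dseq(2)]])
  have zB_C1: "sot_C1_on {0..1} (zB n)" for n
    unfolding zB_def[abs_def] by (rule sot_C1_on_compose[OF delta_z_C1 B_C1])
  have NB_C1: "sot_C1_on {0..1} (NB n)" for n
    unfolding NB_def[abs_def] by (rule sot_C1_on_compose[OF N_C1 B_C1])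
  have B_lin: "complex_linear_op (B n t)" if "t \<in> {0..1}" for n t
    unfolding B_def by (intro complex_linear_op_simps R_simps(4)[OF that dseq(2)] E_lin that)
  have NB_negl: "negl in_kernel (NB n)" for n
  proof (rule Suc.IH[OF NB_C1])
    fix t :: real and x assume t: "t \<in> {0..1}"
    show "complex_linear_op (NB n t)"
      unfolding NB_def by (intro complex_linear_op_simps B_lin N_simps(3)[OF t] t)
    show "P t (NB n t x) = NB n t x" by (simp add: NB_def N_simps(2)[OF t])
    show "NB n t (P t x) = 0" by (simp add: NB_def B_def R_simps(5)[OF t dseq(2)] EP[OF t])
    show "(blinfun_apply (N t) ^^ k) (NB n t x) = 0"
      using Suc.prems(5)[OF t, of "R (dseq n) t x"] by (simp add: NB_def B_def funpow_swap1)
  qed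
  have G_C1: "sot_C1_on {0..1} (\<lambda>t. (E t - zB n t) + NB n t)" for n
    by (intro sot_C1_on_add sot_C1_on_diff E_C1 zB_C1 NB_C1)
  have G_negl: "negl in_kernel (\<lambda>t. (E t - zB n t) + NB n t)" for n
  proof (rule negl_commutator[OF B_C1[of n] sot_C1_on_continuous[OF G_C1]])
    fix \<epsilon> v and t :: real
    assume v: "Sol_in in_kernel \<epsilon> v" and t: "t \<in> {0..1}"
    note Rs = R_simps[OF t dseq(2)[of n]]
    have PB: "P t (B n t x) = B n t x" for x by (simp add: B_def PE[OF t])
    show "B n t (v t) \<in> D t" using P_simps(6)[OF t, of "B n t (v t)"] PB by simp
    have AB: "A t (B n t (v t)) = N t (B n t (v t)) + l t *\<^sub>C B n t (v t)"
      using N_simps(5)[OF t, of "B n t (v t)"] by (simp add: PB)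
    have BA: "B n t (A t (v t)) = (l t + of_real (dseq n) * z t) *\<^sub>C B n t (v t) - E t (v t)"
      by (simp add: B_def Rs(3)[OF SolD(1)[OF Sol_inD(2)[OF v] t]] blinfun.diff_right complex_linear_opD[OF E_lin[OF t]])
    show "A t (B n t (v t)) = B n t (A t (v t)) + ((E t - zB n t) + NB n t) (v t)"
      unfolding AB BA by (simp add: blinfun.bilinear_simps NB_def zB_def scaleC_add_left)
  qed
  have "negl in_kernel (\<lambda>t. ((E t - zB n t) + NB n t) - NB n t)" for n
    by (rule negl_diff[OF sot_C1_on_continuous[OF G_C1] G_negl sot_C1_on_continuous[OF NB_C1] NB_negl])
  then have F_negl: "negl in_kernel (\<lambda>t. E t - zB n t)" for n by simp
  obtain C where C: "C \<ge> 0" "\<And>\<epsilon> v t. \<epsilon> > 0 \<Longrightarrow> Sol \<epsilon> v \<Longrightarrow> t \<in> {0..1} \<Longrightarrow> norm (v t) \<le> C * norm (v 0)"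
    using Sol_bound by blast
  define g where "g n t = norm (zB n t) * C" for n t
  have zB_le: "norm (zB n t) \<le> norm (E t o\<^sub>L red_res (dseq n) t)" if t: "t \<in> {0..1}" for n t
  proof (rule norm_blinfun_bound)
    fix x
    have ER: "E t (R (dseq n) t (x - P t x)) = E t (R (dseq n) t x)"
      by (simp add: blinfun.diff_right R_simps(5)[OF t dseq(2)] EP[OF t])
    have "norm (zB n t x) = norm ((E t o\<^sub>L red_res (dseq n) t) x)"
      using dseq(2)[of n]
      by (simp add: zB_def B_def red_res_apply blinfun.scaleR_right ER norm_scaleC norm_mult z_norm)
    then show "norm (zB n t x) \<le> norm (E t o\<^sub>L red_res (dseq n) t) * norm x"
      using norm_blinfun by metis
  qed simp
  obtain KE where KE: "KE > 0" "\<And>t. t \<in> {0..1} \<Longrightarrow> norm (E t) \<le> KE" using sot_bounded[OF E_cont] by blast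
  have g_bound: "\<bar>g n t\<bar> \<le> KE * M\<^sub>0 * C" if t: "t \<in> {0..1}" for n t
  proof -
    have "norm (zB n t) \<le> KE * M\<^sub>0"
      by (rule order_trans[OF zB_le[OF t] order_trans[OF norm_blinfun_compose
            mult_mono[OF KE(2)[OF t] red_res_norm[OF t dseq(2)]]]]) (use KE in auto)
    then show ?thesis unfolding g_def using C(1) by (simp add: mult_right_mono)
  qed
  \<comment> \<open>An operator norm of a family that is only strongly continuous, hence measurable
    through lower semicontinuity.\<close>
  have g_meas: "g n \<in> borel_measurable (lebesgue_on {0..1})" for n
    unfolding g_def[abs_def]
    by (intro borel_measurable_times borel_measurable_norm_sot borel_measurable_const
        sot_C1_on_continuous[OF zB_C1])
  have g_lim: "AE t in lebesgue. t \<in> {0..1} \<longrightarrow> (\<lambda>n. g n t) \<longlonglongrightarrow> 0"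
    using P_assoc
  proof eventually_elim
    case (elim t)
    show ?case
    proof
      assume t: "t \<in> {0..1}"
      have "(\<lambda>n. E t o\<^sub>L red_res (dseq n) t) \<longlonglongrightarrow> 0"
        using elim t
        by (intro red_res_null_dual[OF refl t _ dseq E_lin[OF t] finite_rank_P_compose[OF t PE[OF t]]]) blast
      then have "(\<lambda>n. norm (E t o\<^sub>L red_res (dseq n) t)) \<longlonglongrightarrow> 0" by (rule tendsto_norm_zero)
      then have "(\<lambda>n. norm (zB n t)) \<longlonglongrightarrow> 0"
        by (rule Lim_null_comparison[rotated]) (simp add: zB_le[OF t])
      then show "(\<lambda>n. g n t) \<longlonglongrightarrow> 0"
        unfolding g_def by (rule tendsto_mult_left_zero)
    qed
  qed
  show ?case
  proof (rule negl_approx[where F = "\<lambda>n t. E t - zB n t" and g = g])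
    show "continuous_on {0..1} (\<lambda>t. (E t - zB n t) x)" for n x
      by (rule sot_C1_on_continuous[OF sot_C1_on_diff[OF E_C1 zB_C1]])
    show "norm ((E t - (E t - zB n t)) (v t)) \<le> g n t * norm (v 0)"
      if v: "Sol_in in_kernel \<epsilon> v" and t: "t \<in> {0..1}" for n \<epsilon> v t
      using order_trans[OF norm_blinfun[of "zB n t" "v t"] mult_left_mono[OF C(2)[OF Sol_inD(1,2)[OF v] t] norm_ge_zero]]
      by (simp add: g_def mult.assoc)
  qed (rule E_cont F_negl g_meas g_bound g_lim; assumption)+
qed

section \<open>Difference quotients in place of \<open>P'\<close>\<close>

definition Dq :: "nat \<Rightarrow> real \<Rightarrow> 'a \<Rightarrow>\<^sub>L 'a" where
  "Dq n t = real (Suc n) *\<^sub>R (P ((1 - 1 / real (Suc n)) * t + 1 / real (Suc n)) - P ((1 - 1 / real (Suc n)) * t))"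

lemma step_size: "1 / real (Suc n) \<in> {0<..1}" "(\<lambda>n. 1 / real (Suc n)) \<longlonglongrightarrow> 0"
proof -
  show "1 / real (Suc n) \<in> {0<..1}" by (simp add: field_simps)
  show "(\<lambda>n. 1 / real (Suc n)) \<longlonglongrightarrow> 0"
    using LIMSEQ_inverse_real_of_nat by (simp only: inverse_eq_divide)
qed

lemma Dq_C1: "sot_C1_on {0..1} (Dq n)"
proof -
  have h: "1 / real (Suc n) \<ge> 0" "1 - 1 / real (Suc n) \<ge> 0" "1 - 1 / real (Suc n) + 1 / real (Suc n) \<le> 1"
    using step_size(1)[of n] by auto
  have "sot_C1_on {0..1} (\<lambda>t. P ((1 - 1 / real (Suc n)) * t + 1 / real (Suc n)))"
    by (rule sot_C1_on_affine[OF P_C1 h(2,1,3)])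
  moreover have "sot_C1_on {0..1} (\<lambda>t. P ((1 - 1 / real (Suc n)) * t))"
    using sot_C1_on_affine[OF P_C1 h(2), of 0] h by simp
  ultimately show ?thesis
    unfolding Dq_def[abs_def] by (intro sot_C1_on_scaleR sot_C1_on_diff)
qed

lemma Dq_linear:
  assumes "t \<in> {0..1}"
  shows "complex_linear_op (Dq n t)"
proof -
  have h: "1 / real (Suc n) \<in> {0..1}" using step_size(1)[of n] by simp
  show ?thesis
    unfolding Dq_def
    by (intro complex_linear_op_simps P_simps(2) straddling_points[OF h assms])
qed

lemma Dq_apply:
  "Dq n t x = (1 / (1 / real (Suc n))) *\<^sub>R (P ((1 - 1 / real (Suc n)) * t + 1 / real (Suc n)) x - P ((1 - 1 / real (Suc n)) * t) x)"
  by (simp add: Dq_def blinfun.bilinear_simps)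

lemma Dq_bounded:
  obtains K where "K > 0" "\<And>t. t \<in> {0..1} \<Longrightarrow> norm (P t) \<le> K" "\<And>t. t \<in> {0..1} \<Longrightarrow> norm (P' t) \<le> K"
    "\<And>n t. t \<in> {0..1} \<Longrightarrow> norm (Dq n t) \<le> K"
proof -
  obtain K1 where K1: "K1 > 0" "\<And>t. t \<in> {0..1} \<Longrightarrow> norm (P t) \<le> K1" using sot_bounded[OF P_continuous] by blast
  obtain K2 where K2: "K2 > 0" "\<And>t. t \<in> {0..1} \<Longrightarrow> norm (P' t) \<le> K2" using sot_bounded[OF P'_cont] by blast
  have "norm (Dq n t x) \<le> K2 * norm x" if t: "t \<in> {0..1}" for n t x
    unfolding Dq_apply
    by (rule straddled_quotient_bound[OF P_deriv _ t step_size(1)])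
      (auto intro!: order_trans[OF norm_blinfun] mult_right_mono K2)
  then have "norm (Dq n t) \<le> K2" if "t \<in> {0..1}" for n t
    using K2(1) that by (intro norm_blinfun_bound) auto
  then show thesis
    using K1 K2 by (intro that[of "max K1 K2"]) (auto simp: le_max_iff_disj)
qed

text \<open>Smooth approximations of \<open>P' P\<close> converge strongly, and testing them on the
  curves of \<open>Sol_expansion\<close> makes the error uniform over solutions.\<close>

lemma negl_P'_range: "negl in_range (\<lambda>t. P' t o\<^sub>L P t)"
proof -
  \<comment> \<open>The outer projections restore the off-diagonal form, which a difference quotient
    has only in the limit.\<close>
  define F where "F n t = ((id_blinfun - P t) o\<^sub>L (Dq n t o\<^sub>L P t))" for n t
  define E where "E t = (P' t o\<^sub>L P t)" for t
  have F_apply: "F n t x = Dq n t (P t x) - P t (Dq n t (P t x))" for n t x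
    by (simp add: F_def blinfun.diff_left)
  have F_C1: "sot_C1_on {0..1} (F n)" for n
    unfolding F_def[abs_def]
    by (intro sot_C1_on_compose sot_C1_on_diff sot_C1_on_const P_C1 Dq_C1)
  have F_lin: "complex_linear_op (F n t)" if "t \<in> {0..1}" for n t
    unfolding F_def by (intro complex_linear_op_simps P_simps(2) Dq_linear that)
  have F_negl: "negl in_range (F n)" for n
  proof (rule negl_range_complement[OF F_C1 F_lin, where k = m\<^sub>0])
    fix t :: real and x assume t: "t \<in> {0..1}"
    show "P t (F n t x) = 0" by (simp add: F_apply blinfun.diff_right P_simps(1)[OF t])
    show "F n t ((blinfun_apply (N t) ^^ m\<^sub>0) (P t x)) = 0" by (simp add: N_simps(4)[OF t])
  qed
  have E_cont: "continuous_on {0..1} (\<lambda>t. E t x)" for x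
    unfolding E_def blinfun_apply_blinfun_compose by (rule continuous_on_sot_apply_interval[OF P'_cont P_continuous])
  have E_lin: "complex_linear_op (E t)" if "t \<in> {0..1}" for t
    unfolding E_def by (intro complex_linear_op_simps P'_linear P_simps(2) that)
  obtain B :: "'a set" and w :: "'a \<Rightarrow> real \<Rightarrow> 'a" and C :: real
    where B: "finite B" "C \<ge> 0" "\<And>b. continuous_on {0..1} (w b)"
    and bound: "\<And>\<epsilon> v t T. Sol_in in_range \<epsilon> v \<Longrightarrow> t \<in> {0..1} \<Longrightarrow> complex_linear_op T \<Longrightarrow>
      norm (T (v t)) \<le> (C * (\<Sum>b\<in>B. norm (T (w b t)))) * norm (v 0)"
    by (rule Sol_expansion) (rule that)
  define g where "g n t = C * (\<Sum>b\<in>B. norm ((E t - F n t) (w b t)))" for n t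
  obtain K where K: "K > 0" "\<And>t. t \<in> {0..1} \<Longrightarrow> norm (P t) \<le> K" "\<And>t. t \<in> {0..1} \<Longrightarrow> norm (P' t) \<le> K"
    "\<And>n t. t \<in> {0..1} \<Longrightarrow> norm (Dq n t) \<le> K"
    by (rule Dq_bounded) (rule that)
  define K' where "K' = K * K + (1 + K) * (K * K)"
  have K': "K' \<ge> 0" using K(1) by (simp add: K'_def)
  have EF_bound: "norm (E t - F n t) \<le> K'" if t: "t \<in> {0..1}" for n t
  proof -
    have Q: "norm (id_blinfun - P t) \<le> 1 + K"
      by (rule order_trans[OF norm_triangle_ineq4 add_mono[OF norm_blinfun_id_le K(2)[OF t]]])
    have "norm (Dq n t o\<^sub>L P t) \<le> K * K" "norm (E t) \<le> K * K"
      unfolding E_def using K(1)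
      by (intro order_trans[OF norm_blinfun_compose] mult_mono K t; simp)+
    then show ?thesis
      unfolding K'_def F_def using K(1)
      by (intro order_trans[OF norm_triangle_ineq4 add_mono[OF _ order_trans[OF norm_blinfun_compose mult_mono[OF Q]]]]) auto
  qed
  have "\<exists>L. \<forall>t\<in>{0..1}. norm (w b t) \<le> L" for b
    using compact_imp_bounded[OF compact_continuous_image[OF B(3) compact_Icc]] by (simp add: bounded_iff)
  then obtain L where L: "\<And>b t. t \<in> {0..1} \<Longrightarrow> norm (w b t) \<le> L b" by metis
  have EF_cont: "continuous_on {0..1} (\<lambda>t. (E t - F n t) x)" for n x
    unfolding blinfun.diff_left by (intro continuous_on_diff E_cont sot_C1_on_continuous[OF F_C1])
  have g_bound: "\<bar>g n t\<bar> \<le> C * (\<Sum>b\<in>B. K' * L b)" if t: "t \<in> {0..1}" for n t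
  proof -
    have "norm ((E t - F n t) (w b t)) \<le> K' * L b" for b
      by (rule order_trans[OF norm_blinfun mult_mono[OF EF_bound[OF t] L[OF t] K' norm_ge_zero]])
    then have "g n t \<le> C * (\<Sum>b\<in>B. K' * L b)"
      unfolding g_def using B(2) by (intro mult_left_mono sum_mono)
    moreover have "g n t \<ge> 0" unfolding g_def using B(2) by (intro mult_nonneg_nonneg sum_nonneg) auto
    ultimately show ?thesis by simp
  qed
  have g_meas: "g n \<in> borel_measurable (lebesgue_on {0..1})" for n
    unfolding g_def[abs_def]
    by (intro continuous_imp_borel_measurable_lebesgue_on continuous_on_mult continuous_on_const
        continuous_on_sum continuous_on_norm continuous_on_sot_apply_interval[OF EF_cont B(3)])
  have g_lim: "AE t in lebesgue. t \<in> {0..1} \<longrightarrow> (\<lambda>n. g n t) \<longlonglongrightarrow> 0"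
  proof (intro AE_I2 impI)
    fix t :: real assume t: "t \<in> {0..1}"
    have "(\<lambda>n. (E t - F n t) x) \<longlonglongrightarrow> 0" for x
    proof -
      have q: "(\<lambda>n. Dq n t (P t x)) \<longlonglongrightarrow> P' t (P t x)"
        unfolding Dq_apply by (rule straddled_quotient_tendsto[OF P_deriv[OF t] t step_size(2,1)])
      then have "(\<lambda>n. P' t (P t x) - (Dq n t (P t x) - P t (Dq n t (P t x)))) \<longlonglongrightarrow>
          P' t (P t x) - (P' t (P t x) - P t (P' t (P t x)))"
        by (intro tendsto_diff tendsto_const blinfun.tendsto[OF tendsto_const q])
      then show ?thesis by (simp add: E_def F_apply blinfun.diff_left P_P'_P[OF t])
    qed
    then have "(\<lambda>n. norm ((E t - F n t) (w b t))) \<longlonglongrightarrow> 0" for b by (rule tendsto_norm_zero)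
    then show "(\<lambda>n. g n t) \<longlonglongrightarrow> 0"
      unfolding g_def by (intro tendsto_mult_right_zero tendsto_null_sum)
  qed
  have "negl in_range E"
  proof (rule negl_approx[where F = F and g = g])
    show "norm ((E t - F n t) (v t)) \<le> g n t * norm (v 0)"
      if "Sol_in in_range \<epsilon> v" "t \<in> {0..1}" for n \<epsilon> v t
      unfolding g_def
      by (rule bound[OF that]) (intro complex_linear_op_simps E_lin F_lin that)
  qed (rule E_cont F_negl sot_C1_on_continuous[OF F_C1] g_meas g_bound g_lim; assumption)+
  then show ?thesis unfolding E_def .
qed

text \<open>Norm differentiability makes the difference quotients converge to \<open>P'\<close> in
  operator norm, as needed for solutions that are not confined to finitely many directions.\<close>

lemma negl_P'_kernel:
  assumes refl: "reflexive_space TYPE('a)"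
    and P_norm_deriv: "\<And>t. t \<in> {0..1} \<Longrightarrow> (P has_vector_derivative P' t) (at t within {0..1})"
  shows "negl in_kernel (\<lambda>t. P t o\<^sub>L P' t)"
proof -
  define F where "F n t = (P t o\<^sub>L (Dq n t o\<^sub>L (id_blinfun - P t)))" for n t
  define E where "E t = (P t o\<^sub>L P' t)" for t
  have F_apply: "F n t x = P t (Dq n t (x - P t x))" for n t x
    by (simp add: F_def blinfun.diff_left)
  have F_C1: "sot_C1_on {0..1} (F n)" for n
    unfolding F_def[abs_def]
    by (intro sot_C1_on_compose sot_C1_on_diff sot_C1_on_const P_C1 Dq_C1)
  have F_lin: "complex_linear_op (F n t)" if "t \<in> {0..1}" for n t
    unfolding F_def by (intro complex_linear_op_simps P_simps(2) Dq_linear that)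
  have F_negl: "negl in_kernel (F n)" for n
  proof (rule negl_kernel[OF refl F_C1 F_lin, where k = m\<^sub>0])
    fix t :: real and x assume t: "t \<in> {0..1}"
    show "P t (F n t x) = F n t x" by (simp add: F_apply P_simps(1)[OF t])
    show "F n t (P t x) = 0" by (simp add: F_apply P_simps(1)[OF t])
    show "(blinfun_apply (N t) ^^ m\<^sub>0) (F n t x) = 0" by (simp add: F_apply N_simps(4)[OF t])
  qed
  have E_cont: "continuous_on {0..1} (\<lambda>t. E t x)" for x
    unfolding E_def blinfun_apply_blinfun_compose by (rule continuous_on_sot_apply_interval[OF P_continuous P'_cont])
  obtain C where C: "C \<ge> 0" "\<And>\<epsilon> v t. \<epsilon> > 0 \<Longrightarrow> Sol \<epsilon> v \<Longrightarrow> t \<in> {0..1} \<Longrightarrow> norm (v t) \<le> C * norm (v 0)"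
    using Sol_bound by blast
  obtain K where K: "K > 0" "\<And>t. t \<in> {0..1} \<Longrightarrow> norm (P t) \<le> K" "\<And>t. t \<in> {0..1} \<Longrightarrow> norm (P' t) \<le> K"
    "\<And>n t. t \<in> {0..1} \<Longrightarrow> norm (Dq n t) \<le> K"
    by (rule Dq_bounded) (rule that)
  have Dq_eq: "Dq n t = (1 / (1 / real (Suc n))) *\<^sub>R (P ((1 - 1 / real (Suc n)) * t + 1 / real (Suc n)) - P ((1 - 1 / real (Suc n)) * t))" for n t
    by (simp add: Dq_def)
  define q where "q n t = P' t - Dq n t" for n t
  have q_cont: "continuous_on {0..1} (\<lambda>t. q n t x)" for n x
    unfolding q_def blinfun.diff_left by (intro continuous_on_diff P'_cont sot_C1_on_continuous[OF Dq_C1])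
  define g where "g n t = K * (norm (q n t) * C)" for n t
  have g_bound: "\<bar>g n t\<bar> \<le> K * ((K + K) * C)" if t: "t \<in> {0..1}" for n t
  proof -
    have "norm (q n t) \<le> K + K"
      unfolding q_def by (rule order_trans[OF norm_triangle_ineq4 add_mono[OF K(3)[OF t] K(4)[OF t]]])
    then have "g n t \<le> K * ((K + K) * C)"
      unfolding g_def using C(1) K(1) by (intro mult_left_mono mult_right_mono) auto
    moreover have "g n t \<ge> 0" unfolding g_def using C(1) K(1) by simp
    ultimately show ?thesis by simp
  qed
  have g_meas: "g n \<in> borel_measurable (lebesgue_on {0..1})" for n
    unfolding g_def[abs_def]
    by (intro borel_measurable_times borel_measurable_const borel_measurable_norm_sot q_cont)
  have g_lim: "AE t in lebesgue. t \<in> {0..1} \<longrightarrow> (\<lambda>n. g n t) \<longlonglongrightarrow> 0"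
  proof (intro AE_I2 impI)
    fix t :: real assume t: "t \<in> {0..1}"
    have "(\<lambda>n. Dq n t) \<longlonglongrightarrow> P' t"
      unfolding Dq_eq by (rule straddled_quotient_tendsto[OF P_norm_deriv[OF t] t step_size(2,1)])
    then have "(\<lambda>n. q n t) \<longlonglongrightarrow> P' t - P' t"
      unfolding q_def by (intro tendsto_diff tendsto_const)
    then have "(\<lambda>n. norm (q n t)) \<longlonglongrightarrow> 0" by (intro tendsto_norm_zero) simp
    then show "(\<lambda>n. g n t) \<longlonglongrightarrow> 0"
      unfolding g_def by (intro tendsto_mult_right_zero tendsto_mult_left_zero)
  qed
  have "negl in_kernel E"
  proof (rule negl_approx[where F = F and g = g])
    show "norm ((E t - F n t) (v t)) \<le> g n t * norm (v 0)"
      if v: "Sol_in in_kernel \<epsilon> v" and t: "t \<in> {0..1}" for n \<epsilon> v t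
    proof -
      have "(E t - F n t) (v t) = P t (q n t (v t))"
        using Sol_inD(3)[OF v t] by (simp add: E_def F_apply q_def blinfun.bilinear_simps)
      also have "norm \<dots> \<le> K * (norm (q n t) * (C * norm (v 0)))"
        by (rule order_trans[OF norm_blinfun mult_mono[OF K(2)[OF t]
              order_trans[OF norm_blinfun mult_left_mono[OF C(2)[OF Sol_inD(1,2)[OF v] t] norm_ge_zero]]]])
          (use K in auto)
      finally show ?thesis by (simp add: g_def mult.assoc)
    qed
  qed (rule E_cont F_negl sot_C1_on_continuous[OF F_C1] g_meas g_bound g_lim; assumption)+
  then show ?thesis unfolding E_def .
qed

lemma P'_P_continuous: "continuous_on {0..1} (\<lambda>t. (P' t o\<^sub>L P t) x)" "continuous_on {0..1} (\<lambda>t. (P t o\<^sub>L P' t) x)"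
  unfolding blinfun_apply_blinfun_compose
  by (rule continuous_on_sot_apply_interval[OF P'_cont P_continuous],
      rule continuous_on_sot_apply_interval[OF P_continuous P'_cont])

text \<open>Of the two terms of the commutator, \<open>P P'\<close> annihilates the range of
  \<open>P\<close>, since \<open>P P' P = 0\<close>; on the kernel it is \<open>P' P\<close> that
  drops out.\<close>

lemma negl_Kc_range: "negl in_range Kc"
proof -
  have "negl in_range (\<lambda>t. P t o\<^sub>L P' t)"
    by (rule negl_zero) (metis P_P'_P blinfun_apply_blinfun_compose)
  from negl_diff[OF P'_P_continuous(1) negl_P'_range P'_P_continuous(2) this]
  show ?thesis unfolding Kc_def[abs_def] commutator_def .
qed

lemma negl_Kc_kernel:
  assumes "reflexive_space TYPE('a)"
    and "\<And>t. t \<in> {0..1} \<Longrightarrow> (P has_vector_derivative P' t) (at t within {0..1})"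
  shows "negl in_kernel Kc"
proof -
  have "negl in_kernel (\<lambda>t. P' t o\<^sub>L P t)"
    by (rule negl_zero) simp
  from negl_diff[OF P'_P_continuous(1) this P'_P_continuous(2) negl_P'_kernel[OF assms]]
  show ?thesis unfolding Kc_def[abs_def] commutator_def .
qed

lemma negl_Kc_imp_close:
  assumes "negl S Kc" "\<eta> > 0"
  shows "\<forall>\<^sub>F \<epsilon> in at_right 0. \<forall>v t. Sol_in S \<epsilon> v \<longrightarrow> t \<in> {0..1} \<longrightarrow> norm (v t - U \<epsilon> t 0 (v 0)) \<le> \<eta> * norm (v 0)"
  using assms(1)[unfolded negl_def, rule_format, OF assms(2)]
  by eventually_elim (simp add: Sol_integral[OF Sol_inD(1,2)])

subsection \<open>The adiabatic theorem\<close>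

text \<open>The operator \<open>A P\<close> equals \<open>N + \<lambda> P\<close>, so the generator
  is bounded and strongly continuous, and the Dyson series applies.\<close>

lemma adiabatic_generator_exists:
  "\<exists>V. evolution_system (\<lambda>t. UNIV) (\<lambda>t x. (1 / \<epsilon>) *\<^sub>R A t (P t x) + commutator (P' t) (P t) x) V"
proof -
  define G where "G t = (1 / \<epsilon>) *\<^sub>R (N t + (cmul (l t) o\<^sub>L P t)) + Kc t" for t
  have G_apply: "(1 / \<epsilon>) *\<^sub>R A t (P t x) + commutator (P' t) (P t) x = G t x" if "t \<in> {0..1}" for t x
    by (simp add: G_def N_simps(5)[OF that] Kc_def blinfun.bilinear_simps)
  have "continuous_on {0..1} (\<lambda>t. G t x)" for x
    unfolding G_def blinfun.add_left blinfun.scaleR_left blinfun_apply_blinfun_compose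
    by (intro continuous_on_add continuous_on_scaleR continuous_on_const N_continuous Kc_continuous
        continuous_on_sot_apply_interval[OF sot_C1_on_continuous[OF sot_C1_on_cmul[OF l_C1]] P_continuous])
  moreover from sot_bounded[OF this] obtain K where "\<And>t. t \<in> {0..1} \<Longrightarrow> norm (G t) \<le> K" by blast
  moreover have "complex_linear_op (G t)" if "t \<in> {0..1}" for t
    unfolding G_def Kc_def commutator_def
    by (intro complex_linear_op_simps N_simps(3) P_simps(2) P'_linear that)
  ultimately have "sot_generator G K" by (intro sot_generator.intro)
  from sot_generator.propagator_evolution_system[OF this G_apply] show ?thesis by blast
qed

text \<open>As \<open>P A P = A P\<close>, the singular term cancels in the equation for
  \<open>v - P v\<close>. This difference solves the transport equation with initial value zero and
  so vanishes; then \<open>A P v = A v\<close>, and \<open>v\<close> is a solution in the sense of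
  \<open>Sol\<close>.\<close>

lemma Sol_reduced:
  fixes x :: 'a
  assumes V: "evolution_system (\<lambda>t. UNIV) (\<lambda>t x. (1 / \<epsilon>) *\<^sub>R A t (P t x) + commutator (P' t) (P t) x) V"
  defines "v \<equiv> \<lambda>t. V t 0 (P 0 x)"
  shows "Sol \<epsilon> v" "\<forall>t\<in>{0..1}. P t (v t) = v t" "v 0 = P 0 x"
proof -
  have 0: "(0::real) \<in> {0..<1}" "(0::real) \<in> {0..1}" by auto
  show v0: "v 0 = P 0 x" using V 0 unfolding evolution_system_def v_def by blast
  have v': "(v has_vector_derivative (1 / \<epsilon>) *\<^sub>R A t (P t (v t)) + Kc t (v t)) (at t within {0..1})"
    if "t \<in> {0..1}" for t
    using V 0(1) that unfolding evolution_system_def v_def Kc_def by blast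
  have v_cont: "continuous_on {0..1} v"
    by (rule continuous_on_vector_derivative[OF v'])
  obtain K where "sot_generator Kc K" using Kc_generator by blast
  then interpret gen: sot_generator Kc K .
  obtain C where C: "\<And>s. s \<in> {0..1} \<Longrightarrow> norm (P s) \<le> C" using sot_bounded[OF P_continuous] by blast
  have "gen.solves (\<lambda>t. v t - P t (v t))"
    unfolding gen.solves_def
  proof
    fix t :: real assume t: "t \<in> {0..1}"
    let ?v' = "(1 / \<epsilon>) *\<^sub>R A t (P t (v t)) + Kc t (v t)"
    have lim: "((\<lambda>s. P s ?v') \<longlongrightarrow> P t ?v') (at t within {0..1})"
      using P_continuous t unfolding continuous_on_def by blast
    have "((\<lambda>s. P s (v s)) has_vector_derivative P' t (v t) + P t ?v') (at t within {0..1})"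
      by (rule has_vector_derivative_sot_apply[OF C lim P_deriv[OF t] v'[OF t]])
    from has_vector_derivative_diff[OF v'[OF t] this]
    show "((\<lambda>t. v t - P t (v t)) has_vector_derivative Kc t (v t - P t (v t))) (at t within {0..1})"
      by (simp add: blinfun.bilinear_simps P_AP[OF t] Kc_intertwine[OF t, symmetric] algebra_simps)
  qed
  moreover have "gen.solves (\<lambda>t. 0)" by (simp add: gen.solves_def)
  ultimately have "v t - P t (v t) = 0" if "t \<in> {0..1}" for t
    by (rule gen.solves_unique[OF _ _ 0(2) _ that]) (simp add: v0 P_simps(1)[OF 0(2)])
  then show Pv: "\<forall>t\<in>{0..1}. P t (v t) = v t" by simp
  show "Sol \<epsilon> v"
    unfolding Sol_def
  proof (intro conjI ballI)
    fix t :: real assume t: "t \<in> {0..1}"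
    show "v t \<in> D t" using P_simps(6)[OF t, of "v t"] Pv t by simp
    show "(v has_vector_derivative (1 / \<epsilon>) *\<^sub>R A t (v t) + Kc t (v t)) (at t within {0..1})"
      using v'[OF t] Pv t by simp
  next
    have "continuous_on {0..1} (\<lambda>t. N t (v t) + cmul (l t) (v t))"
      by (intro continuous_on_add continuous_on_sot_apply_interval[OF N_continuous v_cont]
          continuous_on_sot_apply_interval[OF sot_C1_on_continuous[OF sot_C1_on_cmul[OF l_C1]] v_cont])
    then show "continuous_on {0..1} (\<lambda>t. A t (v t))"
      by (rule continuous_on_cong[THEN iffD1, OF refl, rotated])
        (use N_simps(5) Pv in \<open>metis cmul_apply\<close>)
  qed
qed

lemma adiabatic_reduced:
  assumes V: "\<And>\<epsilon>. \<epsilon> > 0 \<Longrightarrow> evolution_system (\<lambda>t. UNIV)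
      (\<lambda>t x. (1 / \<epsilon>) *\<^sub>R A t (P t x) + commutator (P' t) (P t) x) (V \<epsilon>)"
  shows "((\<lambda>\<epsilon>. SUP t\<in>{0..1}. norm ((U \<epsilon> t 0 - V \<epsilon> t 0) o\<^sub>L P 0)) \<longlongrightarrow> 0) (at_right 0)"
proof (rule SUP_tendsto_zero)
  fix \<eta> :: real assume eta: "\<eta> > 0"
  define c where "c = norm (P 0) + 1"
  have c: "c > 0" by (simp add: c_def add_nonneg_pos)
  have "\<eta> / c > 0" using eta c by simp
  from eventually_at_right_less[of 0] negl_Kc_imp_close[OF negl_Kc_range this]
  show "\<forall>\<^sub>F \<epsilon> in at_right 0. \<forall>t\<in>{0..1}. norm ((U \<epsilon> t 0 - V \<epsilon> t 0) o\<^sub>L P 0) \<le> \<eta>"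
  proof (eventually_elim, intro ballI norm_blinfun_bound)
    fix \<epsilon> t :: real and x
    assume e: "0 < \<epsilon>" and t: "t \<in> {0..1}"
      and close: "\<forall>v t. Sol_in in_range \<epsilon> v \<longrightarrow> t \<in> {0..1} \<longrightarrow> norm (v t - U \<epsilon> t 0 (v 0)) \<le> \<eta> / c * norm (v 0)"
    note S = Sol_reduced[OF V[OF e], of x]
    have "norm (((U \<epsilon> t 0 - V \<epsilon> t 0) o\<^sub>L P 0) x) = norm (V \<epsilon> t 0 (P 0 x) - U \<epsilon> t 0 (P 0 x))"
      by (simp add: blinfun.diff_left norm_minus_commute)
    also have "\<dots> \<le> \<eta> / c * norm (P 0 x)"
      using close[rule_format, of "\<lambda>t. V \<epsilon> t 0 (P 0 x)" t] e S t by (simp add: Sol_in_def)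
    also have "\<dots> \<le> \<eta> / c * (c * norm x)"
      using eta c order_trans[OF norm_blinfun[of "P 0" x] mult_right_mono[of "norm (P 0)" c "norm x"]]
      by (intro mult_left_mono) (auto simp: c_def)
    finally show "norm (((U \<epsilon> t 0 - V \<epsilon> t 0) o\<^sub>L P 0) x) \<le> \<eta> * norm x" using c by simp
  qed (use eta in simp)
qed simp

lemma adiabatic_full:
  assumes reflexive: "reflexive_space TYPE('a)"
    and P_norm_deriv: "\<And>t. t \<in> {0..1} \<Longrightarrow> (P has_vector_derivative P' t) (at t within {0..1})"
    and V: "\<And>\<epsilon>. \<epsilon> > 0 \<Longrightarrow> evolution_system D
      (\<lambda>t x. (1 / \<epsilon>) *\<^sub>R A t x + commutator (P' t) (P t) x) (V \<epsilon>)"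
  shows "((\<lambda>\<epsilon>. SUP t\<in>{0..1}. norm (U \<epsilon> t 0 - V \<epsilon> t 0)) \<longlongrightarrow> 0) (at_right 0)"
proof (rule SUP_tendsto_zero)
  have 0: "(0::real) \<in> {0..<1}" "(0::real) \<in> {0..1}" by auto
  fix \<eta> :: real assume eta: "\<eta> > 0"
  \<comment> \<open>A bound for the norms of \<open>P 0\<close> and \<open>1 - P 0\<close> together,
    since the two components of the initial value are estimated separately.\<close>
  define c where "c = 2 * norm (P 0) + 1"
  have c: "c > 0" by (simp add: c_def add_nonneg_pos)
  have "\<eta> / c > 0" using eta c by simp
  moreover have "negl in_kernel Kc" by (rule negl_Kc_kernel[OF reflexive P_norm_deriv])
  ultimately have close: "\<forall>\<^sub>F \<epsilon> in at_right 0. \<forall>v t. Sol_in S \<epsilon> v \<longrightarrow> t \<in> {0..1} \<longrightarrow>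
      norm (v t - U \<epsilon> t 0 (v 0)) \<le> \<eta> / c * norm (v 0)" if "S = in_range \<or> S = in_kernel" for S
    using that negl_Kc_range negl_Kc_imp_close by blast
  from eventually_at_right_less[of 0] close[OF disjI1[OF refl]] close[OF disjI2[OF refl]]
  show "\<forall>\<^sub>F \<epsilon> in at_right 0. \<forall>t\<in>{0..1}. norm (U \<epsilon> t 0 - V \<epsilon> t 0) \<le> \<eta>"
  proof (eventually_elim, intro ballI norm_blinfun_bound)
    fix \<epsilon> t :: real and x
    assume e: "0 < \<epsilon>" and t: "t \<in> {0..1}"
      and e1: "\<forall>v t. Sol_in in_range \<epsilon> v \<longrightarrow> t \<in> {0..1} \<longrightarrow> norm (v t - U \<epsilon> t 0 (v 0)) \<le> \<eta> / c * norm (v 0)"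
      and e2: "\<forall>v t. Sol_in in_kernel \<epsilon> v \<longrightarrow> t \<in> {0..1} \<longrightarrow> norm (v t - U \<epsilon> t 0 (v 0)) \<le> \<eta> / c * norm (v 0)"
    have main: "norm ((U \<epsilon> t 0 - V \<epsilon> t 0) x) \<le> \<eta> * norm x" if x: "x \<in> D 0" for x
    proof -
      define v where "v s = V \<epsilon> s 0 x" for s
      note ev = V[OF e, unfolded evolution_system_def, THEN conjunct2, THEN conjunct1, rule_format, OF 0(1) x]
      have v0: "v 0 = x" using ev by (simp add: v_def)
      have v': "v s \<in> D s" "(v has_vector_derivative (1 / \<epsilon>) *\<^sub>R A s (v s) + Kc s (v s)) (at s within {0..1})"
        if "s \<in> {0..1}" for s
        using ev that unfolding v_def Kc_def by blast+
      have v_cont: "continuous_on {0..1} v"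
        by (rule continuous_on_vector_derivative[OF v'(2)])
      have gen_cont: "continuous_on {0..1} (\<lambda>s. (1 / \<epsilon>) *\<^sub>R A s (v s) + Kc s (v s))"
        using ev unfolding v_def Kc_def by blast
      \<comment> \<open>Only the full right-hand side is known to be continuous; subtracting
        \<open>Kc s (v s)\<close> recovers the continuity of \<open>A s (v s)\<close>.\<close>
      have "continuous_on {0..1} (\<lambda>s. \<epsilon> *\<^sub>R (((1 / \<epsilon>) *\<^sub>R A s (v s) + Kc s (v s)) - Kc s (v s)))"
        by (intro continuous_on_scaleR continuous_on_const continuous_on_diff gen_cont
            continuous_on_sot_apply_interval[OF Kc_continuous v_cont])
      then have "continuous_on {0..1} (\<lambda>s. A s (v s))" using e by simp
      then have v: "Sol \<epsilon> v" unfolding Sol_def using v' by blast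
      note vP = Sol_P[OF v]
      note vQ = Sol_diff[OF v vP]
      have 1: "norm (P t (v t) - U \<epsilon> t 0 (P 0 (v 0))) \<le> \<eta> / c * norm (P 0 (v 0))"
        using e vP t by (intro e1[rule_format]) (auto simp: Sol_in_def P_simps)
      have 2: "norm ((v t - P t (v t)) - U \<epsilon> t 0 (v 0 - P 0 (v 0))) \<le> \<eta> / c * norm (v 0 - P 0 (v 0))"
        using e vQ t by (intro e2[rule_format]) (auto simp: Sol_in_def P_simps blinfun.diff_right)
      have "norm ((U \<epsilon> t 0 - V \<epsilon> t 0) x) = norm (v t - U \<epsilon> t 0 x)"
        by (simp add: blinfun.diff_left norm_minus_commute v_def)
      also have "v t - U \<epsilon> t 0 x = (P t (v t) - U \<epsilon> t 0 (P 0 (v 0))) +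
          ((v t - P t (v t)) - U \<epsilon> t 0 (v 0 - P 0 (v 0)))"
        by (simp add: v0 blinfun.diff_right)
      also have "norm \<dots> \<le> \<eta> / c * norm (P 0 x) + \<eta> / c * norm (x - P 0 x)"
        using 1 2 unfolding v0 by (rule order_trans[OF norm_triangle_ineq add_mono])
      also have "\<dots> = \<eta> / c * (norm (P 0 x) + norm (x - P 0 x))" by (simp add: distrib_left)
      also have "\<dots> \<le> \<eta> / c * (c * norm x)"
      proof (rule mult_left_mono)
        show "norm (P 0 x) + norm (x - P 0 x) \<le> c * norm x"
          using norm_triangle_ineq4[of x "P 0 x"] norm_blinfun[of "P 0" x]
          by (simp add: c_def algebra_simps)
      qed (use eta c in simp)
      finally show ?thesis using c by simp
    qed
    \<comment> \<open>Classical solutions start in \<open>D 0\<close>; density carries the estimate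
      to all initial values.\<close>
    have "closed {x. norm ((U \<epsilon> t 0 - V \<epsilon> t 0) x) \<le> \<eta> * norm x}"
      by (intro closed_Collect_le continuous_intros)
    then have "closure (D 0) \<subseteq> {x. norm ((U \<epsilon> t 0 - V \<epsilon> t 0) x) \<le> \<eta> * norm x}"
      using main by (intro closure_minimal) auto
    then show "norm ((U \<epsilon> t 0 - V \<epsilon> t 0) x) \<le> \<eta> * norm x"
      using D_dense[OF 0(2)] by auto
  qed (use eta in simp)
qed simp

end

theorem theorem5p4:
  fixes D :: "real \<Rightarrow> 'a::complex_banach set"
    and A :: "real \<Rightarrow> 'a \<Rightarrow> 'a"
    and U :: "real \<Rightarrow> real \<Rightarrow> real \<Rightarrow> 'a \<Rightarrow>\<^sub>L 'a"
    and M \<delta>\<^sub>0 M\<^sub>0 M\<^sub>0' :: real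
    and l :: "real \<Rightarrow> complex"
    and \<theta> :: "real \<Rightarrow> real"
    and P :: "real \<Rightarrow> 'a \<Rightarrow>\<^sub>L 'a"
    and m\<^sub>0 :: nat
  defines "R \<equiv> \<lambda>\<delta> t. resolvent (D t) (A t) (l t + of_real \<delta> * cis (\<theta> t))"
    and "P' \<equiv> sot_deriv {0..1} P"
  assumes A_closed: "\<And>t. t \<in> {0..1} \<Longrightarrow> densely_defined_closed (D t) (A t)"
    and U_evol: "\<And>\<epsilon>. \<epsilon> > 0 \<Longrightarrow> evolution_system D (\<lambda>t x. (1 / \<epsilon>) *\<^sub>R A t x) (U \<epsilon>)"
    and M_ge: "M \<ge> 1"
    and U_bound: "\<And>\<epsilon> s t. \<epsilon> > 0 \<Longrightarrow> 0 \<le> s \<Longrightarrow> s \<le> t \<Longrightarrow> t \<le> 1 \<Longrightarrow> norm (U \<epsilon> t s) \<le> M"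
    and eigen: "\<And>t. t \<in> {0..1} \<Longrightarrow> eigenvalue (D t) (A t) (l t)"
    and delta0_pos: "\<delta>\<^sub>0 > 0"
    and in_rho: "\<And>t \<delta>. t \<in> {0..1} \<Longrightarrow> \<delta> \<in> {0<..\<delta>\<^sub>0} \<Longrightarrow>
                   l t + of_real \<delta> * cis (\<theta> t) \<in> resolvent_set (D t) (A t)"
    and l_C1: "C1_on {0..1} l"
    and cis_C1: "C1_on {0..1} (\<lambda>t. cis (\<theta> t))"
    and R_C1: "\<And>\<delta>. \<delta> \<in> {0<..\<delta>\<^sub>0} \<Longrightarrow> sot_C1_on {0..1} (R \<delta>)"
    and P_proj: "\<And>t. t \<in> {0..1} \<Longrightarrow> bounded_projection (P t)"
    and P_comm: "\<And>t. t \<in> {0..1} \<Longrightarrow> commutes_with (P t) (D t) (A t)"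
    and P_assoc: "AE t in lebesgue. t \<in> {0..1} \<longrightarrow> weakly_associated (D t) (A t) (l t) (P t)"
    and P_ker: "\<And>t. t \<in> {0..1} \<Longrightarrow> range (P t) \<subseteq> kernel_power (D t) (A t) (l t) m\<^sub>0"
    and M0_pos: "M\<^sub>0 > 0" "M\<^sub>0' > 0"
    and R_bound: "\<And>t \<delta>. t \<in> {0..1} \<Longrightarrow> \<delta> \<in> {0<..\<delta>\<^sub>0} \<Longrightarrow>
                    norm (R \<delta> t o\<^sub>L (id_blinfun - P t)) \<le> M\<^sub>0 / \<delta>"
    and R'_bound: "\<And>t \<delta>. t \<in> {0..1} \<Longrightarrow> \<delta> \<in> {0<..\<delta>\<^sub>0} \<Longrightarrow>
                    norm (sot_deriv {0..1} (\<lambda>s. R \<delta> s o\<^sub>L (id_blinfun - P s)) t)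
                      \<le> M\<^sub>0' / \<delta> ^ (m\<^sub>0 + 1)"
    and P0_rank: "finite_rank (P 0)"
    and P_C1: "sot_C1_on {0..1} P"
  shows "(\<forall>\<epsilon>>0. \<exists>V\<^sub>0. evolution_system (\<lambda>t. UNIV)
            (\<lambda>t x. (1 / \<epsilon>) *\<^sub>R A t (P t x) + commutator (P' t) (P t) x) V\<^sub>0)
       \<and> (\<forall>V\<^sub>0. (\<forall>\<epsilon>>0. evolution_system (\<lambda>t. UNIV)
            (\<lambda>t x. (1 / \<epsilon>) *\<^sub>R A t (P t x) + commutator (P' t) (P t) x) (V\<^sub>0 \<epsilon>)) \<longrightarrow>
          ((\<lambda>\<epsilon>. SUP t\<in>{0..1}. norm ((U \<epsilon> t 0 - V\<^sub>0 \<epsilon> t 0) o\<^sub>L P 0)) \<longlongrightarrow> 0) (at_right 0))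
       \<and> (reflexive_space TYPE('a) \<and> C1_on {0..1} P \<longrightarrow>
          (\<forall>V. (\<forall>\<epsilon>>0. evolution_system D
            (\<lambda>t x. (1 / \<epsilon>) *\<^sub>R A t x + commutator (P' t) (P t) x) (V \<epsilon>)) \<longrightarrow>
          ((\<lambda>\<epsilon>. SUP t\<in>{0..1}. norm (U \<epsilon> t 0 - V \<epsilon> t 0)) \<longlongrightarrow> 0) (at_right 0)))"
proof -
  have res: "is_resolvent (D t) (A t) (l t + of_real \<delta> * cis (\<theta> t)) (R \<delta> t)"
    if t: "t \<in> {0..1}" and d: "\<delta> \<in> {0<..\<delta>\<^sub>0}" for t \<delta>
  proof -
    let ?c = "l t + of_real \<delta> * cis (\<theta> t)"
    obtain T where T: "is_resolvent (D t) (A t) ?c T"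
      using in_rho[OF t d] unfolding resolvent_set_def by blast
    moreover have "S = T" if "is_resolvent (D t) (A t) ?c S" for S
      using that T unfolding is_resolvent_def by (metis blinfun_eqI)
    ultimately show ?thesis unfolding R_def resolvent_def by (rule theI)
  qed
  interpret adiabatic D A U M \<delta>\<^sub>0 M\<^sub>0 l "\<lambda>t. cis (\<theta> t)" R P P' m\<^sub>0
  proof
    show "linear_operator (D t) (A t)" "closure (D t) = UNIV" if "t \<in> {0..1}" for t
      using A_closed[OF that] unfolding densely_defined_closed_def by blast+
    show "((\<lambda>s. P s x) has_vector_derivative P' t x) (at t within {0..1})" if "t \<in> {0..1}" for t x
      unfolding P'_def by (rule sot_C1_on_sot_deriv(1)[OF P_C1 that])
    show "continuous_on {0..1} (\<lambda>t. P' t x)" for x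
      unfolding P'_def by (rule sot_C1_on_sot_deriv(2)[OF P_C1])
  qed (fact U_evol M_ge U_bound delta0_pos res cis_C1 R_C1 l_C1 P_proj P_comm P_assoc P_ker R_bound P0_rank
      | simp)+
  \<comment> \<open>A norm derivative is also a strong one, and the latter is unique, so it is the
    \<open>P'\<close> already in use.\<close>
  have norm_deriv: "(P has_vector_derivative P' t) (at t within {0..1})" if C1: "C1_on {0..1} P" and t: "t \<in> {0..1}" for t
  proof -
    obtain F where F: "(P has_vector_derivative F) (at t within {0..1})"
      using C1 t unfolding C1_on_def by blast
    then have "has_sot_derivative P F t {0..1}"
      unfolding has_sot_derivative_def
      using bounded_linear.has_vector_derivative[OF blinfun.bounded_linear_left] by blast
    then have "P' t = F" unfolding P'_def by (rule sot_deriv_eq[OF t])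
    then show ?thesis using F by simp
  qed
  show ?thesis
    using adiabatic_generator_exists adiabatic_reduced adiabatic_full norm_deriv by blast
qed

end
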